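(* Let $n\ge2$ and $p\ge1$ be integers. Assume that the operators $C_{i\,i-1}$, $i=2,\dots,n$, satisfy the Coupling hypothesis of order $n$, where the operators $\Pi_i$ satisfy the Coupling observability hypothesis of order $n$. Assume that the operators $C_{i\,j}$ and $C_{i\,j}^{*}$ are in $\mathcal L(H_k)$ for $i\in\{n+1,\dots,n+p\}$, $j\in\{n-1,\dots,i-1\}$ and $k=0,1$. Let $\mathbf{B}_{n+j}^{*}$, $j=0,\dots,p$, be any given operators such that $\mathbf{B}_{n+j}^{*}$ satisfies the Admissibility and Observability hypotheses of index $n+j$ for all $j\in\{0,\dots,p\}$. Then for all $T>0$ there exists $C(T)>0$ such that all solutions $U$ of the mixed cascade system satisfy the direct inequality $$\sum_{j=0}^p\int_0^T\|\mathbf{B}_{n+j}^{*}U_{n+j}\|_{G_{n+j}}^2dt\le C(T)\Big(\sum_{i=1}^ne_{1+i-n}(U_i)(0)+\sum_{j=1}^pe_1(U_{n+j})(0)\Big).$$ Moreover, there exists $T_{n+p}^{*}>0$ such that for all $T>T_{n+p}^{*}$ all solutions $U$ of the mixed cascade system satisfy the observability inequalities $$e_{1+i-n}(U_i)(0)\le d_{i,n}(T)\int_0^T\|\mathbf{B}_n^{*}(U_n)\|_{G_n}^2dt\qquad\forall\,i=1,\dots,n,$$ $$e_1(U_{n+k})(0)\le\rho_{n,k}(T)\sum_{l=0}^k\int_0^T\|\mathbf{B}_{n+l}^{*}(U_{n+l})\|_{G_{n+l}}^2dt\qquad\forall\,k=1,\dots,p,$$ where $d_{i,n}(T)>0$ are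 constants satisfying $d_{i,n}(T)\le K/T^3$ for $i\in\{1,\dots,n-1\}$ and $d_{n,n}(T)\le K/T$ with $K$ bounded with respect to $T$, and where $\rho_{n,k}(T)>0$ are constants depending on $n$, $k$ and $T$.
   Context: Abstract setting. $H$ is a Hilbert space with norm $|\cdot|$ and scalar product $\langle\cdot,\cdot\rangle$. $A:D(A)\subset H\to H$ is a positive self-adjoint operator with compact resolvent such that, for some $\omega>0$, $|Au|\ge\omega|u|$ for all $u\in D(A)$. For $k\in\mathbb N$, $H_k=D(A^{k/2})$ with norm $|A^{k/2}\cdot|$ ($H_0=H$), and $H_{-k}$ is the dual of $H_k$ with pivot space $H$, with norm $|A^{-k/2}\cdot|$. For $k\in\mathbb Z$ and a pair $W=(w,w')$, $e_k(W)=\frac12\big(|A^{k/2}w|^2+|A^{(k-1)/2}w'|^2\big)$. Coupling hypothesis of order $n$. For all $i\in\{2,\dots,n\}$: $C_{i\,i-1}$ is a bounded operator on $H$; $C_{i\,i-1}^{*}\in\mathcal L(H_k)$ for $k\in\{0,1,\dots,n-i+1\}$; $\|C_{i\,i-1}\|=\beta_i$ and $|C_{i\,i-1}w|^2\le\beta_i\langle C_{i\,i-1}w,w\rangle$ for all $w\in H$; there exists $\alpha_i>0$ such that $\alpha_i|\Pi_iw|^2\le\langle C_{i\,i-1}w,w\rangle$ for all $w\in H$. Coupling observability hypothesis of order $n$. For all $i\in\{2,\dots,n\}$: $\Pi_i\in\mathcal L(H)$ and there exists $T_{0,i}>0$ such that for all $T>T_{0,i}$ there exists $\gamma_i(T)>0$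 such that all solutions $w$ of $w''+Aw=0$ satisfy $\int_0^T|\Pi_iw'|^2dt\ge\gamma_i(T)e_1(W)(0)$, where $W=(w,w')$. Admissibility hypothesis of index $m$. $G_m$ is a Hilbert space (identified with its dual), $\mathbf{B}_m^{*}\in\mathcal L(H_2\times H;G_m)$, and for all $T>0$ there exists $D_m(T)>0$ such that all solutions $w$ of $w''+Aw=f\in L^2([0,T];H)$ satisfy, with $W=(w,w')$, $$\int_0^T\|\mathbf{B}_m^{*}(w,w')\|_{G_m}^2dt\le D_m(T)\Big(e_1(W)(0)+e_1(W)(T)+\int_0^Te_1(W)(t)\,dt+\int_0^T|f|^2dt\Big).$$ For solutions of energy regularity the observation is understood through the extension by density given by this inequality. Observability hypothesis of index $m$. There exists $T_{0,m}>0$ such that for all $T>T_{0,m}$ there exists $R_m(T)>0$ such that all solutions $w$ of $w''+Aw=0$ satisfy $\int_0^T\|\mathbf{B}_m^{*}(w,w')\|_{G_m}^2dt\ge R_m(T)e_1(W)(0)$. Mixed cascade system of order $n+p$: $$u_1''+Au_1=0,\qquad u_i''+Au_i+C_{i\,i-1}u_{i-1}=0\ (2\le i\le n),\qquad u_i''+Au_i+\sum_{k=n-1}^{i-1}C_{i\,k}u_k=0\ (n+1\le i\le n+p),$$ with initial data $(u_1,\dots,u_{n+p},u_1',\dots,u_{n+p}')(0)\in H_1^{n+p}\times H^{n+p}$; $U_i=(u_i,u_i')$. *)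

theory Defs
  imports "HOL-Analysis.Analysis"
begin

text \<open>
  An unbounded operator on a Hilbert space \<open>'h\<close> is identified with its graph, a subset of
  \<open>'h \<times> 'h\<close>: the library's \<open>Domain\<close>, \<open>O\<close>, \<open>^^\<close> and \<open>converse\<close> are then the domain, the composition
  (on its natural domain), the powers and the inverse.
\<close>

definition op_app :: "('h \<times> 'h) set \<Rightarrow> 'h \<Rightarrow> 'h" where
  "op_app A u = (THE v. (u, v) \<in> A)"

definition adjoint_graph :: "('h::real_inner \<times> 'h) set \<Rightarrow> ('h \<times> 'h) set" where
  "adjoint_graph A = {(y, z). \<forall>(x, w)\<in>A. w \<bullet> y = x \<bullet> z}"

definition self_adjoint :: "('h::real_inner \<times> 'h) set \<Rightarrow> bool" where
  "self_adjoint A \<longleftrightarrow> closure (Domain A) = UNIV \<and> adjoint_graph A = A"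

definition positive_op :: "('h::real_inner \<times> 'h) set \<Rightarrow> bool" where
  "positive_op A \<longleftrightarrow> (\<forall>(u, v)\<in>A. 0 \<le> v \<bullet> u)"

text \<open>For some \<open>\<mu>\<close>, the map \<open>(A - \<mu>)\<^sup>-\<^sup>1\<close> is everywhere defined and sends the unit ball to a relatively
  compact set. On a real space \<open>\<mu>\<close> is real.\<close>

definition compact_resolvent :: "('h::real_inner \<times> 'h) set \<Rightarrow> bool" where
  "compact_resolvent A \<longleftrightarrow>
     (\<exists>\<mu>::real. (\<forall>z. \<exists>!u. (u, z + \<mu> *\<^sub>R u) \<in> A) \<and>
        compact (closure {u. \<exists>z. norm z \<le> 1 \<and> (u, z + \<mu> *\<^sub>R u) \<in> A}))"

definition sqrt_op :: "('h::real_inner \<times> 'h) set \<Rightarrow> ('h \<times> 'h) set" where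
  "sqrt_op A = (THE S. self_adjoint S \<and> positive_op S \<and> S O S = A)"

text \<open>\<open>half_pow A k\<close> is \<open>A\<close> raised to the power \<open>k/2\<close>. For \<open>k < 0\<close> and \<open>A\<close> boundedly invertible it is
  defined on the whole of \<open>'h\<close>, and \<open>Hnorm A k\<close> is the norm of the dual space \<open>H\<^sub>k\<close> on the
  pivot space. Negative orders are only ever applied to elements of the pivot space.\<close>

definition half_pow :: "('h::real_inner \<times> 'h) set \<Rightarrow> int \<Rightarrow> ('h \<times> 'h) set" where
  "half_pow A k = (if 0 \<le> k then sqrt_op A ^^ nat k else (converse (sqrt_op A)) ^^ nat (- k))"

definition Hsp :: "('h::real_inner \<times> 'h) set \<Rightarrow> nat \<Rightarrow> 'h set" where
  "Hsp A k = Domain (half_pow A (int k))"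

definition Hnorm :: "('h::real_inner \<times> 'h) set \<Rightarrow> int \<Rightarrow> 'h \<Rightarrow> real" where
  "Hnorm A k u = norm (op_app (half_pow A k) u)"

definition energy :: "('h::real_inner \<times> 'h) set \<Rightarrow> int \<Rightarrow> 'h \<Rightarrow> 'h \<Rightarrow> real" where
  "energy A k w v = (1/2) * ((Hnorm A k w)\<^sup>2 + (Hnorm A (k - 1) v)\<^sup>2)"

text \<open>Membership in \<open>\<L>(H\<^sub>k)\<close> of (the restriction to \<open>H\<^sub>k\<close> of) a linear map on \<open>'h\<close>.\<close>

definition bounded_on_Hsp :: "('h::real_inner \<times> 'h) set \<Rightarrow> nat \<Rightarrow> ('h \<Rightarrow> 'h) \<Rightarrow> bool" where
  "bounded_on_Hsp A k F \<longleftrightarrow> linear F \<and> F ` Hsp A k \<subseteq> Hsp A k \<and>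
     (\<exists>M. \<forall>w\<in>Hsp A k. Hnorm A (int k) (F w) \<le> M * Hnorm A (int k) w)"

definition L2_on :: "real \<Rightarrow> (real \<Rightarrow> 'b::real_normed_vector) \<Rightarrow> bool" where
  "L2_on T f \<longleftrightarrow> set_borel_measurable lebesgue {0..T} f \<and>
     set_integrable lebesgue {0..T} (\<lambda>t. (norm (f t))\<^sup>2)"

text \<open>
  \<open>wave_sol A T f w v\<close>: \<open>w\<close> is a solution on \<open>[0,T]\<close> of \<open>w'' + A w = f\<close> with \<open>w' = v\<close>, of energy
  regularity: \<open>w\<close> lies in \<open>C([0,T];H\<^sub>1)\<close> and in \<open>C\<^sup>1([0,T];H)\<close>, and the equation holds in the dual
  \<open>H\<^sub>-\<^sub>1\<close> of \<open>H\<^sub>1\<close>, i.e. after pairing with every \<open>\<phi>\<close> in \<open>H\<^sub>1\<close>, where \<open>A w\<close> acts as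
  \<open>\<phi> \<mapsto> \<langle>A\<^sup>1\<^sup>/\<^sup>2 w, A\<^sup>1\<^sup>/\<^sup>2 \<phi>\<rangle>\<close>. It is written integrated in time because \<open>f\<close> is only
  square integrable.
\<close>

definition wave_sol ::
  "('h::real_inner \<times> 'h) set \<Rightarrow> real \<Rightarrow> (real \<Rightarrow> 'h) \<Rightarrow> (real \<Rightarrow> 'h) \<Rightarrow> (real \<Rightarrow> 'h) \<Rightarrow> bool" where
  "wave_sol A T f w v \<longleftrightarrow>
     L2_on T f \<and>
     (\<forall>t\<in>{0..T}. w t \<in> Hsp A 1) \<and>
     continuous_on {0..T} (\<lambda>t. op_app (half_pow A 1) (w t)) \<and>
     continuous_on {0..T} v \<and>
     (\<forall>t\<in>{0..T}. (w has_vector_derivative v t) (at t within {0..T})) \<and>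
     (\<forall>\<phi>\<in>Hsp A 1. \<forall>t\<in>{0..T}.
        v t \<bullet> \<phi> - v 0 \<bullet> \<phi>
          + (LINT s:{0..t}|lebesgue. op_app (half_pow A 1) (w s) \<bullet> op_app (half_pow A 1) \<phi>)
        = (LINT s:{0..t}|lebesgue. f s \<bullet> \<phi>))"

text \<open>Solutions with, in addition, \<open>w\<close> in \<open>C([0,T];H\<^sub>2)\<close>: those for which an operator on
  \<open>H\<^sub>2 \<times> H\<close> can be applied to \<open>(w, w')\<close> at every time.\<close>

definition regular_sol ::
  "('h::real_inner \<times> 'h) set \<Rightarrow> real \<Rightarrow> (real \<Rightarrow> 'h) \<Rightarrow> (real \<Rightarrow> 'h) \<Rightarrow> (real \<Rightarrow> 'h) \<Rightarrow> bool" where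
  "regular_sol A T f w v \<longleftrightarrow> wave_sol A T f w v \<and>
     (\<forall>t\<in>{0..T}. w t \<in> Hsp A 2) \<and>
     continuous_on {0..T} (\<lambda>t. op_app (half_pow A 2) (w t))"

definition adm_bound ::
  "('h::real_inner \<times> 'h) set \<Rightarrow> real \<Rightarrow> (real \<Rightarrow> 'h) \<Rightarrow> (real \<Rightarrow> 'h) \<Rightarrow> (real \<Rightarrow> 'h) \<Rightarrow> real" where
  "adm_bound A T f w v =
     energy A 1 (w 0) (v 0) + energy A 1 (w T) (v T)
       + (LINT t:{0..T}|lebesgue. energy A 1 (w t) (v t))
       + (LINT t:{0..T}|lebesgue. (norm (f t))\<^sup>2)"

text \<open>\<open>B\<close> lies in \<open>\<L>(H\<^sub>2 \<times> H; G)\<close>. The Hilbert space \<open>G\<close> is a closed subspace of an ambient one, so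
  that a family of different spaces \<open>G\<^sub>m\<close> lives in one type (e.g. their Hilbert sum).\<close>

definition observation_op ::
  "('h::real_inner \<times> 'h) set \<Rightarrow> 'g::real_inner set \<Rightarrow> ('h \<times> 'h \<Rightarrow> 'g) \<Rightarrow> bool" where
  "observation_op A G B \<longleftrightarrow>
     subspace G \<and> closed G \<and>
     (\<forall>x\<in>Hsp A 2 \<times> UNIV. B x \<in> G) \<and>
     (\<forall>x\<in>Hsp A 2 \<times> UNIV. \<forall>y\<in>Hsp A 2 \<times> UNIV. B (x + y) = B x + B y) \<and>
     (\<forall>c. \<forall>x\<in>Hsp A 2 \<times> UNIV. B (c *\<^sub>R x) = c *\<^sub>R B x) \<and>
     (\<exists>M. \<forall>w\<in>Hsp A 2. \<forall>v. norm (B (w, v)) \<le> M * sqrt ((Hnorm A 2 w)\<^sup>2 + (norm v)\<^sup>2))"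

text \<open>The admissibility inequality is stated for the solutions on which \<open>B\<close> is pointwise defined, and
  is then what makes the extension by density below well defined.\<close>

definition admissible ::
  "('h::real_inner \<times> 'h) set \<Rightarrow> 'g::real_inner set \<Rightarrow> ('h \<times> 'h \<Rightarrow> 'g) \<Rightarrow> bool" where
  "admissible A G B \<longleftrightarrow>
     observation_op A G B \<and>
     (\<forall>T>0. \<exists>D>0. \<forall>f w v. regular_sol A T f w v \<longrightarrow>
        (LINT t:{0..T}|lebesgue. (norm (B (w t, v t)))\<^sup>2) \<le> D * adm_bound A T f w v)"

text \<open>\<open>observation\<close> is the extension by density, in \<open>L\<^sup>2(0,T;G)\<close>, of \<open>t \<mapsto> B (w t, w' t)\<close> from
  regular solutions to all solutions, for the topology given by the right-hand side of the
  admissibility inequality. It is determined up to null sets when \<open>B\<close> is admissible.\<close>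

definition is_observation ::
  "('h::real_inner \<times> 'h) set \<Rightarrow> ('h \<times> 'h \<Rightarrow> 'g::real_inner) \<Rightarrow> real \<Rightarrow>
   (real \<Rightarrow> 'h) \<Rightarrow> (real \<Rightarrow> 'h) \<Rightarrow> (real \<Rightarrow> 'h) \<Rightarrow> (real \<Rightarrow> 'g) \<Rightarrow> bool" where
  "is_observation A B T f w v y \<longleftrightarrow>
     L2_on T y \<and>
     (\<exists>F W V. (\<forall>k::nat. regular_sol A T (F k) (W k) (V k)) \<and>
        (\<lambda>k. adm_bound A T (\<lambda>t. F k t - f t) (\<lambda>t. W k t - w t) (\<lambda>t. V k t - v t)) \<longlonglongrightarrow> 0 \<and>
        (\<forall>k. set_integrable lebesgue {0..T} (\<lambda>t. (norm (B (W k t, V k t) - y t))\<^sup>2)) \<and>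
        (\<lambda>k. LINT t:{0..T}|lebesgue. (norm (B (W k t, V k t) - y t))\<^sup>2) \<longlonglongrightarrow> 0)"

definition observation ::
  "('h::real_inner \<times> 'h) set \<Rightarrow> ('h \<times> 'h \<Rightarrow> 'g::real_inner) \<Rightarrow> real \<Rightarrow>
   (real \<Rightarrow> 'h) \<Rightarrow> (real \<Rightarrow> 'h) \<Rightarrow> (real \<Rightarrow> 'h) \<Rightarrow> (real \<Rightarrow> 'g)" where
  "observation A B T f w v = (SOME y. is_observation A B T f w v y)"

definition observed ::
  "('h::real_inner \<times> 'h) set \<Rightarrow> ('h \<times> 'h \<Rightarrow> 'g::real_inner) \<Rightarrow> real \<Rightarrow>
   (real \<Rightarrow> 'h) \<Rightarrow> (real \<Rightarrow> 'h) \<Rightarrow> (real \<Rightarrow> 'h) \<Rightarrow> real" where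
  "observed A B T f w v = (LINT t:{0..T}|lebesgue. (norm (observation A B T f w v t))\<^sup>2)"

definition observable ::
  "('h::real_inner \<times> 'h) set \<Rightarrow> ('h \<times> 'h \<Rightarrow> 'g::real_inner) \<Rightarrow> bool" where
  "observable A B \<longleftrightarrow>
     (\<exists>T0>0. \<forall>T>T0. \<exists>R>0. \<forall>w v. wave_sol A T (\<lambda>t. 0) w v \<longrightarrow>
        observed A B T (\<lambda>t. 0) w v \<ge> R * energy A 1 (w 0) (v 0))"

definition coupling_hyp ::
  "('h::real_inner \<times> 'h) set \<Rightarrow> nat \<Rightarrow> (nat \<Rightarrow> nat \<Rightarrow> 'h \<Rightarrow>\<^sub>L 'h) \<Rightarrow> (nat \<Rightarrow> 'h \<Rightarrow>\<^sub>L 'h) \<Rightarrow> bool" where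
  "coupling_hyp A n C P \<longleftrightarrow>
     (\<forall>i\<in>{2..n}.
        (\<forall>k\<in>{0..n - i + 1}. bounded_on_Hsp A k (adjoint (blinfun_apply (C i (i - 1))))) \<and>
        (\<exists>\<beta>. norm (C i (i - 1)) = \<beta> \<and>
           (\<forall>w. (norm (C i (i - 1) w))\<^sup>2 \<le> \<beta> * (C i (i - 1) w \<bullet> w))) \<and>
        (\<exists>\<alpha>>0. \<forall>w. \<alpha> * (norm (P i w))\<^sup>2 \<le> C i (i - 1) w \<bullet> w))"

definition coupling_observable ::
  "('h::real_inner \<times> 'h) set \<Rightarrow> nat \<Rightarrow> (nat \<Rightarrow> 'h \<Rightarrow>\<^sub>L 'h) \<Rightarrow> bool" where
  "coupling_observable A n P \<longleftrightarrow>
     (\<forall>i\<in>{2..n}. \<exists>T0>0. \<forall>T>T0. \<exists>\<gamma>>0. \<forall>w v. wave_sol A T (\<lambda>t. 0) w v \<longrightarrow>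
        (LINT t:{0..T}|lebesgue. (norm (P i (v t)))\<^sup>2) \<ge> \<gamma> * energy A 1 (w 0) (v 0))"

text \<open>The coupling terms of the \<open>i\<close>-th equation, moved to the right-hand side.\<close>

definition cascade_source ::
  "nat \<Rightarrow> (nat \<Rightarrow> nat \<Rightarrow> 'h::real_inner \<Rightarrow>\<^sub>L 'h) \<Rightarrow> (nat \<Rightarrow> real \<Rightarrow> 'h) \<Rightarrow> nat \<Rightarrow> real \<Rightarrow> 'h" where
  "cascade_source n C u i t =
     (if i = 1 then 0
      else if i \<le> n then - C i (i - 1) (u (i - 1) t)
      else - (\<Sum>k = n - 1..i - 1. C i k (u k t)))"

definition mixed_cascade_sol ::
  "('h::real_inner \<times> 'h) set \<Rightarrow> nat \<Rightarrow> nat \<Rightarrow> (nat \<Rightarrow> nat \<Rightarrow> 'h \<Rightarrow>\<^sub>L 'h) \<Rightarrow> real \<Rightarrow>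
   (nat \<Rightarrow> real \<Rightarrow> 'h) \<Rightarrow> (nat \<Rightarrow> real \<Rightarrow> 'h) \<Rightarrow> bool" where
  "mixed_cascade_sol A n p C T u v \<longleftrightarrow>
     (\<forall>i\<in>{1..n + p}. wave_sol A T (cascade_source n C u i) (u i) (v i))"

end

theory Submission
  imports Defs
begin

text \<open>
  Let \<open>R = A\<^sup>-\<^sup>1\<^sup>/\<^sup>2\<close>, which is diagonal in an orthonormal basis of eigenvectors. A solution of
  \<open>w'' + A w = f\<close> with continuous \<open>f\<close> is a pair \<open>x = A\<^sup>1\<^sup>/\<^sup>2 w\<close>, \<open>v = w'\<close> of continuous functions
  with \<open>(R x)' = v\<close> and \<open>(R v)' = R f - x\<close>, and \<open>e\<^sub>1\<^sub>-\<^sub>k\<close> is \<open>|R\<^sup>k(x, v)|\<^sup>2 / 2\<close>.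

  Taking \<open>n - i\<close> primitives in time of a cascade turns \<open>e\<^sub>1\<^sub>+\<^sub>i\<^sub>-\<^sub>n(U\<^sub>i)\<close> into the energy \<open>e\<^sub>1\<close> of the
  \<open>i\<close>-th component; write \<open>\<sigma>\<^sub>i\<close> for the supremum over \<open>[0,T]\<close> of the square root of this energy.
  Multiplying the equations of \<open>u\<^sub>i\<close> and \<open>u\<^sub>i\<^sub>-\<^sub>1\<close> crosswise gives
  \<open>\<integral>\<langle>C u\<^sub>i\<^sub>-\<^sub>1, u\<^sub>i\<^sub>-\<^sub>1\<rangle> \<le> K \<sigma>\<^sub>i\<^sub>-\<^sub>1 \<sigma>\<^sub>i\<close>, because the lower components contribute only
  \<open>T \<cdot> K \<sigma>\<^sub>i\<^sub>-\<^sub>1 / T\<close> by induction. The left-hand side dominates \<open>\<integral>|\<Pi>\<^sub>i u\<^sub>i\<^sub>-\<^sub>1|\<^sup>2\<close>, hence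
  \<open>T \<sigma>\<^sub>i\<^sub>-\<^sub>1\<^sup>2\<close> up to a constant for large \<open>T\<close>: the source of the \<open>(i-1)\<close>-st equation is \<open>O(\<sigma>\<^sub>i\<^sub>-\<^sub>1 / T)\<close>,
  so the energy stays comparable to \<open>\<sigma>\<^sub>i\<^sub>-\<^sub>1\<^sup>2\<close> on an interval of length proportional to \<open>T\<close>, which is
  filled with observation windows of fixed length. This yields \<open>\<sigma>\<^sub>i\<^sub>-\<^sub>1 \<le> K \<sigma>\<^sub>i / T\<close>. The same argument
  with the observation of \<open>u\<^sub>n\<close> gives \<open>T \<sigma>\<^sub>n\<^sup>2 \<le> K \<integral>|B u\<^sub>n|\<^sup>2\<close>, and the components beyond \<open>n\<close> follow
  one at a time from observability perturbed by a source.
\<close>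

subsection \<open>Orthonormal bases and multipliers\<close>

text \<open>The coupling form controls the displacement of \<open>u_{i-1}\<close> through
  \<open>\<Pi>_i\<close>, but observability of \<open>\<Pi>_i\<close> concerns velocities. A further
  primitive turns this displacement into a velocity, so a component is looked at on two consecutive
  levels of primitives. Levels are compared at the price of powers of \<open>R\<close>, and this
  comparison needs the couplings to be bounded for the norms \<open>|R^k x|\<close>: that is the
  dual form of the hypotheses on the adjoints.

  The constant \<open>K\<close> has to be uniform in \<open>T\<close>. Observability is therefore
  invoked on one fixed window length only, and \<open>T\<close> enters through the number of
  windows; this accounts for one factor \<open>1/T\<close>, and squaring
  \<open>\<sigma>_i \<le> K \<sigma>_n / T\<close> for the other two.

  The observation of a solution of energy regularity is a choice among \<open>L^2\<close> limits.
  Its norm is recovered as a limit along spectral truncations, where everything is an integral of a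
  continuous function. The compact resolvent provides the eigenbasis and also the separability that
  is needed to subtract square integrable functions.\<close>

lemma mult_self_le_imp_le: "z * z \<le> b * z \<Longrightarrow> 0 \<le> b \<Longrightarrow> 0 \<le> z \<Longrightarrow> z \<le> b" for z b :: real
  by (metis mult_le_cancel_right order.order_iff_strict not_less)

text \<open>\<open>E\<close> may have any cardinality: totality is a statement about orthogonal
  complements, and only sums over finite subsets of \<open>E\<close> occur.\<close>

locale hilbert_basis =
  fixes E :: "'h::{real_inner,complete_space} set"
  assumes norm_basis: "e \<in> E \<Longrightarrow> norm e = 1"
    and orth: "e \<in> E \<Longrightarrow> e' \<in> E \<Longrightarrow> e \<noteq> e' \<Longrightarrow> e \<bullet> e' = 0"
    and total: "(\<And>e. e \<in> E \<Longrightarrow> x \<bullet> e = 0) \<Longrightarrow> x = 0"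
begin

lemma basis_inner: "e \<in> E \<Longrightarrow> e' \<in> E \<Longrightarrow> e \<bullet> e' = (if e = e' then 1 else 0)"
  using norm_basis[of e] orth[of e e'] by (auto simp: norm_eq_1)

lemma vec_eqI: "(\<And>e. e \<in> E \<Longrightarrow> x \<bullet> e = y \<bullet> e) \<Longrightarrow> x = y"
  using total[of "x - y"] by (simp add: inner_diff_left)

lemma inner_sum_basis:
  assumes "finite F" "F \<subseteq> E" "e \<in> E"
  shows "(\<Sum>e'\<in>F. c e' *\<^sub>R e') \<bullet> e = (if e \<in> F then c e else 0)"
proof -
  have "(\<Sum>e'\<in>F. c e' *\<^sub>R e') \<bullet> e = (\<Sum>e'\<in>F. if e' = e then c e' else 0)"
    unfolding inner_sum_left
    by (intro sum.cong) (use assms basis_inner in auto)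
  also have "\<dots> = (if e \<in> F then c e else 0)"
    using assms by (simp add: sum.delta)
  finally show ?thesis .
qed

lemma norm_sum_basis:
  assumes "finite F" "F \<subseteq> E"
  shows "(norm (\<Sum>e\<in>F. c e *\<^sub>R e))\<^sup>2 = (\<Sum>e\<in>F. (c e)\<^sup>2)"
proof -
  have "(norm (\<Sum>e\<in>F. c e *\<^sub>R e))\<^sup>2 = (\<Sum>e\<in>F. c e * ((\<Sum>e\<in>F. c e *\<^sub>R e) \<bullet> e))"
    by (simp add: power2_norm_eq_inner inner_sum_right)
  also have "\<dots> = (\<Sum>e\<in>F. (c e)\<^sup>2)"
    by (intro sum.cong) (use assms inner_sum_basis in \<open>auto simp: power2_eq_square subset_iff\<close>)
  finally show ?thesis .
qed

lemma bessel:
  assumes "finite F" "F \<subseteq> E"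
  shows "(\<Sum>e\<in>F. (x \<bullet> e)\<^sup>2) \<le> (norm x)\<^sup>2"
proof -
  let ?y = "\<Sum>e\<in>F. (x \<bullet> e) *\<^sub>R e"
  have xy: "x \<bullet> ?y = (\<Sum>e\<in>F. (x \<bullet> e)\<^sup>2)"
    by (simp add: inner_sum_right power2_eq_square)
  have "0 \<le> (norm (x - ?y))\<^sup>2" by simp
  also have "\<dots> = (norm x)\<^sup>2 - 2 * (x \<bullet> ?y) + (norm ?y)\<^sup>2"
    by (simp add: power2_norm_eq_inner inner_diff_left inner_diff_right inner_commute)
  finally show ?thesis using norm_sum_basis[OF assms, of "\<lambda>e. x \<bullet> e"] xy by simp
qed

text \<open>Partial sums over increasing finite sets \<open>G k\<close>, chosen so that their square
  sums approach the supremum \<open>s\<close> over all finite sets, form a Cauchy sequence: what is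
  left above \<open>G k\<close> is at most \<open>1 / (k + 1)\<close>. A coefficient outside every
  \<open>G k\<close> must vanish, since adding it would push a square sum above
  \<open>s\<close>.\<close>

lemma riesz_fischer:
  assumes "\<And>F. finite F \<Longrightarrow> F \<subseteq> E \<Longrightarrow> (\<Sum>e\<in>F. (c e)\<^sup>2) \<le> K"
  shows "\<exists>x. (\<forall>e\<in>E. x \<bullet> e = c e) \<and> (norm x)\<^sup>2 \<le> K"
proof -
  let ?S = "(\<lambda>F. \<Sum>e\<in>F. (c e)\<^sup>2) ` {F. finite F \<and> F \<subseteq> E}"
  define s where "s = Sup ?S"
  have bdd: "bdd_above ?S" using assms by (auto intro!: bdd_aboveI[of _ K])
  have up: "(\<Sum>e\<in>F. (c e)\<^sup>2) \<le> s" if "finite F" "F \<subseteq> E" for F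
    unfolding s_def by (rule cSup_upper[OF _ bdd]) (use that in auto)
  have "\<exists>F. finite F \<and> F \<subseteq> E \<and> s - 1 / real (Suc k) < (\<Sum>e\<in>F. (c e)\<^sup>2)" for k
  proof -
    have lt: "s - 1 / real (Suc k) < Sup ?S" unfolding s_def by simp
    have ne: "?S \<noteq> {}" by auto
    obtain z where "z \<in> ?S" "s - 1 / real (Suc k) < z"
      by (rule less_cSupE[OF lt ne])
    then show ?thesis by auto
  qed
  then obtain F where F: "\<And>k. finite (F k)" "\<And>k. F k \<subseteq> E"
    "\<And>k. s - 1 / real (Suc k) < (\<Sum>e\<in>F k. (c e)\<^sup>2)" by metis
  define G where "G k = (\<Union>i\<le>k. F i)" for k
  have G: "finite (G k)" "G k \<subseteq> E" for k using F by (auto simp: G_def)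
  have Gmono: "G k \<subseteq> G l" if "k \<le> l" for k l using that by (force simp: G_def)
  have Gs: "s - 1 / real (Suc k) < (\<Sum>e\<in>G k. (c e)\<^sup>2)" for k
    by (rule less_le_trans[OF F(3) sum_mono2]) (use G in \<open>auto simp: G_def\<close>)
  define x where "x k = (\<Sum>e\<in>G k. c e *\<^sub>R e)" for k
  have dist: "(norm (x l - x k))\<^sup>2 \<le> 1 / real (Suc k)" if "k \<le> l" for k l
  proof -
    have "x l - x k = (\<Sum>e\<in>G l - G k. c e *\<^sub>R e)"
      unfolding x_def using sum_diff[OF G(1) Gmono[OF that]] by metis
    then have "(norm (x l - x k))\<^sup>2 = (\<Sum>e\<in>G l - G k. (c e)\<^sup>2)"
      using norm_sum_basis[of "G l - G k" c] G by auto
    also have "\<dots> = (\<Sum>e\<in>G l. (c e)\<^sup>2) - (\<Sum>e\<in>G k. (c e)\<^sup>2)"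
      using sum_diff[OF G(1) Gmono[OF that]] by metis
    also have "\<dots> \<le> 1 / real (Suc k)" using up[OF G, of l] Gs[of k] by linarith
    finally show ?thesis .
  qed
  have "Cauchy x"
  proof (rule CauchyI)
    fix \<epsilon> :: real assume e: "\<epsilon> > 0"
    then obtain N where N: "1 / real (Suc N) < (\<epsilon>/2)\<^sup>2"
      using reals_Archimedean[of "(\<epsilon>/2)\<^sup>2"] by (auto simp: divide_simps)
    have *: "norm (x k - x N) < \<epsilon>/2" if "N \<le> k" for k
      by (rule power2_less_imp_less) (use dist[OF that] N e in auto)
    show "\<exists>M. \<forall>m\<ge>M. \<forall>n\<ge>M. norm (x m - x n) < \<epsilon>"
    proof (intro exI allI impI)
      fix m n assume "N \<le> m" "N \<le> n"
      then show "norm (x m - x n) < \<epsilon>"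
        using *[of m] *[of n] norm_triangle_ineq4[of "x m - x N" "x n - x N"] by simp
    qed
  qed
  then obtain y where y: "x \<longlonglongrightarrow> y" using Cauchy_convergent convergent_def by blast
  have "y \<bullet> e = c e" if "e \<in> E" for e
  proof -
    have lim: "(\<lambda>k. x k \<bullet> e) \<longlonglongrightarrow> y \<bullet> e" by (intro tendsto_intros y)
    show ?thesis
    proof (cases "\<exists>k. e \<in> G k")
      case True
      then obtain k where k: "e \<in> G k" by blast
      have "\<forall>\<^sub>F l in sequentially. x l \<bullet> e = c e"
        unfolding eventually_sequentially x_def
        using inner_sum_basis[OF G that] k subsetD[OF Gmono] by (intro exI[of _ k]) auto
      then have "(\<lambda>k. x k \<bullet> e) \<longlonglongrightarrow> c e" by (rule tendsto_eventually)
      then show ?thesis using lim LIMSEQ_unique by blast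
    next
      case False
      then have "x k \<bullet> e = 0" for k unfolding x_def using inner_sum_basis[OF G that] by auto
      then have "y \<bullet> e = 0" using lim by (simp add: LIMSEQ_const_iff)
      moreover have "(c e)\<^sup>2 \<le> 1 / real (Suc k)" for k
      proof -
        have "(\<Sum>e\<in>insert e (G k). (c e)\<^sup>2) \<le> s" by (rule up) (use G that in auto)
        then show ?thesis using Gs[of k] False G by simp
      qed
      then have "(c e)\<^sup>2 \<le> 0"
        by (intro LIMSEQ_le_const[OF LIMSEQ_inverse_real_of_nat]) (auto simp: inverse_eq_divide)
      ultimately show ?thesis by simp
    qed
  qed
  moreover have "(norm y)\<^sup>2 \<le> K"
  proof (rule LIMSEQ_le_const2)
    show "(\<lambda>k. (norm (x k))\<^sup>2) \<longlonglongrightarrow> (norm y)\<^sup>2" by (intro tendsto_intros y)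
    show "\<exists>N. \<forall>n\<ge>N. (norm (x n))\<^sup>2 \<le> K"
      unfolding x_def using norm_sum_basis[OF G, of c] assms[OF G] by auto
  qed
  ultimately show ?thesis by blast
qed

text \<open>A substitute for Parseval's identity: bounded finite coordinate sums produce a vector by
  Riesz-Fischer, and totality identifies it with \<open>x\<close>.\<close>

lemma norm_le_coords_sum:
  assumes "\<And>F. finite F \<Longrightarrow> F \<subseteq> E \<Longrightarrow> (\<Sum>e\<in>F. (x \<bullet> e)\<^sup>2) \<le> K"
  shows "(norm x)\<^sup>2 \<le> K"
proof -
  obtain y where "\<forall>e\<in>E. y \<bullet> e = x \<bullet> e" "(norm y)\<^sup>2 \<le> K"
    using riesz_fischer[of "\<lambda>e. x \<bullet> e", OF assms] by blast
  moreover from this have "y = x" by (intro vec_eqI) auto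
  ultimately show ?thesis by simp
qed

text \<open>The diagonal operator with symbol \<open>g\<close>. Coordinates separate points, so the
  description is unique; existence holds for symbols bounded on \<open>E\<close> and comes from
  \<open>mult_both\<close>.\<close>

definition mult :: "('h \<Rightarrow> real) \<Rightarrow> 'h \<Rightarrow> 'h" where
  "mult g x = (THE y. \<forall>e\<in>E. y \<bullet> e = g e * (x \<bullet> e))"

definition bounded_symbol :: "('h \<Rightarrow> real) \<Rightarrow> bool" where
  "bounded_symbol g \<longleftrightarrow> (\<exists>b. \<forall>e\<in>E. \<bar>g e\<bar> \<le> b)"

lemma mult_both:
  assumes "\<And>e. e \<in> E \<Longrightarrow> \<bar>g e\<bar> \<le> b"
  shows "(\<forall>e\<in>E. mult g x \<bullet> e = g e * (x \<bullet> e)) \<and> (norm (mult g x))\<^sup>2 \<le> b\<^sup>2 * (norm x)\<^sup>2"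
proof -
  have "(\<Sum>e\<in>F. (g e * (x \<bullet> e))\<^sup>2) \<le> b\<^sup>2 * (norm x)\<^sup>2" if "finite F" "F \<subseteq> E" for F
  proof -
    have "(\<Sum>e\<in>F. (g e * (x \<bullet> e))\<^sup>2) \<le> (\<Sum>e\<in>F. b\<^sup>2 * (x \<bullet> e)\<^sup>2)"
      unfolding power_mult_distrib
      by (intro sum_mono mult_right_mono) (use assms that abs_le_square_iff in fastforce)+
    also have "\<dots> \<le> b\<^sup>2 * (norm x)\<^sup>2"
      using bessel[OF that, of x] by (simp add: sum_distrib_left[symmetric] mult_left_mono)
    finally show ?thesis .
  qed
  from riesz_fischer[of "\<lambda>e. g e * (x \<bullet> e)", OF this] obtain y where
    y: "\<forall>e\<in>E. y \<bullet> e = g e * (x \<bullet> e)" "(norm y)\<^sup>2 \<le> b\<^sup>2 * (norm x)\<^sup>2" by blast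
  have "mult g x = y" unfolding mult_def
  proof (rule the_equality)
    show "\<forall>e\<in>E. y \<bullet> e = g e * (x \<bullet> e)" by (rule y(1))
    show "z = y" if "\<forall>e\<in>E. z \<bullet> e = g e * (x \<bullet> e)" for z
      by (rule vec_eqI) (use that y(1) in simp)
  qed
  then show ?thesis using y by simp
qed

lemma mult_coord: "bounded_symbol g \<Longrightarrow> e \<in> E \<Longrightarrow> mult g x \<bullet> e = g e * (x \<bullet> e)"
  unfolding bounded_symbol_def using mult_both[of g] by blast

lemma norm_mult_le:
  assumes "\<And>e. e \<in> E \<Longrightarrow> \<bar>g e\<bar> \<le> b" "0 \<le> b"
  shows "norm (mult g x) \<le> b * norm x"
  by (rule power2_le_imp_le)
    (use mult_both[of g b x, OF assms(1)] assms(2) in \<open>auto simp: power_mult_distrib\<close>)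

lemma bounded_linear_mult [intro]:
  assumes "bounded_symbol g"
  shows "bounded_linear (mult g)"
proof -
  obtain b where b: "\<forall>e\<in>E. \<bar>g e\<bar> \<le> b" using assms bounded_symbol_def by blast
  show ?thesis
  proof (rule bounded_linear_intro)
    show "mult g (x + y) = mult g x + mult g y" for x y
      by (rule vec_eqI) (simp add: mult_coord[OF assms] inner_add_left algebra_simps)
    show "mult g (r *\<^sub>R x) = r *\<^sub>R mult g x" for r x
      by (rule vec_eqI) (simp add: mult_coord[OF assms])
    show "norm (mult g x) \<le> norm x * \<bar>b\<bar>" for x
      using norm_mult_le[of g "\<bar>b\<bar>" x] b by (force simp: mult.commute)
  qed
qed

lemma bounded_symbol_times: "bounded_symbol g \<Longrightarrow> bounded_symbol h \<Longrightarrow> bounded_symbol (\<lambda>e. g e * h e)"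
proof -
  assume "bounded_symbol g" "bounded_symbol h"
  then obtain b d where "\<forall>e\<in>E. \<bar>g e\<bar> \<le> b" "\<forall>e\<in>E. \<bar>h e\<bar> \<le> d" unfolding bounded_symbol_def by blast
  then have "\<forall>e\<in>E. \<bar>g e * h e\<bar> \<le> \<bar>b\<bar> * \<bar>d\<bar>"
    unfolding abs_mult by (intro ballI mult_mono) auto
  then show ?thesis unfolding bounded_symbol_def by blast
qed

lemma mult_mult: "bounded_symbol g \<Longrightarrow> bounded_symbol h \<Longrightarrow> mult g (mult h x) = mult (\<lambda>e. g e * h e) x"
  by (rule vec_eqI) (simp add: mult_coord bounded_symbol_times)

lemma mult_cong: "(\<And>e. e \<in> E \<Longrightarrow> g e = h e) \<Longrightarrow> mult g x = mult h x"
  unfolding mult_def by (intro arg_cong[of _ _ The] ext) auto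

text \<open>If every finite projection stayed at distance \<open>\<epsilon>\<close>, Pythagoras
  would bound all coordinate sums by \<open>|x|^2 - \<epsilon>^2\<close>, and then
  \<open>|x|^2\<close> itself.\<close>

lemma finite_span_dense:
  assumes "\<epsilon> > 0"
  shows "\<exists>F. finite F \<and> F \<subseteq> E \<and> norm (x - (\<Sum>e\<in>F. (x \<bullet> e) *\<^sub>R e)) < \<epsilon>"
proof (rule ccontr)
  assume "\<not> ?thesis"
  then have *: "\<epsilon> \<le> norm (x - (\<Sum>e\<in>F. (x \<bullet> e) *\<^sub>R e))" if "finite F" "F \<subseteq> E" for F
    using that not_less by blast
  have "(\<Sum>e\<in>F. (x \<bullet> e)\<^sup>2) \<le> (norm x)\<^sup>2 - \<epsilon>\<^sup>2" if F: "finite F" "F \<subseteq> E" for F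
  proof -
    let ?y = "\<Sum>e\<in>F. (x \<bullet> e) *\<^sub>R e"
    have "\<epsilon>\<^sup>2 \<le> (norm (x - ?y))\<^sup>2" using *[OF F] assms by (intro power_mono) auto
    also have "\<dots> = (norm x)\<^sup>2 - 2 * (x \<bullet> ?y) + (norm ?y)\<^sup>2"
      by (simp add: power2_norm_eq_inner inner_diff_left inner_diff_right inner_commute)
    also have "\<dots> = (norm x)\<^sup>2 - (\<Sum>e\<in>F. (x \<bullet> e)\<^sup>2)"
      using norm_sum_basis[OF F, of "\<lambda>e. x \<bullet> e"] by (simp add: inner_sum_right power2_eq_square)
    finally show ?thesis by simp
  qed
  from norm_le_coords_sum[OF this] assms show False by simp
qed

lemma finite_span_closure:
  assumes "\<And>F c. finite F \<Longrightarrow> F \<subseteq> E \<Longrightarrow> (\<Sum>e\<in>F. c e *\<^sub>R e) \<in> X"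
  shows "x \<in> closure X"
  unfolding closure_approachable
proof (intro allI impI)
  fix \<epsilon> :: real assume "\<epsilon> > 0"
  from finite_span_dense[OF this, of x] obtain F where F: "finite F" "F \<subseteq> E"
    "norm (x - (\<Sum>e\<in>F. (x \<bullet> e) *\<^sub>R e)) < \<epsilon>" by blast
  then show "\<exists>y\<in>X. dist y x < \<epsilon>"
    using assms[OF F(1,2), of "\<lambda>e. x \<bullet> e"] by (metis dist_norm dist_commute)
qed

lemma mult_sym: assumes g: "bounded_symbol g" shows "mult g x \<bullet> y = x \<bullet> mult g y"
proof -
  have *: "mult g z \<bullet> e = z \<bullet> mult g e" if "e \<in> E" for z e
  proof -
    have "mult g e = g e *\<^sub>R e"
      by (rule vec_eqI) (use basis_inner that g in \<open>auto simp: mult_coord\<close>)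
    then show ?thesis using that g by (simp add: mult_coord)
  qed
  have "bounded_linear (\<lambda>y. x \<bullet> mult g y)"
    by (intro bounded_linear_compose[OF bounded_linear_inner_right bounded_linear_mult[OF g]])
  have "mult g x \<bullet> y = x \<bullet> mult g y" if "y = (\<Sum>e\<in>F. c e *\<^sub>R e)" "finite F" "F \<subseteq> E" for F c y
  proof -
    have "x \<bullet> mult g y = (\<Sum>e\<in>F. c e * (x \<bullet> mult g e))"
      using linear_sum[OF bounded_linear.linear[OF \<open>bounded_linear (\<lambda>y. x \<bullet> mult g y)\<close>], of "\<lambda>e. c e *\<^sub>R e" F]
      using linear_cmul[OF bounded_linear.linear[OF \<open>bounded_linear (\<lambda>y. x \<bullet> mult g y)\<close>]] that(1)
      by simp
    also have "\<dots> = mult g x \<bullet> y" unfolding that(1) inner_sum_right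
      using * that by (intro sum.cong) auto
    finally show ?thesis by simp
  qed note fin = this
  have "closed {y. mult g x \<bullet> y = x \<bullet> mult g y}"
    by (intro closed_Collect_eq continuous_intros linear_continuous_on
        bounded_linear_compose[OF bounded_linear_inner_right bounded_linear_mult[OF g]])
  moreover have "y \<in> closure {y. mult g x \<bullet> y = x \<bullet> mult g y}"
    by (rule finite_span_closure) (use fin in blast)
  ultimately show ?thesis by (auto simp: closure_closed)
qed

text \<open>\<open>adjoint\<close> is defined by choice, so the identity requires that some adjoint
  exists. This is Riesz representation of \<open>x \<mapsto> C x \<bullet> y\<close> in the basis:
  testing with the vector \<open>?z\<close> built from the coefficients
  \<open>C e \<bullet> y\<close> bounds their square sum, and the resulting vector represents the
  functional on finite combinations, hence everywhere by density.\<close>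

lemma adjoint_exists:
  fixes C :: "'h \<Rightarrow>\<^sub>L 'h"
  shows "C x \<bullet> y = x \<bullet> adjoint (blinfun_apply C) y"
proof -
  have "\<exists>z. \<forall>x. C x \<bullet> y = x \<bullet> z" for y
  proof -
    have "(\<Sum>e\<in>F. (C e \<bullet> y)\<^sup>2) \<le> (norm C * norm y)\<^sup>2" if F: "finite F" "F \<subseteq> E" for F
    proof -
      let ?z = "\<Sum>e\<in>F. (C e \<bullet> y) *\<^sub>R e"
      have "(norm ?z)\<^sup>2 = (\<Sum>e\<in>F. (C e \<bullet> y)\<^sup>2)" using norm_sum_basis[OF F] .
      also have "\<dots> = C ?z \<bullet> y"
        by (simp add: blinfun.sum_right blinfun.scaleR_right inner_sum_left power2_eq_square)
      also have "\<dots> \<le> norm C * norm ?z * norm y"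
        by (rule order_trans[OF norm_cauchy_schwarz mult_right_mono[OF norm_blinfun norm_ge_zero]])
      finally have "norm ?z * norm ?z \<le> (norm C * norm y) * norm ?z"
        by (simp add: power2_eq_square mult_ac)
      then have "norm ?z \<le> norm C * norm y"
        by (rule mult_self_le_imp_le) simp_all
      then have "(norm ?z)\<^sup>2 \<le> (norm C * norm y)\<^sup>2" by (rule power_mono) (rule norm_ge_zero)
      then show ?thesis using norm_sum_basis[OF F, of "\<lambda>e. C e \<bullet> y"] by linarith
    qed
    from riesz_fischer[of "\<lambda>e. C e \<bullet> y", OF this]
    obtain z where z: "\<And>e. e \<in> E \<Longrightarrow> z \<bullet> e = C e \<bullet> y" by blast
    have fin: "C x \<bullet> y = x \<bullet> z" if "x = (\<Sum>e\<in>F. c e *\<^sub>R e)" "finite F" "F \<subseteq> E" for F c x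
    proof -
      have "C x \<bullet> y = (\<Sum>e\<in>F. c e * (C e \<bullet> y))"
        unfolding that(1) by (simp add: blinfun.sum_right blinfun.scaleR_right inner_sum_left)
      also have "\<dots> = (\<Sum>e\<in>F. c e * (e \<bullet> z))"
        using that(3) z by (intro sum.cong) (simp_all add: inner_commute subset_iff)
      finally show ?thesis unfolding that(1) by (simp add: inner_sum_left)
    qed
    have "C x \<bullet> y = x \<bullet> z" for x
    proof -
      have "closed {x. C x \<bullet> y = x \<bullet> z}"
        by (intro closed_Collect_eq continuous_intros)
      moreover have "x \<in> closure {x. C x \<bullet> y = x \<bullet> z}"
        by (rule finite_span_closure) (use fin in blast)
      ultimately show ?thesis by (auto simp: closure_closed)
    qed
    then show ?thesis by blast
  qed
  then obtain f where "\<forall>x y. C x \<bullet> y = x \<bullet> f y" by metis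
  then have "\<forall>x y. C x \<bullet> y = x \<bullet> adjoint (blinfun_apply C) y"
    unfolding adjoint_def by (rule someI[where P = "\<lambda>f. \<forall>x y. C x \<bullet> y = x \<bullet> f y"])
  then show ?thesis by blast
qed

text \<open>Coordinatewise differentiability alone is not uniform in \<open>e\<close>; continuity of
  the candidate \<open>v\<close> restores uniformity. The remainder \<open>q\<close> is tested with
  its own finite projection \<open>z\<close>, the mean value inequality bounds the result by
  \<open>\<epsilon> * norm z * norm (s - t)\<close>, and cancelling one \<open>norm z\<close> leaves
  a bound that does not depend on the finite set.\<close>

lemma has_vector_derivative_coords:
  assumes d: "\<And>e t. e \<in> E \<Longrightarrow> t \<in> {0..T} \<Longrightarrow>
      ((\<lambda>t. w t \<bullet> e) has_real_derivative v t \<bullet> e) (at t within {0..T})"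
    and v: "continuous_on {0..T} v" and t: "t \<in> {0..T}"
  shows "(w has_vector_derivative v t) (at t within {0..T})"
  unfolding has_vector_derivative_def has_derivative_within_alt
proof (intro conjI allI impI)
  show "bounded_linear (\<lambda>x. x *\<^sub>R v t)" by (rule bounded_linear_scaleR_left)
  fix \<epsilon> :: real assume "\<epsilon> > 0"
  then obtain \<delta> where \<delta>: "\<delta> > 0" "\<And>s. s \<in> {0..T} \<Longrightarrow> dist s t < \<delta> \<Longrightarrow> dist (v s) (v t) < \<epsilon>"
    using v t unfolding continuous_on_iff by meson
  show "\<exists>d>0. \<forall>y\<in>{0..T}. norm (y - t) < d \<longrightarrow>
      norm (w y - w t - (y - t) *\<^sub>R v t) \<le> \<epsilon> * norm (y - t)"
  proof (intro exI[of _ \<delta>] conjI ballI impI \<delta>(1))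
    fix s assume s: "s \<in> {0..T}" "norm (s - t) < \<delta>"
    define q where "q = w s - w t - (s - t) *\<^sub>R v t"
    have "(\<Sum>e\<in>F. (q \<bullet> e)\<^sup>2) \<le> (\<epsilon> * norm (s - t))\<^sup>2" if F: "finite F" "F \<subseteq> E" for F
    proof -
      define z where "z = (\<Sum>e\<in>F. (q \<bullet> e) *\<^sub>R e)"
      have zz: "(norm z)\<^sup>2 = (\<Sum>e\<in>F. (q \<bullet> e)\<^sup>2)" unfolding z_def by (rule norm_sum_basis[OF F])
      define h where "h r = (w r - w t - (r - t) *\<^sub>R v t) \<bullet> z" for r
      have qz: "h s - h t = (norm z)\<^sup>2"
        unfolding zz h_def q_def[symmetric] by (simp add: z_def inner_sum_right power2_eq_square)
      have inn: "{min s t..max s t} \<subseteq> {0..T}" using s t by auto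
      have dh: "(h has_derivative (*) ((v r - v t) \<bullet> z)) (at r within {min s t..max s t})"
        if r: "r \<in> {min s t..max s t}" for r
      proof -
        have rT: "r \<in> {0..T}" using inn r by blast
        have "(h has_real_derivative (v r - v t) \<bullet> z) (at r within {0..T})"
          unfolding h_def z_def inner_sum_right inner_scaleR_right inner_diff_left inner_scaleR_left
          using F rT
          by (auto intro!: derivative_eq_intros d simp: subset_iff sum_subtractf algebra_simps)
        then show ?thesis using inn
          by (metis has_derivative_subset has_field_derivative_def)
      qed
      have "norm (h s - h t) \<le> (\<epsilon> * norm z) * norm (s - t)"
      proof (rule differentiable_bound[OF _ dh])
        show "onorm ((*) ((v r - v t) \<bullet> z)) \<le> \<epsilon> * norm z" if r: "r \<in> {min s t..max s t}" for r
        proof -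
          have "dist r t < \<delta>" using r s by (auto simp: dist_real_def)
          then have "norm (v r - v t) < \<epsilon>" using \<delta>(2)[of r] subsetD[OF inn r] by (simp add: dist_norm)
          then have "\<bar>(v r - v t) \<bullet> z\<bar> \<le> \<epsilon> * norm z"
            using Cauchy_Schwarz_ineq2[of "v r - v t" z]
            by (meson less_imp_le mult_right_mono norm_ge_zero order_trans)
          then show ?thesis
            by (intro onorm_le) (simp add: abs_mult mult_right_mono)
        qed
      qed auto
      then have "norm z * norm z \<le> (\<epsilon> * norm (s - t)) * norm z"
        unfolding qz by (simp add: power2_eq_square mult_ac)
      then have "norm z \<le> \<epsilon> * norm (s - t)"
        by (rule mult_self_le_imp_le) (use \<open>\<epsilon> > 0\<close> in simp_all)
      then show ?thesis unfolding zz[symmetric] by (rule power_mono) (rule norm_ge_zero)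
    qed
    from norm_le_coords_sum[OF this] have "(norm q)\<^sup>2 \<le> (\<epsilon> * norm (s - t))\<^sup>2" .
    then show "norm (w s - w t - (s - t) *\<^sub>R v t) \<le> \<epsilon> * norm (s - t)"
      unfolding q_def[symmetric] using \<open>\<epsilon> > 0\<close> by (rule_tac power2_le_imp_le) simp_all
  qed
qed

end

subsection \<open>The spectral basis of the operator\<close>

text \<open>A maximizing sequence for \<open>norm (S x)\<close> on the unit sphere of
  \<open>M\<close> consists of approximate eigenvectors of \<open>S^2\<close> for
  \<open>b^2\<close>, by symmetry and expansion of a square; compactness extracts a limit
  \<open>y\<close> with \<open>S (S y) = b^2 y\<close>. The invariant subspace \<open>M\<close> is
  carried along so that the lemma can be applied to orthogonal complements.\<close>

lemma compact_symmetric_eigenvector: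
  fixes S :: "'h::{real_inner,complete_space} \<Rightarrow> 'h"
  assumes S: "bounded_linear S" and sym: "\<And>x y. S x \<bullet> y = x \<bullet> S y"
    and inj: "\<And>x. S x = 0 \<Longrightarrow> x = 0"
    and comp: "compact (closure (S ` cball 0 1))"
    and M: "subspace M" "closed M" "S ` M \<subseteq> M" and x0: "x0 \<in> M" "x0 \<noteq> 0"
  shows "\<exists>e\<in>M. norm e = 1 \<and> (\<exists>s. s \<noteq> 0 \<and> S e = s *\<^sub>R e)"
proof -
  interpret S: bounded_linear S by (rule S)
  let ?Q = "(\<lambda>x. norm (S x)) ` {x\<in>M. norm x = 1}"
  define b where "b = Sup ?Q"
  have u0: "x0 /\<^sub>R norm x0 \<in> {x\<in>M. norm x = 1}"
    using M(1) x0 by (auto simp: subspace_scale)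
  obtain B where B: "\<And>x. norm (S x) \<le> norm x * B" using S.bounded by blast
  have bdd: "bdd_above ?Q" using B by (auto intro!: bdd_aboveI[of _ B]) (metis mult_1)
  have ub: "norm (S x) \<le> b * norm x" if "x \<in> M" for x
  proof (cases "x = 0")
    case False
    have "norm (S (x /\<^sub>R norm x)) \<le> b" unfolding b_def
      by (rule cSup_upper[OF _ bdd]) (use that False M(1) in \<open>auto simp: subspace_scale\<close>)
    then show ?thesis using False by (simp add: S.scaleR field_simps)
  qed (simp add: S.zero)
  have "b > 0"
  proof -
    have "0 < norm (S x0)" using inj x0 by auto
    then have "0 < b * norm x0" using ub[OF x0(1)] by linarith
    then show ?thesis using x0(2) by (simp add: zero_less_mult_iff)
  qed
  have "\<exists>x\<in>M. norm x = 1 \<and> b - 1 / real (Suc k) < norm (S x)" for k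
  proof -
    have "b - 1 / real (Suc k) < Sup ?Q" unfolding b_def by simp
    moreover have "?Q \<noteq> {}" using u0 by blast
    ultimately obtain z where "z \<in> ?Q" "b - 1 / real (Suc k) < z"
      by (rule less_cSupE)
    then show ?thesis by auto
  qed
  then obtain x where x: "\<And>k. x k \<in> M" "\<And>k. norm (x k) = 1"
    "\<And>k. b - 1 / real (Suc k) < norm (S (x k))" by metis
  have "(\<lambda>k. b - 1 / real (Suc k)) \<longlonglongrightarrow> b - 0"
    by (intro tendsto_intros LIMSEQ_inverse_real_of_nat[unfolded inverse_eq_divide])
  then have lim0: "(\<lambda>k. b - 1 / real (Suc k)) \<longlonglongrightarrow> b" by simp
  have lim: "(\<lambda>k. norm (S (x k))) \<longlonglongrightarrow> b"
  proof (rule tendsto_sandwich[OF _ _ lim0 tendsto_const])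
    show "\<forall>\<^sub>F k in sequentially. b - 1 / real (Suc k) \<le> norm (S (x k))"
      using x(3) by (intro always_eventually allI less_imp_le)
    show "\<forall>\<^sub>F k in sequentially. norm (S (x k)) \<le> b"
      using ub[OF x(1)] x(2) by (intro always_eventually allI) simp
  qed
  have est: "(norm (b\<^sup>2 *\<^sub>R x k - S (S (x k))))\<^sup>2 \<le> (b\<^sup>2)\<^sup>2 - b\<^sup>2 * (norm (S (x k)))\<^sup>2" for k
  proof -
    have "(norm (b\<^sup>2 *\<^sub>R x k - S (S (x k))))\<^sup>2
      = (b\<^sup>2)\<^sup>2 * (norm (x k))\<^sup>2 - 2 * b\<^sup>2 * (x k \<bullet> S (S (x k))) + (norm (S (S (x k))))\<^sup>2"
      by (simp only: power2_norm_eq_inner) (simp add: inner_diff_left inner_diff_right inner_commute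
          power2_eq_square algebra_simps)
    also have "x k \<bullet> S (S (x k)) = (norm (S (x k)))\<^sup>2"
      using sym[of "x k" "S (x k)"] by (simp add: power2_norm_eq_inner)
    also have "(norm (S (S (x k))))\<^sup>2 \<le> (b * norm (S (x k)))\<^sup>2"
      using ub[of "S (x k)"] x(1) M(3) by (intro power_mono) auto
    finally show ?thesis using x(2) by (simp add: power_mult_distrib)
  qed
  have lim2: "(\<lambda>k. b\<^sup>2 *\<^sub>R x k - S (S (x k))) \<longlonglongrightarrow> 0"
  proof -
    have "(\<lambda>k. (b\<^sup>2)\<^sup>2 - b\<^sup>2 * (norm (S (x k)))\<^sup>2) \<longlonglongrightarrow> (b\<^sup>2)\<^sup>2 - b\<^sup>2 * b\<^sup>2"
      by (intro tendsto_intros lim)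
    then have "(\<lambda>k. (norm (b\<^sup>2 *\<^sub>R x k - S (S (x k))))\<^sup>2) \<longlonglongrightarrow> 0"
      by (rule_tac tendsto_sandwich[OF always_eventually always_eventually tendsto_const[of 0]])
        (use est in \<open>simp_all add: power2_eq_square\<close>)
    then have "(\<lambda>k. sqrt ((norm (b\<^sup>2 *\<^sub>R x k - S (S (x k))))\<^sup>2)) \<longlonglongrightarrow> sqrt 0"
      by (rule tendsto_real_sqrt)
    then show ?thesis by (simp add: tendsto_norm_zero_iff)
  qed
  have "S (x k) \<in> closure (S ` cball 0 1)" for k
    using x(2) closure_subset by (force simp: image_iff)
  then obtain l r where r: "strict_mono r" "((\<lambda>k. S (x k)) \<circ> r) \<longlonglongrightarrow> l"
    using comp unfolding compact_def by metis
  have l2: "(\<lambda>k. S (S (x (r k)))) \<longlonglongrightarrow> S l"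
    using S.tendsto[OF r(2)] by (simp add: o_def)
  have "(\<lambda>k. (b\<^sup>2 *\<^sub>R x (r k) - S (S (x (r k)))) + S (S (x (r k)))) \<longlonglongrightarrow> 0 + S l"
    by (intro tendsto_add l2) (use LIMSEQ_subseq_LIMSEQ[OF lim2 r(1)] in \<open>simp add: o_def\<close>)
  then have "(\<lambda>k. (1/b\<^sup>2) *\<^sub>R (b\<^sup>2 *\<^sub>R x (r k))) \<longlonglongrightarrow> (1/b\<^sup>2) *\<^sub>R S l"
    by (intro tendsto_intros) simp
  then obtain y where y: "(\<lambda>k. x (r k)) \<longlonglongrightarrow> y" "y = (1/b\<^sup>2) *\<^sub>R S l" using \<open>b > 0\<close> by simp
  have yM: "y \<in> M" using M(2) x(1) y(1) closed_sequentially by metis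
  have ny: "norm y = 1" using tendsto_norm[OF y(1)] x(2) by (simp add: LIMSEQ_const_iff)
  have "l = S y" using S.tendsto[OF y(1)] r(2) LIMSEQ_unique by (fastforce simp: o_def)
  then have SS: "S (S y) = b\<^sup>2 *\<^sub>R y" using y(2) \<open>b > 0\<close> by simp
  \<comment> \<open>\<open>(S - b) (S + b) y = 0\<close>: either \<open>S + b\<close> kills
    \<open>y\<close>, which is then an eigenvector for \<open>-b\<close>, or
    \<open>S y + b y\<close> is a nonzero eigenvector for \<open>b\<close>.\<close>
  show ?thesis
  proof (cases "S y + b *\<^sub>R y = 0")
    case True
    then have "S y = (-b) *\<^sub>R y" by (simp add: eq_neg_iff_add_eq_0)
    moreover have "- b \<noteq> 0" using \<open>b > 0\<close> by simp
    ultimately show ?thesis using yM ny by blast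
  next
    case False
    let ?z = "S y + b *\<^sub>R y"
    have "?z \<in> M" using yM M by (auto intro!: subspace_add subspace_scale)
    then have "?z /\<^sub>R norm ?z \<in> M" using M(1) by (simp add: subspace_scale)
    moreover have "S ?z = b *\<^sub>R ?z"
      by (simp add: S.add S.scaleR SS scaleR_add_right power2_eq_square)
    then have "S (?z /\<^sub>R norm ?z) = b *\<^sub>R (?z /\<^sub>R norm ?z)" by (simp only: S.scaleR) simp
    ultimately show ?thesis using \<open>b > 0\<close> False
      by (intro bexI[of _ "?z /\<^sub>R norm ?z"]) auto
  qed
qed

text \<open>Zorn's lemma on orthonormal sets of eigenvectors. The orthogonal complement of a maximal
  one is closed, and invariant by symmetry; were it nonzero, it would contain one more
  eigenvector.\<close>

lemma compact_symmetric_eigenbasis: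
  fixes S :: "'h::{real_inner,complete_space} \<Rightarrow> 'h"
  assumes S: "bounded_linear S" and sym: "\<And>x y. S x \<bullet> y = x \<bullet> S y"
    and inj: "\<And>x. S x = 0 \<Longrightarrow> x = 0"
    and comp: "compact (closure (S ` cball 0 1))"
  shows "\<exists>E. hilbert_basis E \<and> (\<forall>e\<in>E. \<exists>s. s \<noteq> 0 \<and> S e = s *\<^sub>R e)"
proof -
  let ?ev = "\<lambda>e. norm e = 1 \<and> (\<exists>s. s \<noteq> 0 \<and> S e = s *\<^sub>R e)"
  let ?P = "{E. (\<forall>e\<in>E. ?ev e) \<and> pairwise orthogonal E}"
  have "\<exists>E\<in>?P. \<forall>X\<in>?P. E \<subseteq> X \<longrightarrow> X = E"
  proof (rule subset_Zorn', safe)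
    fix \<C> assume c: "subset.chain ?P \<C>"
    then have sub: "\<And>X. X \<in> \<C> \<Longrightarrow> X \<in> ?P" by (auto simp: subset.chain_def)
    show "norm e = 1" "\<exists>s. s \<noteq> 0 \<and> S e = s *\<^sub>R e" if "e \<in> X" "X \<in> \<C>" for e X
      using sub that by auto
    show "pairwise orthogonal (\<Union> \<C>)"
    proof (rule pairwiseI)
      fix x y assume "x \<in> \<Union>\<C>" "y \<in> \<Union>\<C>" and ne: "x \<noteq> y"
      then obtain X1 X2 where X12: "X1 \<in> \<C>" "x \<in> X1" "X2 \<in> \<C>" "y \<in> X2" by blast
      then have "X1 \<subseteq> X2 \<or> X2 \<subseteq> X1" using c by (auto simp: subset_chain_def)
      then obtain X where "X \<in> \<C>" "x \<in> X" "y \<in> X" using X12 by blast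
      then show "orthogonal x y" using sub[of X] ne by (auto simp: pairwise_def)
    qed
  qed
  then obtain E where EP: "E \<in> ?P" and max0: "\<forall>X\<in>?P. E \<subseteq> X \<longrightarrow> X = E" by (rule bexE)
  have E: "\<forall>e\<in>E. ?ev e" "pairwise orthogonal E" using EP by simp_all
  have max: "X = E" if "X \<in> ?P" "E \<subseteq> X" for X using max0[rule_format, OF that] .
  let ?M = "{x. \<forall>e\<in>E. x \<bullet> e = 0}"
  have "hilbert_basis E"
  proof
    show "norm e = 1" if "e \<in> E" for e using E that by blast
    show "e \<bullet> e' = 0" if "e \<in> E" "e' \<in> E" "e \<noteq> e'" for e e'
      using E(2) that by (auto simp: pairwise_def orthogonal_def)
    show "x = 0" if x: "\<And>e. e \<in> E \<Longrightarrow> x \<bullet> e = 0" for x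
    proof (rule ccontr)
      assume "x \<noteq> 0"
      have "?M = (\<Inter>e\<in>E. {x. x \<bullet> e = 0})" by auto
      moreover have "closed {x. x \<bullet> e = 0}" for e :: 'h
        by (intro closed_Collect_eq continuous_intros)
      ultimately have cl: "closed ?M" by auto
      have "subspace ?M" by (auto simp: subspace_def inner_add_left)
      moreover have "S ` ?M \<subseteq> ?M"
      proof safe
        fix z e assume z: "\<forall>e\<in>E. z \<bullet> e = 0" and e: "e \<in> E"
        then obtain s where "S e = s *\<^sub>R e" using E by blast
        then show "S z \<bullet> e = 0" using sym z e by simp
      qed
      ultimately obtain e where e: "e \<in> ?M" "?ev e"
        using compact_symmetric_eigenvector[OF S sym inj comp _ cl, of x] x \<open>x \<noteq> 0\<close> by blast
      have "insert e E \<in> ?P" using e E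
        by (auto simp: pairwise_insert orthogonal_def inner_commute)
      then have "insert e E = E" by (rule max) auto
      then have "e \<in> E" by blast
      then have "e \<bullet> e = 0" using e(1) by blast
      then show False using e(2) by simp
    qed
  qed
  then show ?thesis using E by blast
qed

section \<open>Graphs of self-adjoint operators\<close>

text \<open>Linearity is not part of \<open>self_adjoint\<close>: an adjoint graph is cut out by
  linear conditions, and \<open>adjoint_graph A = A\<close> hands its linearity over to
  \<open>A\<close>.\<close>

lemma adjoint_graph_linear:
  assumes "(x, w) \<in> adjoint_graph A" "(y, z) \<in> adjoint_graph A"
  shows "(x + r *\<^sub>R y, w + r *\<^sub>R z) \<in> adjoint_graph A"
  using assms unfolding adjoint_graph_def by (fastforce simp: inner_add_right)

lemma self_adjoint_linear:
  assumes "self_adjoint A" "(x, w) \<in> A" "(y, z) \<in> A"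
  shows "(x + r *\<^sub>R y, w + r *\<^sub>R z) \<in> A"
  using adjoint_graph_linear[of x w A y z r] assms unfolding self_adjoint_def by simp

lemma self_adjoint_scale:
  assumes "self_adjoint A" "(x, w) \<in> A"
  shows "(r *\<^sub>R x, r *\<^sub>R w) \<in> A"
  using self_adjoint_linear[OF assms assms(2), of "r - 1"] by (simp add: scaleR_diff_left)

lemma self_adjoint_sym:
  assumes "self_adjoint A" "(x, w) \<in> A" "(y, z) \<in> A"
  shows "w \<bullet> y = x \<bullet> z"
proof -
  have "(y, z) \<in> adjoint_graph A" using assms(1,3) unfolding self_adjoint_def by simp
  then show ?thesis using assms(2) unfolding adjoint_graph_def by fastforce
qed

text \<open>Density of the domain makes the graph single-valued: a value at 0 is orthogonal to
  \<open>Domain A\<close>.\<close>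

lemma self_adjoint_zero:
  assumes "self_adjoint A" "(0, w) \<in> A"
  shows "w = 0"
proof -
  have "closed {y. w \<bullet> y = 0}" by (intro closed_Collect_eq continuous_intros)
  moreover have "Domain A \<subseteq> {y. w \<bullet> y = 0}"
    using self_adjoint_sym[OF assms] by auto
  ultimately have "closure (Domain A) \<subseteq> {y. w \<bullet> y = 0}" by (rule closure_minimal[rotated])
  then have "w \<bullet> w = 0" using assms(1) unfolding self_adjoint_def by blast
  then show ?thesis by simp
qed

lemma self_adjoint_fun:
  assumes "self_adjoint A" "(u, w) \<in> A" "(u, z) \<in> A"
  shows "w = z"
  using self_adjoint_zero[OF assms(1), of "w - z"]
    self_adjoint_linear[OF assms, of "-1"] by simp

lemma self_adjoint_op_app:
  assumes "self_adjoint A" "(u, w) \<in> A" shows "op_app A u = w"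
  unfolding op_app_def by (rule the_equality) (use assms self_adjoint_fun in blast)+

lemma compact_countable_dense:
  fixes K :: "'a::metric_space set"
  assumes "compact K"
  shows "\<exists>D. countable D \<and> K \<subseteq> closure D"
proof -
  have "\<exists>k. finite k \<and> K \<subseteq> (\<Union>x\<in>k. ball x (1 / real (Suc n)))" for n
    using compact_eq_totally_bounded[of K] assms by (metis divide_pos_pos of_nat_0_less_iff zero_less_Suc zero_less_one)
  then obtain k where k: "\<And>n. finite (k n)" "\<And>n. K \<subseteq> (\<Union>x\<in>k n. ball x (1 / real (Suc n)))" by metis
  have "K \<subseteq> closure (\<Union>n. k n)"
  proof
    fix x assume x: "x \<in> K"
    show "x \<in> closure (\<Union>n. k n)" unfolding closure_approachable
    proof (intro allI impI)
      fix \<epsilon> :: real assume "\<epsilon> > 0"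
      then obtain n where n: "1 / real (Suc n) < \<epsilon>"
        using reals_Archimedean by (auto simp: inverse_eq_divide)
      obtain y where "y \<in> k n" "x \<in> ball y (1 / real (Suc n))" using k(2) x by blast
      then show "\<exists>y\<in>\<Union>n. k n. dist y x < \<epsilon>" using n by force
    qed
  qed
  moreover have "countable (\<Union>n. k n)" using k(1) by (simp add: countable_finite)
  ultimately show ?thesis by blast
qed

text \<open>The resolvent \<open>S = (A - \<mu>)^{-1}\<close> is symmetric, injective and compact,
  and \<open>S e = s e\<close> means \<open>A e = (1 / s + \<mu>) e\<close>. Positivity excludes
  negative eigenvalues, after which the lower bound on \<open>|A u|\<close> gives
  \<open>\<omega>\<close>. The countable dense set \<open>D\<close> serves measurability questions
  later on.\<close>

lemma spectral:
  fixes A :: "('h::{real_inner,complete_space} \<times> 'h) set"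
  assumes sa: "self_adjoint A" and pos: "positive_op A" and cr: "compact_resolvent A"
    and om: "\<omega> > 0" "\<forall>u\<in>Domain A. norm (op_app A u) \<ge> \<omega> * norm u"
  shows "\<exists>E lam D. hilbert_basis E \<and> (\<forall>e\<in>E. (e, lam e *\<^sub>R e) \<in> A \<and> lam e \<ge> \<omega>) \<and>
     countable D \<and> closure D = (UNIV :: 'h set)"
proof -
  obtain \<mu> :: real where ex: "\<And>z. \<exists>!u. (u, z + \<mu> *\<^sub>R u) \<in> A"
    and comp: "compact (closure {u. \<exists>z. norm z \<le> 1 \<and> (u, z + \<mu> *\<^sub>R u) \<in> A})"
    using cr unfolding compact_resolvent_def by blast
  define S where "S z = (THE u. (u, z + \<mu> *\<^sub>R u) \<in> A)" for z
  have S: "(S z, z + \<mu> *\<^sub>R S z) \<in> A" for z unfolding S_def by (rule theI'[OF ex])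
  have Seq: "S z = u" if "(u, z + \<mu> *\<^sub>R u) \<in> A" for u z using ex S that by blast
  have im: "S ` cball 0 1 = {u. \<exists>z. norm z \<le> 1 \<and> (u, z + \<mu> *\<^sub>R u) \<in> A}"
  proof (intro set_eqI iffI)
    fix u assume "u \<in> S ` cball 0 1"
    then show "u \<in> {u. \<exists>z. norm z \<le> 1 \<and> (u, z + \<mu> *\<^sub>R u) \<in> A}" using S by auto
  next
    fix u assume "u \<in> {u. \<exists>z. norm z \<le> 1 \<and> (u, z + \<mu> *\<^sub>R u) \<in> A}"
    then obtain z where "norm z \<le> 1" "u = S z" using Seq by auto
    then show "u \<in> S ` cball 0 1" by simp
  qed
  have comp': "compact (closure (S ` cball 0 1))" using comp im by simp
  have addS: "S (x + y) = S x + S y" for x y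
    by (rule Seq) (use self_adjoint_linear[OF sa S S, of x 1 y] in \<open>simp add: algebra_simps\<close>)
  have scS: "S (r *\<^sub>R x) = r *\<^sub>R S x" for r x
    by (rule Seq) (use self_adjoint_scale[OF sa S, of r x] in \<open>simp add: algebra_simps\<close>)
  have "bounded (S ` cball 0 1)"
    using compact_imp_bounded[OF comp'] bounded_subset closure_subset by blast
  then obtain b where b: "\<And>x. norm x \<le> 1 \<Longrightarrow> norm (S x) \<le> b"
    unfolding bounded_iff by fastforce
  have bl: "bounded_linear S"
  proof (rule bounded_linear_intro[where K = b])
    show "norm (S x) \<le> norm x * b" for x
    proof (cases "x = 0")
      case True then show ?thesis using scS[of 0 0] by simp
    next
      case False
      then have "norm (S (x /\<^sub>R norm x)) \<le> b" by (intro b) simp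
      then show ?thesis using False by (simp add: scS field_simps)
    qed
  qed (fact addS scS)+
  have sym: "S x \<bullet> y = x \<bullet> S y" for x y
    using self_adjoint_sym[OF sa S[of x] S[of y]] by (simp add: inner_add_left inner_add_right)
  have inj: "x = 0" if "S x = 0" for x
    using S[of x] self_adjoint_zero[OF sa] that by simp
  obtain E where E: "hilbert_basis E" "\<forall>e\<in>E. \<exists>s. s \<noteq> 0 \<and> S e = s *\<^sub>R e"
    using compact_symmetric_eigenbasis[OF bl sym inj comp'] by blast
  then obtain s where s: "\<And>e. e \<in> E \<Longrightarrow> s e \<noteq> 0" "\<And>e. e \<in> E \<Longrightarrow> S e = s e *\<^sub>R e" by metis
  define lam where "lam e = 1 / s e + \<mu>" for e
  have "(e, lam e *\<^sub>R e) \<in> A \<and> lam e \<ge> \<omega>" if e: "e \<in> E" for e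
  proof
    have "((1 / s e) *\<^sub>R (s e *\<^sub>R e), (1 / s e) *\<^sub>R (e + \<mu> *\<^sub>R (s e *\<^sub>R e))) \<in> A"
      using S[of e] s[OF e] by (intro self_adjoint_scale[OF sa]) simp
    then show mem: "(e, lam e *\<^sub>R e) \<in> A" using s(1)[OF e]
      by (simp add: lam_def algebra_simps)
    have ne: "norm e = 1" using hilbert_basis.norm_basis[OF E(1) e] .
    then have "e \<bullet> e = 1" by (simp add: norm_eq_1)
    then have "lam e \<ge> 0" using pos mem unfolding positive_op_def by fastforce
    moreover have "\<bar>lam e\<bar> \<ge> \<omega>"
      using om(2) mem self_adjoint_op_app[OF sa mem] ne by (force simp: Domain_iff)
    ultimately show "lam e \<ge> \<omega>" by simp
  qed
  moreover obtain D0 where D0: "countable D0" "closure (S ` cball 0 1) \<subseteq> closure D0"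
    using compact_countable_dense[OF comp'] by blast
  \<comment> \<open>\<open>Domain A\<close> is covered by the dilates of the image of the unit ball
    under \<open>S\<close>, and that image, being relatively compact, is approximated from the
    countable set \<open>D0\<close>.\<close>
  define D where "D = (\<Union>n::nat. (\<lambda>x. real n *\<^sub>R x) ` D0)"
  have "countable D" unfolding D_def using D0 by auto
  moreover have "Domain A \<subseteq> closure D"
  proof
    fix u assume "u \<in> Domain A"
    then obtain w where w: "(u, w) \<in> A" by blast
    define z where "z = w - \<mu> *\<^sub>R u"
    have "S z = u" by (rule Seq) (use w z_def in simp)
    obtain n :: nat where n: "norm z \<le> real n" "n > 0"
    proof -
      obtain n :: nat where "norm z \<le> real n" using real_arch_simple by blast
      then have "norm z \<le> real (Suc n)" by simp
      then show ?thesis using that[of "Suc n"] by simp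
    qed
    have "norm (z /\<^sub>R real n) \<le> 1" using n by (simp add: field_simps)
    then have "S (z /\<^sub>R real n) \<in> closure D0" using D0(2) closure_subset by (force simp: image_iff)
    then have "real n *\<^sub>R S (z /\<^sub>R real n) \<in> (\<lambda>x. real n *\<^sub>R x) ` closure D0" by blast
    also have "\<dots> = closure ((\<lambda>x. real n *\<^sub>R x) ` D0)" by (rule closure_scaleR)
    also have "\<dots> \<subseteq> closure D" by (rule closure_mono) (auto simp: D_def)
    finally show "u \<in> closure D" using n \<open>S z = u\<close> by (simp add: scS)
  qed
  then have "closure (Domain A) \<subseteq> closure D" by (simp add: closure_minimal)
  then have "closure D = UNIV" using sa unfolding self_adjoint_def by blast
  ultimately show ?thesis using E(1) by blast
qed

text \<open>\<open>a e\<close> is the eigenvalue of \<open>A^{1/2}\<close> at \<open>e\<close>. The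
  graph of the square root is written through its bounded inverse, which parametrizes it by the
  whole space. \<open>D\<close> records that the space is separable.\<close>

locale wave = hilbert_basis E for E :: "'h::{real_inner,complete_space} set" +
  fixes a :: "'h \<Rightarrow> real" and c :: real and A :: "('h \<times> 'h) set" and D :: "'h set"
  assumes c_pos: "c > 0" and a_ge: "e \<in> E \<Longrightarrow> a e \<ge> c"
    and sqrt_graph: "sqrt_op A = {(mult (\<lambda>e. 1 / a e) y, y) | y. True}"
    and D: "countable D" "closure D = UNIV"

text \<open>Since \<open>sqrt_op\<close> is a definite description, both existence and uniqueness of
  the positive square root have to be shown. Existence: the inverse of the diagonal operator with
  symbol \<open>1 / a\<close>. Uniqueness: any positive root \<open>S\<close> agrees with it on the
  eigenvectors of \<open>A\<close>; symmetry then gives one inclusion of graphs, self-adjointness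
  the other.\<close>

lemma wave_exists:
  fixes A :: "('h::{real_inner,complete_space} \<times> 'h) set"
  assumes sa: "self_adjoint A" and pos: "positive_op A" and cr: "compact_resolvent A"
    and om: "\<omega> > 0" "\<forall>u\<in>Domain A. norm (op_app A u) \<ge> \<omega> * norm u"
  shows "\<exists>E a c D. wave E a c A D"
proof -
  obtain E lam D where hb: "hilbert_basis E" and lam: "\<And>e. e \<in> E \<Longrightarrow> (e, lam e *\<^sub>R e) \<in> A"
    "\<And>e. e \<in> E \<Longrightarrow> lam e \<ge> \<omega>"
    and D: "countable D" "closure D = (UNIV :: 'h set)" using spectral[OF assms] by blast
  interpret hilbert_basis E by (rule hb)
  define a where "a e = sqrt (lam e)" for e
  have a_ge: "a e \<ge> sqrt \<omega>" if "e \<in> E" for e unfolding a_def using lam(2)[OF that] by simp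
  have a_pos: "a e > 0" if "e \<in> E" for e
    using a_ge[OF that] om(1) by (meson less_le_trans real_sqrt_gt_zero)
  have aa: "a e * a e = lam e" if "e \<in> E" for e
    using lam(2)[OF that] om(1) by (simp add: a_def)
  define R where "R = mult (\<lambda>e. 1 / a e)"
  have bdd: "bounded_symbol (\<lambda>e. 1 / a e)" unfolding bounded_symbol_def
  proof (intro exI ballI)
    fix e assume e: "e \<in> E"
    show "\<bar>1 / a e\<bar> \<le> 1 / sqrt \<omega>"
      using a_ge[OF e] a_pos[OF e] om(1) by (simp add: frac_le)
  qed
  have Rc: "R x \<bullet> e = (x \<bullet> e) / a e" if "e \<in> E" for x e
    unfolding R_def using mult_coord[OF bdd that] by simp
  have Rsym: "R x \<bullet> y = x \<bullet> R y" for x y unfolding R_def by (rule mult_sym[OF bdd])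
  have AR: "x = R (R w)" if "(x, w) \<in> A" for x w
  proof (rule vec_eqI)
    fix e assume e: "e \<in> E"
    have "w \<bullet> e = (x \<bullet> e) * (a e * a e)"
      using self_adjoint_sym[OF sa that lam(1)[OF e]] aa[OF e] by simp
    then show "x \<bullet> e = R (R w) \<bullet> e" using Rc[OF e] a_pos[OF e] by simp
  qed
  have RA: "(R (R w), w) \<in> A" for w
  proof -
    have "z \<bullet> R (R w) = x \<bullet> w" if "(x, z) \<in> A" for x z
      using AR[OF that] Rsym by metis
    then have "(R (R w), w) \<in> adjoint_graph A"
      unfolding adjoint_graph_def by blast
    then show ?thesis using sa self_adjoint_def by blast
  qed
  define S0 where "S0 = {(R y, y) | y. True}"
  have dense: "closure (Domain S0) = UNIV"
  proof -
    have "x \<in> closure (Domain S0)" for x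
      unfolding closure_approachable
    proof (intro allI impI)
      fix \<epsilon> :: real assume "\<epsilon> > 0"
      from finite_span_dense[OF this, of x] obtain F where F: "finite F" "F \<subseteq> E"
        "norm (x - (\<Sum>e\<in>F. (x \<bullet> e) *\<^sub>R e)) < \<epsilon>" by blast
      have "R (\<Sum>e\<in>F. (a e * (x \<bullet> e)) *\<^sub>R e) = (\<Sum>e\<in>F. (x \<bullet> e) *\<^sub>R e)"
      proof (rule vec_eqI)
        fix e assume e: "e \<in> E"
        show "R (\<Sum>e\<in>F. (a e * (x \<bullet> e)) *\<^sub>R e) \<bullet> e = (\<Sum>e\<in>F. (x \<bullet> e) *\<^sub>R e) \<bullet> e"
          using Rc[OF e] inner_sum_basis[OF F(1,2) e] a_pos[OF e] by simp
      qed
      then have "(\<Sum>e\<in>F. (x \<bullet> e) *\<^sub>R e) \<in> Domain S0" unfolding S0_def by (metis (mono_tags, lifting) Domain.simps mem_Collect_eq)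
      then show "\<exists>y\<in>Domain S0. dist y x < \<epsilon>" using F(3) by (metis dist_norm dist_commute)
    qed
    then show ?thesis by auto
  qed
  have saS: "self_adjoint S0"
    unfolding self_adjoint_def
  proof (intro conjI dense set_eqI)
    fix p :: "'h \<times> 'h"
    obtain y z where p: "p = (y, z)" by (cases p)
    have "(y, z) \<in> adjoint_graph S0 \<longleftrightarrow> (\<forall>x. x \<bullet> y = x \<bullet> R z)"
      unfolding adjoint_graph_def S0_def by (auto simp: Rsym)
    also have "\<dots> \<longleftrightarrow> y = R z" by (auto simp: vector_eq_ldot)
    also have "\<dots> \<longleftrightarrow> (y, z) \<in> S0" unfolding S0_def by auto
    finally show "p \<in> adjoint_graph S0 \<longleftrightarrow> p \<in> S0" unfolding p .
  qed
  have posS: "positive_op S0"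
  proof -
    \<comment> \<open>Positivity of \<open>R\<close> is read off from its own diagonal square
      root.\<close>
    have b2: "bounded_symbol (\<lambda>e. 1 / sqrt (a e))" unfolding bounded_symbol_def
    proof (intro exI ballI)
      fix e assume e: "e \<in> E"
      show "\<bar>1 / sqrt (a e)\<bar> \<le> 1 / sqrt (sqrt \<omega>)"
        using a_ge[OF e] a_pos[OF e] om(1) by (simp add: frac_le)
    qed
    have "y \<bullet> R y \<ge> 0" for y
    proof -
      have "R y = mult (\<lambda>e. 1 / sqrt (a e)) (mult (\<lambda>e. 1 / sqrt (a e)) y)"
        unfolding mult_mult[OF b2 b2] R_def
        using a_pos by (intro mult_cong) (auto simp: less_imp_le)
      then show ?thesis using mult_sym[OF b2, of y] by (metis inner_ge_zero)
    qed
    then show ?thesis unfolding positive_op_def S0_def by auto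
  qed
  have SS: "S0 O S0 = A"
    unfolding S0_def using AR RA by (auto simp: relcomp_unfold)
  have "sqrt_op A = S0" unfolding sqrt_op_def
  proof (rule the_equality)
    show "self_adjoint S0 \<and> positive_op S0 \<and> S0 O S0 = A" using saS posS SS by blast
    fix S assume "self_adjoint S \<and> positive_op S \<and> S O S = A"
    then have S: "self_adjoint S" "positive_op S" "S O S = A" by auto
    have eS: "(e, a e *\<^sub>R e) \<in> S" if e: "e \<in> E" for e
    proof -
      obtain g where g: "(e, g) \<in> S" "(g, lam e *\<^sub>R e) \<in> S" using lam(1)[OF e] S(3) by blast
      \<comment> \<open>With \<open>g = S e\<close>, the vector \<open>g - (a e) e\<close> is mapped
        by \<open>S\<close> to \<open>- a e\<close> times itself; positivity of \<open>S\<close>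
        forces it to vanish.\<close>
      have "(g + (- a e) *\<^sub>R e, lam e *\<^sub>R e + (- a e) *\<^sub>R g) \<in> S"
        by (rule self_adjoint_linear[OF S(1) g(2,1)])
      also have "lam e *\<^sub>R e + (- a e) *\<^sub>R g = (- a e) *\<^sub>R (g + (- a e) *\<^sub>R e)"
        using aa[OF e] by (simp add: algebra_simps)
      finally have "0 \<le> ((- a e) *\<^sub>R (g + (- a e) *\<^sub>R e)) \<bullet> (g + (- a e) *\<^sub>R e)"
        using S(2) unfolding positive_op_def by fast
      then have "(g + (- a e) *\<^sub>R e) \<bullet> (g + (- a e) *\<^sub>R e) \<le> 0"
        using a_pos[OF e] by (simp only: inner_scaleR_left) (simp add: mult_le_0_iff zero_le_mult_iff)
      then have "g = a e *\<^sub>R e" using inner_ge_zero[of "g + (- a e) *\<^sub>R e"]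
        by (metis add.inverse_inverse add_eq_0_iff dual_order.antisym inner_eq_zero_iff scaleR_minus_left)
      then show ?thesis using g by simp
    qed
    have SR: "x = R w" if "(x, w) \<in> S" for x w
    proof (rule vec_eqI)
      fix e assume e: "e \<in> E"
      show "x \<bullet> e = R w \<bullet> e"
        using self_adjoint_sym[OF S(1) that eS[OF e]] Rc[OF e] a_pos[OF e] by simp
    qed
    have "z \<bullet> R w = x \<bullet> w" if "(x, z) \<in> S" for x z w
      using SR[OF that] Rsym by metis
    then have "(R w, w) \<in> adjoint_graph S" for w
      unfolding adjoint_graph_def by blast
    then show "S = S0" unfolding S0_def using SR S(1) self_adjoint_def by fastforce
  qed
  then have "wave E a (sqrt \<omega>) A D"
    by unfold_locales (use om(1) a_ge D S0_def R_def in auto)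
  then show ?thesis by blast
qed

subsection \<open>The wave equation in spectral coordinates\<close>

lemma LINT_continuous:
  fixes g :: "real \<Rightarrow> real"
  assumes "continuous_on {a..b} g"
  shows "(LINT t:{a..b}|lebesgue. g t) = integral {a..b} g"
  by (rule set_lebesgue_integral_eq_integral(2)[OF absolutely_integrable_continuous_real[OF assms]])

lemma L2_on_continuous:
  fixes f :: "real \<Rightarrow> 'b::real_normed_vector"
  assumes "continuous_on {0..T} f"
  shows "L2_on T f"
proof -
  have "(\<lambda>x. indicator {0..T} x *\<^sub>R f x) \<in> borel_measurable lborel"
    using borel_measurable_continuous_on_indicator[OF _ assms] by simp
  then have "(\<lambda>x. indicator {0..T} x *\<^sub>R f x) \<in> borel_measurable lebesgue"
    by (rule measurable_completion)
  moreover have "continuous_on {0..T} (\<lambda>t. (norm (f t))\<^sup>2)" by (intro continuous_intros assms)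
  ultimately show ?thesis unfolding L2_on_def set_borel_measurable_def
    using absolutely_integrable_continuous_real by blast
qed

lemma has_real_derivative_inner:
  fixes f g :: "real \<Rightarrow> 'a::real_inner"
  assumes "(f has_vector_derivative f') (at t within S)" "(g has_vector_derivative g') (at t within S)"
  shows "((\<lambda>t. f t \<bullet> g t) has_real_derivative f t \<bullet> g' + f' \<bullet> g t) (at t within S)"
  unfolding has_real_derivative_iff_has_vector_derivative
  by (rule bounded_bilinear.has_vector_derivative[OF bounded_bilinear_inner assms])

lemma ftc_real:
  fixes f :: "real \<Rightarrow> real"
  assumes "a \<le> b" "\<And>x. x \<in> {a..b} \<Longrightarrow> (f has_real_derivative f' x) (at x within {a..b})"
  shows "integral {a..b} f' = f b - f a"
  by (rule integral_unique[OF fundamental_theorem_of_calculus])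
    (use assms in \<open>auto simp: has_real_derivative_iff_has_vector_derivative\<close>)

context wave
begin

definition R :: "'h \<Rightarrow> 'h" where "R = mult (\<lambda>e. 1 / a e)"
text \<open>\<open>J k\<close> is the spectral projection that regularizes solutions, and \<open>N k = J k R\<^sup>-\<^sup>1\<close>.\<close>

definition J :: "nat \<Rightarrow> 'h \<Rightarrow> 'h" where "J k = mult (\<lambda>e. if a e \<le> real k then 1 else 0)"
definition N :: "nat \<Rightarrow> 'h \<Rightarrow> 'h" where "N k = mult (\<lambda>e. if a e \<le> real k then a e else 0)"

lemma a_pos: "e \<in> E \<Longrightarrow> a e > 0"
  using a_ge[of e] c_pos by linarith

lemma bounded_symbol_R: "bounded_symbol (\<lambda>e. 1 / a e)"
  unfolding bounded_symbol_def
proof (intro exI ballI)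
  fix e assume "e \<in> E"
  then show "\<bar>1 / a e\<bar> \<le> 1 / c" using a_ge[of e] a_pos[of e] c_pos by (simp add: frac_le)
qed

lemma bounded_symbol_J: "bounded_symbol (\<lambda>e. if a e \<le> real k then 1 else 0)"
  unfolding bounded_symbol_def by (rule exI[of _ 1]) auto

lemma bounded_symbol_N: "bounded_symbol (\<lambda>e. if a e \<le> real k then a e else 0)"
  unfolding bounded_symbol_def by (rule exI[of _ "real k"]) (auto simp: less_imp_le a_pos abs_of_pos)

lemmas R_bl = bounded_linear_mult[OF bounded_symbol_R, folded R_def]
lemmas J_bl = bounded_linear_mult[OF bounded_symbol_J, folded J_def]
lemmas N_bl = bounded_linear_mult[OF bounded_symbol_N, folded N_def]
lemmas R_sym = mult_sym[OF bounded_symbol_R, folded R_def]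
lemmas J_sym = mult_sym[OF bounded_symbol_J, folded J_def]
lemmas N_sym = mult_sym[OF bounded_symbol_N, folded N_def]
lemmas R_coord = mult_coord[OF bounded_symbol_R, folded R_def]
lemmas J_coord = mult_coord[OF bounded_symbol_J, folded J_def]
lemmas N_coord = mult_coord[OF bounded_symbol_N, folded N_def]

sublocale R: bounded_linear R by (rule R_bl)
sublocale J: bounded_linear "J k" for k by (rule J_bl)
sublocale N: bounded_linear "N k" for k by (rule N_bl)

lemma norm_J: "norm (J k x) \<le> norm x"
  unfolding J_def using norm_mult_le[of "\<lambda>e. if a e \<le> real k then 1 else 0" 1 x] by auto

lemma norm_R: "norm (R x) \<le> (1 / c) * norm x"
  unfolding R_def
proof (rule norm_mult_le)
  show "\<bar>1 / a e\<bar> \<le> 1 / c" if "e \<in> E" for e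
    using a_ge[OF that] a_pos[OF that] c_pos by (simp add: frac_le)
qed (use c_pos in simp)

lemma R_inj: "R x = R y \<Longrightarrow> x = y"
proof (rule vec_eqI)
  fix e assume "R x = R y" "e \<in> E"
  then have "1 / a e * (x \<bullet> e) = 1 / a e * (y \<bullet> e)" using R_coord by metis
  then show "x \<bullet> e = y \<bullet> e" using a_pos[OF \<open>e \<in> E\<close>] by simp
qed

lemma R_pow_inj: "(R ^^ m) x = (R ^^ m) y \<Longrightarrow> x = y"
  by (induction m) (auto dest: R_inj)

lemma N_R: "N k (R x) = J k x"
  by (rule vec_eqI) (use a_pos in \<open>force simp: N_coord R_coord J_coord\<close>)

lemma R_N: "R (N k x) = J k x"
  by (rule vec_eqI) (use a_pos in \<open>force simp: N_coord R_coord J_coord\<close>)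

lemma J_R: "J k (R x) = R (J k x)"
  by (rule vec_eqI) (simp add: R_coord J_coord)

text \<open>Compare with a finite projection \<open>?y\<close> of \<open>x\<close>: once
  \<open>k\<close> exceeds \<open>a e\<close> on the finite set, each coordinate of
  \<open>x - J k x\<close> is zero or equal to that of \<open>x - ?y\<close>.\<close>

lemma J_lim: "(\<lambda>k. J k x) \<longlonglongrightarrow> x"
proof (rule LIMSEQ_I)
  fix \<epsilon> :: real assume "\<epsilon> > 0"
  from finite_span_dense[OF this, of x] obtain F where F: "finite F" "F \<subseteq> E"
    "norm (x - (\<Sum>e\<in>F. (x \<bullet> e) *\<^sub>R e)) < \<epsilon>" by blast
  let ?y = "\<Sum>e\<in>F. (x \<bullet> e) *\<^sub>R e"
  obtain K :: nat where K: "\<forall>e\<in>F. a e \<le> real K"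
  proof -
    obtain K :: nat where "Max (insert 0 (a ` F)) \<le> real K" using real_arch_simple by blast
    then show ?thesis using that[of K] F(1) by simp
  qed
  show "\<exists>no. \<forall>n\<ge>no. norm (J n x - x) < \<epsilon>"
  proof (intro exI allI impI)
    fix k assume "k \<ge> K"
    have "norm (x - J k x) \<le> norm (x - ?y)"
    proof (rule power2_le_imp_le[OF norm_le_coords_sum norm_ge_zero])
      fix G assume G: "finite G" "G \<subseteq> E"
      have "(\<Sum>e\<in>G. ((x - J k x) \<bullet> e)\<^sup>2) \<le> (\<Sum>e\<in>G. ((x - ?y) \<bullet> e)\<^sup>2)"
      proof (rule sum_mono)
        fix e assume "e \<in> G"
        then have e: "e \<in> E" using G by blast
        have "a e \<le> real k" if "e \<in> F" using K that \<open>k \<ge> K\<close> by force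
        then show "((x - J k x) \<bullet> e)\<^sup>2 \<le> ((x - ?y) \<bullet> e)\<^sup>2"
          using inner_sum_basis[OF F(1,2) e] J_coord[OF e]
          by (auto simp: inner_diff_left)
      qed
      also have "\<dots> \<le> (norm (x - ?y))\<^sup>2" by (rule bessel[OF G])
      finally show "(\<Sum>e\<in>G. ((x - J k x) \<bullet> e)\<^sup>2) \<le> (norm (x - ?y))\<^sup>2" .
    qed
    then show "norm (J k x - x) < \<epsilon>" using F(3) by (simp add: norm_minus_commute)
  qed
qed

section \<open>Norms and energies of every order through powers of \<open>R\<close>\<close>

lemma sqrt_relpow: "sqrt_op A ^^ m = {((R ^^ m) y, y) | y. True}"
proof (induction m)
  case (Suc m)
  have "sqrt_op A = {(R y, y) | y. True}" using sqrt_graph by (simp add: R_def)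
  then show ?case using Suc by (auto simp: relcomp_unfold funpow_swap1)
qed auto

lemma converse_sqrt_relpow: "(sqrt_op A)\<inverse> ^^ m = {(x, (R ^^ m) x) | x. True}"
proof (induction m)
  case (Suc m)
  have "(sqrt_op A)\<inverse> = {(y, R y) | y. True}" using sqrt_graph by (auto simp: R_def)
  then show ?case using Suc by (auto simp: relcomp_unfold)
qed auto

lemma Hsp_eq: "Hsp A m = range (R ^^ m)"
  unfolding Hsp_def half_pow_def using sqrt_relpow[of m] by auto

lemma op_app_half_pow: "op_app (half_pow A (int m)) ((R ^^ m) y) = y"
  unfolding op_app_def half_pow_def using sqrt_relpow[of m]
  by (intro the_equality) (auto dest: R_pow_inj)

lemma op_app_half_pow1: "op_app (half_pow A 1) (R y) = y"
  using op_app_half_pow[of 1 y] by simp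

lemma op_app_half_pow2: "op_app (half_pow A 2) (R (R y)) = y"
  using op_app_half_pow[of 2 y] by (simp add: eval_nat_numeral)

lemma op_app_half_pow_neg: "op_app (half_pow A (- int m)) x = (R ^^ m) x"
proof (cases "m = 0")
  case True then show ?thesis using op_app_half_pow[of 0 x] by simp
next
  case False
  then show ?thesis unfolding op_app_def half_pow_def using converse_sqrt_relpow[of m]
    by (intro the_equality) auto
qed

lemma energy_eq:
  "energy A (1 - int m) (R x) v = 1/2 * (norm ((R ^^ m) x, (R ^^ m) v))\<^sup>2"
proof -
  \<comment> \<open>For \<open>m \<ge> 1\<close> the order \<open>1 - m\<close> is not positive, and
    the \<open>R\<close> in the displacement completes \<open>R^{m-1}\<close> to \<open>R^m\<close>;
    for \<open>m = 0\<close> the operator of order 1 cancels it.\<close>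
  have "op_app (half_pow A (1 - int m)) (R x) = (R ^^ m) x"
  proof (cases m)
    case 0 then show ?thesis using op_app_half_pow1 by simp
  next
    case (Suc j)
    then show ?thesis using op_app_half_pow_neg[of j "R x"] by (simp add: funpow_swap1)
  qed
  moreover have "op_app (half_pow A (1 - int m - 1)) v = (R ^^ m) v"
    using op_app_half_pow_neg[of m v] by simp
  ultimately show ?thesis unfolding energy_def Hnorm_def by (simp add: norm_Pair)
qed

lemma energy1: "energy A 1 (R x) v = 1/2 * (norm (x, v))\<^sup>2"
  using energy_eq[of 0 x v] by simp

section \<open>The wave equation with continuous source\<close>

definition cw :: "real \<Rightarrow> (real \<Rightarrow> 'h) \<Rightarrow> (real \<Rightarrow> 'h) \<Rightarrow> (real \<Rightarrow> 'h) \<Rightarrow> bool" where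
  "cw T f x v \<longleftrightarrow> continuous_on {0..T} f \<and> continuous_on {0..T} x \<and> continuous_on {0..T} v \<and>
     (\<forall>t\<in>{0..T}. ((\<lambda>t. R (x t)) has_vector_derivative v t) (at t within {0..T})) \<and>
     (\<forall>t\<in>{0..T}. ((\<lambda>t. R (v t)) has_vector_derivative R (f t) - x t) (at t within {0..T}))"

lemma cwD:
  assumes "cw T f x v"
  shows "continuous_on {0..T} f" "continuous_on {0..T} x" "continuous_on {0..T} v"
    "t \<in> {0..T} \<Longrightarrow> ((\<lambda>t. R (x t)) has_vector_derivative v t) (at t within {0..T})"
    "t \<in> {0..T} \<Longrightarrow> ((\<lambda>t. R (v t)) has_vector_derivative R (f t) - x t) (at t within {0..T})"
  using assms unfolding cw_def by auto

lemma cw_imp_wave_sol: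
  assumes "cw T f x v"
  shows "wave_sol A T f (\<lambda>t. R (x t)) v"
  unfolding wave_sol_def
proof (intro conjI ballI)
  note cw = cwD[OF assms]
  show "L2_on T f" by (rule L2_on_continuous[OF cw(1)])
  show "R (x t) \<in> Hsp A 1" for t unfolding Hsp_eq by simp
  show "continuous_on {0..T} (\<lambda>t. op_app (half_pow A 1) (R (x t)))"
    unfolding op_app_half_pow1 by (rule cw(2))
  show "continuous_on {0..T} v" by (rule cw(3))
  show "((\<lambda>t. R (x t)) has_vector_derivative v t) (at t within {0..T})" if "t \<in> {0..T}" for t
    by (rule cw(4)[OF that])
  fix \<phi> t assume "\<phi> \<in> Hsp A 1" and t: "t \<in> {0..T}"
  then obtain \<psi> where \<psi>: "\<phi> = R \<psi>" unfolding Hsp_eq by auto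
  have sub: "{0..t} \<subseteq> {0..T}" using t by auto
  have c1: "continuous_on {0..t} (\<lambda>s. x s \<bullet> \<psi>)" "continuous_on {0..t} (\<lambda>s. f s \<bullet> \<phi>)"
    by (intro continuous_intros continuous_on_subset[OF _ sub] cw)+
  have "integral {0..t} (\<lambda>s. (f s \<bullet> \<phi>) - (x s \<bullet> \<psi>)) = v t \<bullet> \<phi> - v 0 \<bullet> \<phi>"
  proof (rule ftc_real)
    fix s assume s: "s \<in> {0..t}"
    have "((\<lambda>t. R (v t) \<bullet> \<psi>) has_real_derivative R (v s) \<bullet> 0 + (R (f s) - x s) \<bullet> \<psi>) (at s within {0..t})"
      by (rule has_real_derivative_inner[OF has_vector_derivative_within_subset[OF cw(5) sub]])
        (use s sub in auto)
    then show "((\<lambda>t. v t \<bullet> \<phi>) has_real_derivative f s \<bullet> \<phi> - x s \<bullet> \<psi>) (at s within {0..t})"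
      by (simp add: \<psi> R_sym inner_diff_left)
  qed (use t in simp)
  moreover have "integral {0..t} (\<lambda>s. (f s \<bullet> \<phi>) - (x s \<bullet> \<psi>))
      = integral {0..t} (\<lambda>s. f s \<bullet> \<phi>) - integral {0..t} (\<lambda>s. x s \<bullet> \<psi>)"
    by (intro Henstock_Kurzweil_Integration.integral_diff integrable_continuous_real c1)
  ultimately show "v t \<bullet> \<phi> - v 0 \<bullet> \<phi> +
       (LINT s:{0..t}|lebesgue. op_app (half_pow A 1) (R (x s)) \<bullet> op_app (half_pow A 1) \<phi>)
     = (LINT s:{0..t}|lebesgue. f s \<bullet> \<phi>)"
    unfolding \<psi> op_app_half_pow1 using LINT_continuous[OF c1(1)] LINT_continuous[OF c1(2)] \<psi> by simp
qed

text \<open>Testing the weak equation with \<open>R e\<close> gives an integral formula for the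
  coordinate of \<open>R v\<close> at \<open>e\<close>. As the source is continuous, each coordinate
  is differentiable, and \<open>has_vector_derivative_coords\<close> upgrades this to a derivative
  in norm.\<close>

lemma wave_sol_imp_cw:
  assumes w: "wave_sol A T f w v" and f: "continuous_on {0..T} f"
  shows "\<exists>x. cw T f x v \<and> (\<forall>t\<in>{0..T}. w t = R (x t))"
proof -
  define x where "x t = op_app (half_pow A 1) (w t)" for t
  have wx: "w t = R (x t)" if "t \<in> {0..T}" for t
  proof -
    have "w t \<in> Hsp A 1" using w that unfolding wave_sol_def by blast
    then obtain y where "w t = R y" unfolding Hsp_eq by auto
    then show ?thesis using op_app_half_pow1 by (simp add: x_def)
  qed
  have x: "continuous_on {0..T} x" using w unfolding wave_sol_def x_def[symmetric] by blast
  have v: "continuous_on {0..T} v" using w unfolding wave_sol_def by blast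
  have "((\<lambda>t. R (x t)) has_vector_derivative v t) (at t within {0..T})" if t: "t \<in> {0..T}" for t
  proof -
    have "(w has_vector_derivative v t) (at t within {0..T})" using w t unfolding wave_sol_def by blast
    then show ?thesis by (rule has_vector_derivative_transform[OF t, rotated]) (use wx in simp)
  qed
  moreover have "((\<lambda>t. R (v t)) has_vector_derivative R (f t) - x t) (at t within {0..T})"
    if t: "t \<in> {0..T}" for t
  proof (rule has_vector_derivative_coords[OF _ _ t])
    show "continuous_on {0..T} (\<lambda>t. R (f t) - x t)"
      by (intro continuous_intros x R.continuous_on f)
    fix e s assume e: "e \<in> E" and s: "s \<in> {0..T}"
    have c1: "continuous_on {0..T} (\<lambda>s. x s \<bullet> e)" "continuous_on {0..T} (\<lambda>s. f s \<bullet> R e)"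
      by (intro continuous_intros x f)+
    have eq: "R (v r) \<bullet> e = v 0 \<bullet> R e + integral {0..r} (\<lambda>s. f s \<bullet> R e) - integral {0..r} (\<lambda>s. x s \<bullet> e)"
      if r: "r \<in> {0..T}" for r
    proof -
      have sub: "{0..r} \<subseteq> {0..T}" using r by auto
      have "R e \<in> Hsp A 1" unfolding Hsp_eq by simp
      then have "v r \<bullet> R e - v 0 \<bullet> R e + (LINT s:{0..r}|lebesgue. x s \<bullet> op_app (half_pow A 1) (R e))
        = (LINT s:{0..r}|lebesgue. f s \<bullet> R e)"
        using w r unfolding wave_sol_def x_def[symmetric] by blast
      then show ?thesis unfolding op_app_half_pow1
        using LINT_continuous[OF continuous_on_subset[OF c1(1) sub]]
          LINT_continuous[OF continuous_on_subset[OF c1(2) sub]] by (simp add: R_sym)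
    qed
    have "((\<lambda>r. v 0 \<bullet> R e + integral {0..r} (\<lambda>s. f s \<bullet> R e) - integral {0..r} (\<lambda>s. x s \<bullet> e))
        has_real_derivative 0 + f s \<bullet> R e - x s \<bullet> e) (at s within {0..T})"
      by (intro DERIV_diff DERIV_add DERIV_const integral_has_real_derivative c1 s)
    then have "((\<lambda>r. v 0 \<bullet> R e + integral {0..r} (\<lambda>s. f s \<bullet> R e) - integral {0..r} (\<lambda>s. x s \<bullet> e))
        has_real_derivative (R (f s) - x s) \<bullet> e) (at s within {0..T})"
      by (simp add: R_sym inner_diff_left)
    then show "((\<lambda>t. R (v t) \<bullet> e) has_real_derivative (R (f s) - x s) \<bullet> e) (at s within {0..T})"
      unfolding has_real_derivative_iff_has_vector_derivative
      by (rule has_vector_derivative_transform[OF s, rotated]) (use eq in simp)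
  qed
  ultimately show ?thesis unfolding cw_def using f x v wx by blast
qed

text \<open>Used with powers of \<open>R\<close>, which gives the equation in weaker norms, and with
  \<open>J k\<close>, which gives it for truncated solutions.\<close>

lemma cw_commute:
  assumes L: "bounded_linear L" "\<And>x. L (R x) = R (L x)" and w: "cw T f x v"
  shows "cw T (\<lambda>t. L (f t)) (\<lambda>t. L (x t)) (\<lambda>t. L (v t))"
proof -
  note cw = cwD[OF w]
  show ?thesis unfolding cw_def
  proof (intro conjI ballI)
    fix t assume t: "t \<in> {0..T}"
    show "((\<lambda>t. R (L (x t))) has_vector_derivative L (v t)) (at t within {0..T})"
      using bounded_linear.has_vector_derivative[OF L(1) cw(4)[OF t]] by (simp add: L(2))
    show "((\<lambda>t. R (L (v t))) has_vector_derivative R (L (f t)) - L (x t)) (at t within {0..T})"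
      using bounded_linear.has_vector_derivative[OF L(1) cw(5)[OF t]]
      by (simp add: L(2) linear_diff[OF bounded_linear.linear[OF L(1)]])
  qed (intro bounded_linear.continuous_on[OF L(1)] cw)+
qed

lemma R_pow_bl: "bounded_linear (R ^^ m)"
proof (induction m)
  case 0 show ?case using bounded_linear_ident by (simp add: id_def)
next
  case (Suc m)
  then show ?case using bounded_linear_compose[OF R_bl] by (simp add: o_def)
qed

lemma cw_J: "cw T f x v \<Longrightarrow> cw T (\<lambda>t. J k (f t)) (\<lambda>t. J k (x t)) (\<lambda>t. J k (v t))"
  by (rule cw_commute[OF J_bl J_R])

lemma cw_R_pow: "cw T f x v \<Longrightarrow> cw T (\<lambda>t. (R^^m) (f t)) (\<lambda>t. (R^^m) (x t)) (\<lambda>t. (R^^m) (v t))"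
  by (rule cw_commute[OF R_pow_bl]) (simp_all add: funpow_swap1)

lemma cw_diff:
  assumes "cw T f x v" "cw T g y u"
  shows "cw T (\<lambda>t. f t - g t) (\<lambda>t. x t - y t) (\<lambda>t. v t - u t)"
proof -
  note 1 = cwD[OF assms(1)] and 2 = cwD[OF assms(2)]
  show ?thesis unfolding cw_def
  proof (intro conjI ballI)
    fix t assume t: "t \<in> {0..T}"
    show "((\<lambda>t. R (x t - y t)) has_vector_derivative v t - u t) (at t within {0..T})"
      using has_vector_derivative_diff[OF 1(4)[OF t] 2(4)[OF t]] by (simp add: R.diff)
    show "((\<lambda>t. R (v t - u t)) has_vector_derivative R (f t - g t) - (x t - y t)) (at t within {0..T})"
      using has_vector_derivative_diff[OF 1(5)[OF t] 2(5)[OF t]] by (simp add: R.diff algebra_simps)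
  qed (intro continuous_intros 1 2)+
qed

lemma cw_shift:
  assumes w: "cw T f x v" and b: "0 \<le> b" "b + \<tau> \<le> T"
  shows "cw \<tau> (\<lambda>t. f (b + t)) (\<lambda>t. x (b + t)) (\<lambda>t. v (b + t))"
proof -
  note cw = cwD[OF w]
  have sub: "(\<lambda>t. b + t) ` {0..\<tau>} \<subseteq> {0..T}" using b by auto
  have cont: "continuous_on {0..\<tau>} (\<lambda>t. g (b + t))" if "continuous_on {0..T} g" for g :: "real \<Rightarrow> 'h"
    by (rule continuous_on_compose2[OF that _ sub]) (intro continuous_intros)
  have der: "((\<lambda>t. g (b + t)) has_vector_derivative g' (b + t)) (at t within {0..\<tau>})"
    if t: "t \<in> {0..\<tau>}" and g: "\<And>s. s \<in> {0..T} \<Longrightarrow> (g has_vector_derivative g' s) (at s within {0..T})"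
    for g g' :: "real \<Rightarrow> 'h" and t
  proof -
    have "(g has_vector_derivative g' (b + t)) (at (b + t) within (\<lambda>t. b + t) ` {0..\<tau>})"
      by (rule has_vector_derivative_within_subset[OF g sub]) (use t b in auto)
    moreover have "((\<lambda>t. b + t) has_vector_derivative 1) (at t within {0..\<tau>})"
      by (auto intro!: derivative_eq_intros)
    ultimately show ?thesis
      using vector_diff_chain_within[of "\<lambda>t. b + t" 1 t "{0..\<tau>}" g] by (simp add: o_def)
  qed
  show ?thesis unfolding cw_def
  proof (intro conjI ballI cont cw(1-3))
    fix t assume t: "t \<in> {0..\<tau>}"
    show "((\<lambda>t. R (x (b + t))) has_vector_derivative v (b + t)) (at t within {0..\<tau>})"
      by (rule der[OF t cw(4)])
    show "((\<lambda>t. R (v (b + t))) has_vector_derivative R (f (b + t)) - x (b + t)) (at t within {0..\<tau>})"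
      by (rule der[OF t cw(5)])
  qed
qed

text \<open>Only \<open>R x\<close> and \<open>R v\<close> are differentiable by assumption.
  Applying the bounded operator \<open>N k\<close>, which cancels \<open>R\<close> below the cutoff,
  differentiates the truncations themselves.\<close>

lemma cw_J_deriv:
  assumes "cw T f x v" "t \<in> {0..T}"
  shows "((\<lambda>t. J k (x t)) has_vector_derivative N k (v t)) (at t within {0..T})"
    "((\<lambda>t. J k (v t)) has_vector_derivative J k (f t) - N k (x t)) (at t within {0..T})"
  using bounded_linear.has_vector_derivative[OF N_bl cwD(4)[OF assms]]
    bounded_linear.has_vector_derivative[OF N_bl cwD(5)[OF assms]]
  by (simp_all add: N_R N.diff)

lemma N_J_swap: "N k x \<bullet> J k y = J k x \<bullet> N k y"
proof -
  have "N k x \<bullet> J k y = x \<bullet> N k (J k y)" by (rule N_sym)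
  also have "N k (J k y) = J k (N k y)" by (rule vec_eqI) (simp add: N_coord J_coord)
  finally show ?thesis by (simp add: J_sym)
qed

text \<open>The squared energy norm of the truncation has derivative
  \<open>2 * (J k v \<bullet> J k f)\<close>, because the wave part is skew. For its square root
  this yields the Lipschitz constant \<open>M\<close> whatever the truncation, and \<open>k\<close>
  tends to infinity.\<close>

lemma cw_norm_lipschitz:
  assumes w: "cw T f x v" and st: "0 \<le> s" "s \<le> t" "t \<le> T"
    and M: "\<And>r. r \<in> {s..t} \<Longrightarrow> norm (f r) \<le> M"
  shows "\<bar>norm (x t, v t) - norm (x s, v s)\<bar> \<le> M * (t - s)"
proof -
  have "0 \<le> M" using M[of s] st norm_ge_zero order_trans by (metis atLeastAtMost_iff order_refl)
  \<comment> \<open>The term \<open>1 / (k + 1)\<close> keeps the square root differentiable where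
    the energy vanishes, and disappears in the limit.\<close>
  define n where "n k r = (J k (x r) \<bullet> J k (x r) + J k (v r) \<bullet> J k (v r)) + 1 / real (Suc k)" for k r
  have npos: "n k r > 0" for k r
    unfolding n_def by (intro add_nonneg_pos add_nonneg_nonneg) auto
  have sub: "{s..t} \<subseteq> {0..T}" using st by auto
  have *: "\<bar>sqrt (n k t) - sqrt (n k s)\<bar> \<le> M * (t - s)" for k
  proof -
    define d where "d r = 2 * (J k (v r) \<bullet> J k (f r)) * (inverse (sqrt (n k r)) / 2)" for r
    have der: "((\<lambda>r. sqrt (n k r)) has_real_derivative d r) (at r within {s..t})" if r: "r \<in> {s..t}" for r
    proof -
      note J = cw_J_deriv[OF w subsetD[OF sub r], of k, THEN has_vector_derivative_within_subset, OF sub]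
      have "(n k has_real_derivative (J k (x r) \<bullet> N k (v r) + N k (v r) \<bullet> J k (x r)
         + (J k (v r) \<bullet> (J k (f r) - N k (x r)) + (J k (f r) - N k (x r)) \<bullet> J k (v r))) + 0) (at r within {s..t})"
        unfolding n_def by (intro DERIV_add DERIV_const has_real_derivative_inner J)
      moreover have "J k (x r) \<bullet> N k (v r) + N k (v r) \<bullet> J k (x r)
         + (J k (v r) \<bullet> (J k (f r) - N k (x r)) + (J k (f r) - N k (x r)) \<bullet> J k (v r)) + 0 = 2 * (J k (v r) \<bullet> J k (f r))"
        using N_J_swap[of k "x r" "v r"] by (simp add: inner_diff_left inner_diff_right inner_commute)
      ultimately have "(n k has_real_derivative 2 * (J k (v r) \<bullet> J k (f r))) (at r within {s..t})" by simp
      from DERIV_chain2[OF DERIV_real_sqrt[OF npos] this] show ?thesis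
        unfolding d_def by (simp add: mult_ac)
    qed
    have bd: "\<bar>d r\<bar> \<le> M" if r: "r \<in> {s..t}" for r
    proof -
      have "\<bar>J k (v r) \<bullet> J k (f r)\<bar> \<le> norm (J k (v r)) * norm (J k (f r))" by (rule Cauchy_Schwarz_ineq2)
      also have "\<dots> \<le> sqrt (n k r) * M"
      proof (rule mult_mono)
        have "(norm (J k (v r)))\<^sup>2 \<le> n k r" unfolding n_def power2_norm_eq_inner by simp
        then show "norm (J k (v r)) \<le> sqrt (n k r)" by (rule real_le_rsqrt)
        show "norm (J k (f r)) \<le> M" using norm_J[of k "f r"] M[OF r] by linarith
      qed (use npos[of k r] in auto)
      finally have "\<bar>J k (v r) \<bullet> J k (f r)\<bar> \<le> sqrt (n k r) * M" .
      then show ?thesis unfolding d_def abs_mult using npos[of k r]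
        by (simp add: field_simps)
    qed
    have "norm (sqrt (n k t) - sqrt (n k s)) \<le> M * norm (t - s)"
    proof (rule differentiable_bound[where S = "{s..t}" and f' = "\<lambda>r. (*) (d r)"])
      show "((\<lambda>r. sqrt (n k r)) has_derivative (*) (d r)) (at r within {s..t})" if "r \<in> {s..t}" for r
        using der[OF that] by (simp add: has_field_derivative_def)
      show "onorm ((*) (d r)) \<le> M" if "r \<in> {s..t}" for r
        by (rule onorm_le) (use bd[OF that] in \<open>simp add: abs_mult mult_right_mono\<close>)
    qed (use st in auto)
    then show ?thesis using st by simp
  qed
  have lim: "(\<lambda>k. sqrt (n k r)) \<longlonglongrightarrow> norm (x r, v r)" for r
  proof -
    have "(\<lambda>k. sqrt (n k r)) \<longlonglongrightarrow> sqrt ((x r \<bullet> x r + v r \<bullet> v r) + 0)"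
      unfolding n_def
      by (intro tendsto_intros J_lim LIMSEQ_inverse_real_of_nat[unfolded inverse_eq_divide])
    then show ?thesis by (simp add: norm_Pair power2_norm_eq_inner)
  qed
  show ?thesis
    by (rule LIMSEQ_le_const2[OF tendsto_rabs[OF tendsto_diff[OF lim lim]]]) (use * in auto)
qed

text \<open>Green's identity: each equation is paired with the displacement of the other. Only the
  velocities have to be truncated, since the displacements are differentiable; the contributions of
  \<open>A\<close> and the products of velocities cancel by symmetry of \<open>N k\<close> and
  \<open>J k\<close>. Dominated convergence removes the truncation.\<close>

lemma cw_duality:
  assumes 1: "cw T f x v" and 2: "cw T g y u" and T: "0 \<le> T"
  shows "integral {0..T} (\<lambda>t. f t \<bullet> R (y t) - g t \<bullet> R (x t))
    = (v T \<bullet> R (y T) - u T \<bullet> R (x T)) - (v 0 \<bullet> R (y 0) - u 0 \<bullet> R (x 0))"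
proof -
  note c = cwD(1-3)[OF 1] cwD(1-3)[OF 2]
  let ?h = "\<lambda>k t. J k (v t) \<bullet> R (y t) - J k (u t) \<bullet> R (x t)"
  let ?d = "\<lambda>k t. J k (f t) \<bullet> R (y t) - J k (g t) \<bullet> R (x t)"
  have k: "integral {0..T} (?d k) = ?h k T - ?h k 0" for k
  proof (rule ftc_real[OF T])
    fix t assume t: "t \<in> {0..T}"
    have "(?h k has_real_derivative (J k (v t) \<bullet> u t + (J k (f t) - N k (x t)) \<bullet> R (y t))
       - (J k (u t) \<bullet> v t + (J k (g t) - N k (y t)) \<bullet> R (x t))) (at t within {0..T})"
      by (intro DERIV_diff has_real_derivative_inner cw_J_deriv[OF 1 t] cw_J_deriv[OF 2 t]
          cwD(4)[OF 1 t] cwD(4)[OF 2 t])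
    moreover have "N k (x t) \<bullet> R (y t) = N k (y t) \<bullet> R (x t)"
      using N_sym[of k "x t" "R (y t)"] N_sym[of k "y t" "R (x t)"] J_sym[of k "x t" "y t"]
      by (simp add: N_R inner_commute)
    moreover have "J k (v t) \<bullet> u t = J k (u t) \<bullet> v t"
      using J_sym[of k "v t" "u t"] by (simp add: inner_commute)
    ultimately show "(?h k has_real_derivative ?d k t) (at t within {0..T})"
      by (simp add: inner_diff_left)
  qed
  have l1: "(\<lambda>k. ?h k T - ?h k 0) \<longlonglongrightarrow>
      (v T \<bullet> R (y T) - u T \<bullet> R (x T)) - (v 0 \<bullet> R (y 0) - u 0 \<bullet> R (x 0))"
    by (intro tendsto_intros J_lim)
  have "(\<lambda>k. integral {0..T} (?d k)) \<longlonglongrightarrow> integral {0..T} (\<lambda>t. f t \<bullet> R (y t) - g t \<bullet> R (x t))"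
  proof (rule dominated_convergence(2))
    show "?d k integrable_on {0..T}" for k
      by (intro integrable_continuous_real continuous_intros J.continuous_on R.continuous_on c)
    show "(\<lambda>t. norm (f t) * norm (R (y t)) + norm (g t) * norm (R (x t))) integrable_on {0..T}"
      by (intro integrable_continuous_real continuous_intros J.continuous_on R.continuous_on c)
    show "norm (?d k t) \<le> norm (f t) * norm (R (y t)) + norm (g t) * norm (R (x t))" for k t
    proof -
      have b: "\<bar>J k p \<bullet> q\<bar> \<le> norm p * norm q" for p q
        using Cauchy_Schwarz_ineq2[of "J k p" q] norm_J[of k p]
        by (meson mult_right_mono norm_ge_zero order_trans)
      show ?thesis using b[of "f t" "R (y t)"] b[of "g t" "R (x t)"]
        unfolding real_norm_def by linarith
    qed
    show "(\<lambda>k. ?d k t) \<longlonglongrightarrow> f t \<bullet> R (y t) - g t \<bullet> R (x t)" for t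
      by (intro tendsto_intros J_lim)
  qed
  then show ?thesis using l1 unfolding k by (rule LIMSEQ_unique)
qed

section \<open>Free waves with arbitrary initial data\<close>

text \<open>Continuity of the symbols need not be uniform over \<open>E\<close>, so there need be
  none in operator norm; the uniform bound 1 and approximation by finite combinations give
  continuity for each fixed \<open>x\<close>.\<close>

lemma mult_strong_continuous:
  assumes g: "\<And>t e. e \<in> E \<Longrightarrow> \<bar>g t e\<bar> \<le> 1" and gc: "\<And>e. continuous_on S (\<lambda>t. g t e)"
  shows "continuous_on S (\<lambda>t::real. mult (g t) x)"
  unfolding continuous_on_iff
proof (intro ballI allI impI)
  fix t and \<epsilon> :: real assume t: "t \<in> S" and \<epsilon>: "\<epsilon> > 0"
  have bd: "bounded_symbol (g s)" for s unfolding bounded_symbol_def using g by blast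
  have "\<epsilon> / 3 > 0" using \<epsilon> by simp
  from finite_span_dense[OF this, of x] obtain F where
    F: "finite F" "F \<subseteq> E" "norm (x - (\<Sum>e\<in>F. (x \<bullet> e) *\<^sub>R e)) < \<epsilon> / 3" by blast
  let ?y = "\<Sum>e\<in>F. (x \<bullet> e) *\<^sub>R e"
  have my: "mult (g s) ?y = (\<Sum>e\<in>F. (g s e * (x \<bullet> e)) *\<^sub>R e)" for s
    by (rule vec_eqI) (simp add: mult_coord[OF bd] inner_sum_basis[OF F(1,2)])
  have "continuous_on S (\<lambda>s. mult (g s) ?y)" unfolding my by (intro continuous_intros gc)
  then obtain d where d: "d > 0" "\<And>s. s \<in> S \<Longrightarrow> dist s t < d \<Longrightarrow> dist (mult (g s) ?y) (mult (g t) ?y) < \<epsilon> / 3"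
    unfolding continuous_on_iff using t \<open>\<epsilon> / 3 > 0\<close> by meson
  have near: "dist (mult (g s) x) (mult (g s) ?y) < \<epsilon> / 3" for s
  proof -
    have "mult (g s) x - mult (g s) ?y = mult (g s) (x - ?y)"
      using linear_diff[OF bounded_linear.linear[OF bounded_linear_mult[OF bd]]] by simp
    also have "norm \<dots> \<le> 1 * norm (x - ?y)" by (rule norm_mult_le) (use g in auto)
    finally show ?thesis using F(3) by (simp add: dist_norm)
  qed
  show "\<exists>d>0. \<forall>x'\<in>S. dist x' t < d \<longrightarrow> dist (mult (g x') x) (mult (g t) x) < \<epsilon>"
  proof (intro exI[of _ d] conjI d(1) ballI impI)
    fix s assume "s \<in> S" "dist s t < d"
    then show "dist (mult (g s) x) (mult (g t) x) < \<epsilon>"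
      using d(2)[of s] near[of s] near[of t]
        dist_triangle_third[of "mult (g s) x" "mult (g s) ?y" \<epsilon> "mult (g t) ?y" "mult (g t) x"]
      by (simp add: dist_commute)
  qed
qed

text \<open>In the variables \<open>(x, v)\<close> the free evolution rotates each coordinate pair
  by the angle \<open>t * a e\<close>. Derivatives are computed coordinatewise and assembled by
  \<open>has_vector_derivative_coords\<close>.\<close>

lemma free_wave_exists: "\<exists>x v. cw T (\<lambda>t. 0) x v \<and> x 0 = x0 \<and> v 0 = v0"
proof -
  define gc gs where "gc t e = cos (t * a e)" and "gs t e = sin (t * a e)" for t e
  have b: "\<bar>gc t e\<bar> \<le> 1" "\<bar>gs t e\<bar> \<le> 1" for t e by (simp_all add: gc_def gs_def)
  have bd: "bounded_symbol (gc t)" "bounded_symbol (gs t)" for t unfolding bounded_symbol_def using b by blast+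
  note co = mult_coord[OF bd(1)] mult_coord[OF bd(2)]
  have ct: "continuous_on S (\<lambda>t. mult (gc t) y)" "continuous_on S (\<lambda>t. mult (gs t) y)" for S y
    by (intro mult_strong_continuous b; unfold gc_def gs_def; intro continuous_intros)+
  define x where "x t = mult (gc t) x0 + mult (gs t) v0" for t
  define v where "v t = mult (gc t) v0 - mult (gs t) x0" for t
  have cx: "continuous_on {0..T} x" "continuous_on {0..T} v"
    unfolding x_def v_def by (intro continuous_intros ct)+
  have d1: "((\<lambda>t. R (x t)) has_vector_derivative v t) (at t within {0..T})" if "t \<in> {0..T}" for t
  proof (rule has_vector_derivative_coords[OF _ cx(2) that])
    fix e t assume e: "e \<in> E"
    have "R (x t) \<bullet> e = (1 / a e) * (cos (t * a e) * (x0 \<bullet> e) + sin (t * a e) * (v0 \<bullet> e))" for t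
      unfolding x_def R_coord[OF e] inner_add_left co[OF e] by (simp add: gc_def gs_def)
    moreover have "v t \<bullet> e = (1 / a e) * ((- sin (t * a e) * (1 * a e)) * (x0 \<bullet> e) + (cos (t * a e) * (1 * a e)) * (v0 \<bullet> e))"
      unfolding v_def inner_diff_left co[OF e] using less_imp_neq[OF a_pos[OF e]] by (simp add: gc_def gs_def field_simps)
    moreover have "((\<lambda>t. (1 / a e) * (cos (t * a e) * (x0 \<bullet> e) + sin (t * a e) * (v0 \<bullet> e))) has_real_derivative
      (1 / a e) * ((- sin (t * a e) * (1 * a e)) * (x0 \<bullet> e) + (cos (t * a e) * (1 * a e)) * (v0 \<bullet> e))) (at t within {0..T})"
      using less_imp_neq[OF a_pos[OF e]] by (auto intro!: derivative_eq_intros)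
    ultimately show "((\<lambda>t. R (x t) \<bullet> e) has_real_derivative v t \<bullet> e) (at t within {0..T})" by (simp only:)
  qed
  have d2: "((\<lambda>t. R (v t)) has_vector_derivative R 0 - x t) (at t within {0..T})" if "t \<in> {0..T}" for t
  proof (rule has_vector_derivative_coords[OF _ _ that])
    show "continuous_on {0..T} (\<lambda>t. R 0 - x t)" by (intro continuous_intros cx)
    fix e t assume e: "e \<in> E"
    have "R (v t) \<bullet> e = (1 / a e) * (cos (t * a e) * (v0 \<bullet> e) - sin (t * a e) * (x0 \<bullet> e))" for t
      unfolding v_def R_coord[OF e] inner_diff_left co[OF e] by (simp add: gc_def gs_def)
    moreover have "(R 0 - x t) \<bullet> e = (1 / a e) * ((- sin (t * a e) * (1 * a e)) * (v0 \<bullet> e) - (cos (t * a e) * (1 * a e)) * (x0 \<bullet> e))"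
      unfolding x_def inner_diff_left inner_add_left co[OF e] R.zero using less_imp_neq[OF a_pos[OF e]]
      by (simp add: gc_def gs_def field_simps)
    moreover have "((\<lambda>t. (1 / a e) * (cos (t * a e) * (v0 \<bullet> e) - sin (t * a e) * (x0 \<bullet> e))) has_real_derivative
      (1 / a e) * ((- sin (t * a e) * (1 * a e)) * (v0 \<bullet> e) - (cos (t * a e) * (1 * a e)) * (x0 \<bullet> e))) (at t within {0..T})"
      using less_imp_neq[OF a_pos[OF e]] by (auto intro!: derivative_eq_intros)
    ultimately show "((\<lambda>t. R (v t) \<bullet> e) has_real_derivative (R 0 - x t) \<bullet> e) (at t within {0..T})" by (simp only:)
  qed
  have "mult (gc 0) y = y" "mult (gs 0) y = 0" for y
    by (rule vec_eqI; simp add: co; simp add: gc_def gs_def)+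
  then have "x 0 = x0" "v 0 = v0" by (simp_all add: x_def v_def)
  moreover have "cw T (\<lambda>t. 0) x v" unfolding cw_def using cx d1 d2 by auto
  ultimately show ?thesis by blast
qed

end

subsection \<open>Completeness of \<open>L\<^sup>2\<close> and the admissibility bound\<close>

lemma indicator_continuous_measurable:
  fixes f :: "real \<Rightarrow> 'b::real_normed_vector"
  assumes "continuous_on {0..T} f"
  shows "(\<lambda>x. indicator {0..T} x *\<^sub>R f x) \<in> borel_measurable lebesgue"
  using L2_on_continuous[OF assms] unfolding L2_on_def set_borel_measurable_def by blast

lemma dist_sq_le: "(norm (x - z))\<^sup>2 \<le> 2 * (norm (x - y))\<^sup>2 + 2 * (norm (y - z))\<^sup>2"
  for x :: "'a::real_normed_vector"
proof -
  have "(norm (x - z))\<^sup>2 \<le> (norm (x - y) + norm (y - z))\<^sup>2"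
    by (intro power_mono norm_diff_triangle_le[OF order_refl order_refl] norm_ge_zero)
  also have "\<dots> \<le> 2 * (norm (x - y))\<^sup>2 + 2 * (norm (y - z))\<^sup>2"
    using sum_squares_bound[of "norm (x - y)" "norm (y - z)"] by (simp add: power2_sum)
  finally show ?thesis .
qed

lemma norm_diff_sq_le: "(norm (x - y))\<^sup>2 \<le> 2 * (norm x)\<^sup>2 + 2 * (norm y)\<^sup>2"
  for x :: "'a::real_normed_vector"
  using dist_sq_le[of x y 0] by simp

text \<open>Completeness in the form needed for continuous functions. Increments of a subsequence
  are made so small that a weighted series of their squares is integrable; its sum \<open>h\<close>
  governs both the pointwise rate of convergence and the final \<open>L^2\<close> error.\<close>

lemma L2_complete:
  fixes b :: "nat \<Rightarrow> real \<Rightarrow> 'g::{real_normed_vector,complete_space}"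
  assumes cont: "\<And>k. continuous_on {0..T} (b k)"
    and cauchy: "\<And>\<epsilon>. \<epsilon> > 0 \<Longrightarrow>
      \<exists>N. \<forall>k\<ge>N. \<forall>l\<ge>N. (LINT t:{0..T}|lebesgue. (norm (b k t - b l t))\<^sup>2) \<le> \<epsilon>"
  shows "\<exists>y s. L2_on T y \<and> strict_mono (s :: nat \<Rightarrow> nat) \<and>
    (\<forall>j. set_integrable lebesgue {0..T} (\<lambda>t. (norm (b (s j) t - y t))\<^sup>2)) \<and>
    (\<lambda>j. LINT t:{0..T}|lebesgue. (norm (b (s j) t - y t))\<^sup>2) \<longlonglongrightarrow> 0"
proof -
  \<comment> \<open>Squared increments of size \<open>32^{-j}\<close> leave room for the weight
    \<open>16^j\<close> in \<open>u\<close>: the weighted integrals remain summable, while pointwise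
    increments decay like \<open>4^{-j}\<close>.\<close>
  have "\<exists>N. \<forall>k\<ge>N. \<forall>l\<ge>N. (LINT t:{0..T}|lebesgue. (norm (b k t - b l t))\<^sup>2) \<le> (1/32)^j" for j :: nat
    by (rule cauchy) simp
  then obtain s0 where s0: "\<And>j k l. k \<ge> s0 j \<Longrightarrow> l \<ge> s0 j \<Longrightarrow>
      (LINT t:{0..T}|lebesgue. (norm (b k t - b l t))\<^sup>2) \<le> (1/32)^j" by metis
  define s where "s j = (\<Sum>i\<le>j. Suc (s0 i))" for j
  have sm: "strict_mono s" unfolding strict_mono_Suc_iff s_def by simp
  have ss0: "s0 j \<le> s j" for j unfolding s_def
    using member_le_sum[of j "{..j}" "\<lambda>i. Suc (s0 i)"] by simp
  define d where "d j = b (s j)" for j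
  have dc: "continuous_on {0..T} (d j)" for j unfolding d_def by (rule cont)
  define u where "u j t = indicator {0..T} t *\<^sub>R (16^j * (norm (d (Suc j) t - d j t))\<^sup>2)" for j and t :: real
  have u0: "u j t \<ge> 0" for j t unfolding u_def by simp
  have u_int: "integrable lebesgue (u j)" for j
    unfolding u_def set_integrable_def[symmetric]
    by (intro absolutely_integrable_continuous_real continuous_intros dc)
  have uL: "integral\<^sup>L lebesgue (u j) \<le> (1/2)^j" for j
  proof -
    have "integral\<^sup>L lebesgue (u j) = 16^j * (LINT t:{0..T}|lebesgue. (norm (d (Suc j) t - d j t))\<^sup>2)"
      unfolding u_def set_lebesgue_integral_def[symmetric] by simp
    also have "\<dots> \<le> 16^j * (1/32)^j"
      unfolding d_def using strict_mono_leD[OF sm, of j "Suc j"] ss0[of j]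
      by (intro mult_left_mono s0) auto
    also have "\<dots> = (1/2::real)^j" by (simp add: power_mult_distrib[symmetric])
    finally show ?thesis .
  qed
  define g where "g t = (\<Sum>j. ennreal (u j t))" for t
  have um: "u j \<in> borel_measurable lebesgue" for j using u_int by (rule borel_measurable_integrable)
  have gm: "g \<in> borel_measurable lebesgue" unfolding g_def using um by measurable
  have gI: "integral\<^sup>N lebesgue g \<le> ennreal 2"
  proof -
    have "integral\<^sup>N lebesgue g = (\<Sum>j. integral\<^sup>N lebesgue (\<lambda>t. ennreal (u j t)))"
      unfolding g_def using um by (intro nn_integral_suminf) measurable
    also have "\<dots> = (\<Sum>j. ennreal (integral\<^sup>L lebesgue (u j)))"
      using u_int u0 by (intro suminf_cong nn_integral_eq_integral) auto
    also have "\<dots> \<le> (\<Sum>j. ennreal ((1/2)^j))"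
      by (intro suminf_le summableI ennreal_leI uL)
    also have "\<dots> = ennreal (\<Sum>j. (1/2)^j)" by (intro suminf_ennreal2 summable_geometric) auto
    also have "(\<Sum>j. (1/2::real)^j) = 2" by (simp add: suminf_geometric)
    finally show ?thesis .
  qed
  have gAE: "AE t in lebesgue. g t \<noteq> \<infinity>"
    by (rule nn_integral_noteq_infinite[OF gm]) (use gI ennreal_less_top[of 2] in \<open>auto simp: top_unique\<close>)
  define Z where "Z = {t. g t \<noteq> \<infinity>}"
  have Zm: "Z \<inter> space lebesgue \<in> sets lebesgue"
  proof -
    have "{t\<in>space lebesgue. g t \<noteq> \<infinity>} \<in> sets lebesgue" using gm by measurable
    then show ?thesis unfolding Z_def by simp
  qed
  define h where "h t = enn2real (g t)" for t
  have h0: "h t \<ge> 0" for t unfolding h_def by simp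
  have uh: "u j t \<le> h t" if "t \<in> Z" for j t
  proof -
    have "ennreal (u j t) \<le> g t"
      unfolding g_def using sum_le_suminf[OF summableI, of "{j}" "\<lambda>j. ennreal (u j t)"] by simp
    moreover have "g t < top" using that unfolding Z_def by (simp add: less_top)
    ultimately have "enn2real (ennreal (u j t)) \<le> enn2real (g t)" by (rule enn2real_mono)
    then show ?thesis using u0 by (simp add: h_def)
  qed
  have step: "norm (d (Suc j) t - d j t) \<le> sqrt (h t) / 4^j" if t: "t \<in> Z" "t \<in> {0..T}" for j t
  proof -
    have "16^j * (norm (d (Suc j) t - d j t))\<^sup>2 \<le> h t" using uh[OF t(1), of j] t(2) by (simp add: u_def)
    then have "(4^j * norm (d (Suc j) t - d j t))\<^sup>2 \<le> h t"
      by (simp add: power_mult_distrib power_mult[symmetric] mult.commute[of j] power_mult)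
    then have "4^j * norm (d (Suc j) t - d j t) \<le> sqrt (h t)" by (rule real_le_rsqrt)
    then show ?thesis by (simp add: field_simps)
  qed
  have far0: "norm (d (j + m) t - d j t) \<le> 2 * sqrt (h t) / 4^j - 2 * sqrt (h t) / 4^(j + m)"
    if t: "t \<in> Z" "t \<in> {0..T}" for j m t
  proof (induction m)
    case (Suc m)
    have "norm (d (j + Suc m) t - d j t) \<le> norm (d (Suc (j + m)) t - d (j + m) t) + norm (d (j + m) t - d j t)"
      using norm_triangle_ineq[of "d (Suc (j + m)) t - d (j + m) t" "d (j + m) t - d j t"] by simp
    also have "\<dots> \<le> sqrt (h t) / 4^(j + m) + (2 * sqrt (h t) / 4^j - 2 * sqrt (h t) / 4^(j + m))"
      by (intro add_mono step t Suc)
    also have "\<dots> \<le> 2 * sqrt (h t) / 4^j - 2 * sqrt (h t) / 4^(j + Suc m)"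
      using h0[of t] by (simp add: field_simps)
    finally show ?case .
  qed simp
  have far: "norm (d l t - d j t) \<le> 2 * sqrt (h t) / 4^j" if t: "t \<in> Z" "t \<in> {0..T}" and "j \<le> l" for j l t
  proof -
    have "norm (d l t - d j t) \<le> 2 * sqrt (h t) / 4^j - 2 * sqrt (h t) / 4^l"
      using far0[OF t, of j "l - j"] that(3) by simp
    moreover have "0 \<le> 2 * sqrt (h t) / 4^l" using h0 by simp
    ultimately show ?thesis by linarith
  qed
  have geo: "(\<lambda>j. C / 4^j) \<longlonglongrightarrow> 0" for C :: real
    by (rule LIMSEQ_divide_realpow_zero) simp
  define y where "y t = (if t \<in> Z then (if t \<in> {0..T} then lim (\<lambda>j. d j t) else 0) else 0)" for t
  have dy: "(\<lambda>j. d j t) \<longlonglongrightarrow> y t" if t: "t \<in> Z" "t \<in> {0..T}" for t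
  proof -
    have "Cauchy (\<lambda>j. d j t)"
    proof (rule CauchyI)
      fix \<epsilon> :: real assume "\<epsilon> > 0"
      then obtain j where j: "4 * sqrt (h t) / 4^j < \<epsilon>"
        using order_tendstoD(2)[OF geo[of "4 * sqrt (h t)"]] eventually_happens'[OF sequentially_bot] by blast
      show "\<exists>M. \<forall>m\<ge>M. \<forall>n\<ge>M. norm (d m t - d n t) < \<epsilon>"
      proof (intro exI allI impI)
        fix m n assume mn: "m \<ge> j" "n \<ge> j"
        have "norm (d m t - d n t) \<le> norm (d m t - d j t) + norm (d n t - d j t)"
          using norm_triangle_ineq4[of "d m t - d j t" "d n t - d j t"] by simp
        also have "\<dots> \<le> 2 * sqrt (h t) / 4^j + 2 * sqrt (h t) / 4^j" by (intro add_mono far t mn)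
        finally show "norm (d m t - d n t) < \<epsilon>" using j by simp
      qed
    qed
    then have "(\<lambda>j. d j t) \<longlonglongrightarrow> lim (\<lambda>j. d j t)"
      using Cauchy_convergent convergent_LIMSEQ_iff by blast
    then show ?thesis unfolding y_def using t by simp
  qed
  \<comment> \<open>Set to zero outside \<open>Z\<close>, so that convergence holds at every point
    and measurability passes to the limit.\<close>
  define d' where "d' j t = (if t \<in> Z then indicator {0..T} t *\<^sub>R d j t else 0)" for j and t :: real
  have d'm: "d' j \<in> borel_measurable lebesgue" for j
    unfolding d'_def by (intro measurable_If_set indicator_continuous_measurable dc Zm) simp
  have d'y: "(\<lambda>j. d' j t) \<longlonglongrightarrow> y t" for t
    unfolding d'_def using dy[of t] by (auto simp: y_def indicator_def)
  have ym: "y \<in> borel_measurable lebesgue"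
    by (rule borel_measurable_LIMSEQ_metric[OF d'm d'y])
  have yi: "(\<lambda>t. indicator {0..T} t *\<^sub>R y t) = y" by (auto simp: y_def indicator_def)
  define r where "r j t = indicator {0..T} t *\<^sub>R (norm (d j t - y t))\<^sup>2" for j and t :: real
  have r0: "r j t \<ge> 0" for j t unfolding r_def by simp
  \<comment> \<open>The target space need not be separable, so measurability of
    \<open>norm (d j t - y t)\<close> is obtained as a limit of norms of differences of continuous
    functions, not from the measurability of \<open>y\<close>.\<close>
  have rm: "r j \<in> borel_measurable lebesgue" for j
  proof (rule borel_measurable_LIMSEQ_real)
    fix l
    define F where "F l t = (if t \<in> Z then indicator {0..T} t *\<^sub>R (norm (d j t - d l t))\<^sup>2
         else indicator {0..T} t *\<^sub>R (norm (d j t))\<^sup>2)" for l and t :: real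
    show "F l \<in> borel_measurable lebesgue" for l
      unfolding F_def by (intro measurable_If_set indicator_continuous_measurable continuous_intros dc Zm)
    have F: "F l t = indicator {0..T} t *\<^sub>R (norm (d j t - d' l t))\<^sup>2" for l t
      unfolding F_def d'_def by (auto simp: indicator_def)
    show "(\<lambda>l. F l t) \<longlonglongrightarrow> r j t" for t
      unfolding F r_def by (intro tendsto_intros d'y)
  qed
  have r_le: "r j t \<le> (4 / 16^j) * h t" if t: "t \<in> Z" for j t
  proof (cases "t \<in> {0..T}")
    case True
    have lim: "(\<lambda>l. norm (d l t - d j t)) \<longlonglongrightarrow> norm (y t - d j t)" by (intro tendsto_intros dy t True)
    have "norm (y t - d j t) \<le> 2 * sqrt (h t) / 4^j"
      by (rule LIMSEQ_le_const2[OF lim]) (use far[OF t True] in blast)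
    then have "(norm (y t - d j t))\<^sup>2 \<le> (2 * sqrt (h t) / 4^j)\<^sup>2" by (rule power_mono) simp
    also have "\<dots> = 4 / 16^j * h t" using h0[of t]
      by (simp add: power_mult_distrib power_divide power_mult[symmetric] mult.commute[of j])
        (simp add: power_mult)
    finally show ?thesis using True by (simp add: r_def norm_minus_commute)
  qed (use h0 in \<open>simp add: r_def\<close>)
  have rI: "integral\<^sup>N lebesgue (\<lambda>t. ennreal (r j t)) \<le> ennreal (8 / 16^j)" for j
  proof -
    have "AE t in lebesgue. ennreal (r j t) \<le> ennreal (4 / 16^j) * g t"
      using gAE
    proof eventually_elim
      case (elim t)
      then have "t \<in> Z" unfolding Z_def by simp
      moreover have "g t = ennreal (h t)" using elim by (simp add: h_def less_top)
      ultimately show ?case using r_le[of t j] by (simp add: ennreal_mult'[symmetric] ennreal_leI)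
    qed
    then have "integral\<^sup>N lebesgue (\<lambda>t. ennreal (r j t)) \<le> integral\<^sup>N lebesgue (\<lambda>t. ennreal (4 / 16^j) * g t)"
      by (rule nn_integral_mono_AE)
    also have "\<dots> = ennreal (4 / 16^j) * integral\<^sup>N lebesgue g" by (rule nn_integral_cmult[OF gm])
    also have "\<dots> \<le> ennreal (4 / 16^j) * ennreal 2" by (intro mult_left_mono gI) simp
    also have "\<dots> = ennreal (8 / 16^j)" by (subst ennreal_mult'[symmetric]) simp_all
    finally show ?thesis .
  qed
  have rint: "integrable lebesgue (r j)" for j
  proof (rule integrableI_bounded[OF rm])
    have "integral\<^sup>N lebesgue (\<lambda>t. ennreal (norm (r j t))) = integral\<^sup>N lebesgue (\<lambda>t. ennreal (r j t))"
      using r0 by simp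
    then show "integral\<^sup>N lebesgue (\<lambda>t. ennreal (norm (r j t))) < \<infinity>"
      using rI[of j] ennreal_less_top[of "8 / 16^j"] by (simp add: order_le_less_trans)
  qed
  have rL: "integral\<^sup>L lebesgue (r j) \<le> 8 / 16^j" for j
    by (rule integral_real_bounded[OF _ rI]) simp
  have rlim: "(\<lambda>j. integral\<^sup>L lebesgue (r j)) \<longlonglongrightarrow> 0"
  proof (rule tendsto_sandwich[OF always_eventually always_eventually tendsto_const])
    show "\<forall>j. 0 \<le> integral\<^sup>L lebesgue (r j)" using r0 by (simp add: integral_nonneg_AE)
    show "\<forall>j. integral\<^sup>L lebesgue (r j) \<le> 8 / 16^j" using rL by blast
    show "(\<lambda>j. 8 / 16^j :: real) \<longlonglongrightarrow> 0"
      by (rule LIMSEQ_divide_realpow_zero) simp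
  qed
  have "set_integrable lebesgue {0..T} (\<lambda>t. (norm (y t))\<^sup>2)"
    unfolding set_integrable_def
  proof (rule Bochner_Integration.integrable_bound)
    show "integrable lebesgue (\<lambda>t. 2 * r 0 t + 2 * (indicator {0..T} t *\<^sub>R (norm (d 0 t))\<^sup>2))"
      by (intro Bochner_Integration.integrable_add Bochner_Integration.integrable_mult_right rint
          absolutely_integrable_continuous_real[unfolded set_integrable_def] continuous_intros dc)
    have "(\<lambda>t. (norm (y t))\<^sup>2) \<in> borel_measurable lebesgue"
      using measurable_compose[OF ym borel_measurable_norm] by measurable
    moreover have "(\<lambda>t. indicator {0..T} t *\<^sub>R (norm (y t))\<^sup>2) = (\<lambda>t. (norm (y t))\<^sup>2)"
      by (auto simp: y_def indicator_def)
    ultimately show "(\<lambda>t. indicator {0..T} t *\<^sub>R (norm (y t))\<^sup>2) \<in> borel_measurable lebesgue"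
      by simp
    have "(norm (y t))\<^sup>2 \<le> 2 * (norm (d 0 t - y t))\<^sup>2 + 2 * (norm (d 0 t))\<^sup>2" for t
      using dist_sq_le[of "y t" 0 "d 0 t"] by (simp add: norm_minus_commute)
    then show "AE t in lebesgue. norm (indicator {0..T} t *\<^sub>R (norm (y t))\<^sup>2)
        \<le> norm (2 * r 0 t + 2 * (indicator {0..T} t *\<^sub>R (norm (d 0 t))\<^sup>2))"
      by (intro AE_I2) (simp add: r_def indicator_def)
  qed
  then have "L2_on T y" unfolding L2_on_def set_borel_measurable_def using ym yi by simp
  then show ?thesis using sm rint rlim unfolding r_def d_def set_integrable_def set_lebesgue_integral_def
    by blast
qed

text \<open>The hypotheses are the Young form of the triangle inequality in \<open>L\<^sup>2\<close>.\<close>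

lemma young_limit:
  fixes P :: real and Q \<rho> :: "nat \<Rightarrow> real"
  assumes "P \<ge> 0" "\<And>k. Q k \<ge> 0" "\<And>k. \<rho> k \<ge> 0" "\<rho> \<longlonglongrightarrow> 0"
    and 1: "\<And>k \<delta>. \<delta> > 0 \<Longrightarrow> P \<le> (1 + \<delta>) * Q k + (1 + 1/\<delta>) * \<rho> k"
    and 2: "\<And>k \<delta>. \<delta> > 0 \<Longrightarrow> Q k \<le> (1 + \<delta>) * P + (1 + 1/\<delta>) * \<rho> k"
  shows "Q \<longlonglongrightarrow> P"
proof (rule LIMSEQ_I)
  fix \<epsilon> :: real assume "\<epsilon> > 0"
  \<comment> \<open>Once \<open>\<rho> k < 1\<close>, hypothesis \<open>2\<close> with
    \<open>\<delta> = 1\<close> gives \<open>Q k \<le> 2 * P + 2\<close>; the choice makes both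
    \<open>\<delta> * Q k\<close> and \<open>\<delta> * P\<close> at most
    \<open>\<epsilon> / 2\<close>.\<close>
  define \<delta> where "\<delta> = \<epsilon> / (2 * (2 * P + 2 + 1))"
  have \<delta>: "\<delta> > 0" using \<open>\<epsilon> > 0\<close> assms(1) by (simp add: \<delta>_def)
  have "(\<lambda>k. (1 + 1/\<delta>) * \<rho> k) \<longlonglongrightarrow> (1 + 1/\<delta>) * 0" by (intro tendsto_intros assms)
  then have "\<forall>\<^sub>F k in sequentially. (1 + 1/\<delta>) * \<rho> k < \<epsilon> / 2 \<and> \<rho> k < 1"
    using \<open>\<epsilon> > 0\<close> by (intro eventually_conj) (rule order_tendstoD(2)[OF _ half_gt_zero] order_tendstoD(2)[OF assms(4)]; simp)+
  then obtain k0 where k0: "\<And>k. k \<ge> k0 \<Longrightarrow> (1 + 1/\<delta>) * \<rho> k < \<epsilon> / 2 \<and> \<rho> k < 1"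
    unfolding eventually_sequentially by blast
  show "\<exists>no. \<forall>k\<ge>no. norm (Q k - P) < \<epsilon>"
  proof (intro exI allI impI)
    fix k assume "k \<ge> k0"
    from k0[OF this] have r: "(1 + 1/\<delta>) * \<rho> k < \<epsilon> / 2" "\<rho> k < 1" by auto
    have "Q k \<le> 2 * P + 2" using 2[of 1 k] r(2) by simp
    then have "\<delta> * Q k \<le> \<delta> * (2 * P + 2)" using \<delta> by simp
    also have lb: "\<dots> \<le> \<epsilon> / 2"
    proof -
      have "\<delta> * (2 * P + 2 + 1) = \<epsilon> / 2" unfolding \<delta>_def using assms(1) by (simp add: field_simps)
      moreover have "\<delta> * (2 * P + 2) \<le> \<delta> * (2 * P + 2 + 1)" using \<delta> by simp
      ultimately show ?thesis by simp
    qed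
    finally have "\<delta> * Q k \<le> \<epsilon> / 2" .
    moreover have "\<delta> * P \<le> \<epsilon> / 2"
    proof -
      have "\<delta> * P \<le> \<delta> * (2 * P + 2)" using \<delta> assms(1) by (intro mult_left_mono) auto
      then show ?thesis using lb by linarith
    qed
    ultimately have "P - Q k < \<epsilon>" "Q k - P < \<epsilon>"
      using 1[OF \<delta>, of k] 2[OF \<delta>, of k] r unfolding distrib_right[of 1 \<delta>] by linarith+
    then show "norm (Q k - P) < \<epsilon>" by simp
  qed
qed

lemma young_sq:
  fixes p q r \<delta> :: real
  assumes "\<delta> > 0" "0 \<le> p" "p \<le> q + r" "0 \<le> q" "0 \<le> r"
  shows "p\<^sup>2 \<le> (1 + \<delta>) * q\<^sup>2 + (1 + 1/\<delta>) * r\<^sup>2"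
proof -
  have "p\<^sup>2 \<le> (q + r)\<^sup>2" using assms by (intro power_mono) auto
  moreover have "(1 + \<delta>) * q\<^sup>2 + (1 + 1/\<delta>) * r\<^sup>2 - (q + r)\<^sup>2 = (\<delta> * q - r)\<^sup>2 / \<delta>"
    using assms(1) by (simp add: field_simps power2_eq_square)
  moreover have "(\<delta> * q - r)\<^sup>2 / \<delta> \<ge> 0" using assms(1) by simp
  ultimately show ?thesis by linarith
qed

section \<open>Linearity of solutions with square integrable sources\<close>

context wave
begin

text \<open>Separability through \<open>D\<close>: the preimage of an open set under the difference
  is a countable union, over centres in \<open>D\<close> and radii \<open>1 / (n + 1)\<close>, of
  intersections of preimages of balls whose differences stay in the set.\<close>

lemma borel_measurable_diff_sep:
  fixes f g :: "'a \<Rightarrow> 'h"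
  assumes f: "f \<in> borel_measurable M" and g: "g \<in> borel_measurable M"
  shows "(\<lambda>x. f x - g x) \<in> borel_measurable M"
proof (rule borel_measurableI)
  fix S :: "'h set" assume S: "open S"
  define r where "r n = 1 / real (Suc n)" for n
  define I where "I = {(d, d', n). d \<in> D \<and> d' \<in> D \<and> (\<forall>y\<in>ball d (r n). \<forall>z\<in>ball d' (r n). y - z \<in> S)}"
  have "I \<subseteq> D \<times> D \<times> UNIV" unfolding I_def by auto
  then have cI: "countable I" using D(1) by (meson countable_SIGMA countable_subset countableI_type)
  have "(\<lambda>x. f x - g x) -` S \<inter> space M
    = (\<Union>i\<in>I. (f -` ball (fst i) (r (snd (snd i))) \<inter> space M) \<inter> (g -` ball (fst (snd i)) (r (snd (snd i))) \<inter> space M))"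
    (is "?L = ?R")
  proof
    show "?R \<subseteq> ?L" unfolding I_def by auto
    show "?L \<subseteq> ?R"
    proof
      fix x assume x: "x \<in> ?L"
      then obtain \<epsilon> where \<epsilon>: "\<epsilon> > 0" "ball (f x - g x) \<epsilon> \<subseteq> S" using S by (auto simp: open_contains_ball)
      obtain n where n: "r n < \<epsilon> / 4"
        unfolding r_def using reals_Archimedean[of "\<epsilon> / 4"] \<epsilon>(1) by (auto simp: inverse_eq_divide)
      have rp: "r n > 0" unfolding r_def by simp
      obtain d where d: "d \<in> D" "dist d (f x) < r n" using D(2) rp closure_approachable by (metis UNIV_I)
      obtain d' where d': "d' \<in> D" "dist d' (g x) < r n" using D(2) rp closure_approachable by (metis UNIV_I)
      have "y - z \<in> S" if "y \<in> ball d (r n)" "z \<in> ball d' (r n)" for y z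
      proof -
        have "dist y (f x) < 2 * r n" "dist z (g x) < 2 * r n"
          using that d(2) d'(2) dist_triangle[of y "f x" d] dist_triangle[of z "g x" d']
          by (auto simp: dist_commute)
        then have "dist (y - z) (f x - g x) < \<epsilon>"
          using n norm_triangle_ineq4[of "y - f x" "z - g x"] by (simp add: dist_norm algebra_simps)
        then show ?thesis using \<epsilon>(2) by (auto simp: dist_commute)
      qed
      then have "(d, d', n) \<in> I" unfolding I_def using d d' by blast
      moreover have "x \<in> space M" using x by blast
      ultimately show "x \<in> ?R" using d(2) d'(2) by (intro UN_I[of "(d, d', n)"]) auto
    qed
  qed
  moreover have "?R \<in> sets M"
    by (rule sets.countable_UN'[OF cI]) (use f g in \<open>auto intro!: sets.Int measurable_sets\<close>)
  ultimately show "(\<lambda>x. f x - g x) -` S \<inter> space M \<in> sets M" by simp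
qed

lemma L2_on_diff:
  fixes f g :: "real \<Rightarrow> 'h"
  assumes f: "L2_on T f" and g: "L2_on T g"
  shows "L2_on T (\<lambda>t. f t - g t)"
proof -
  have m: "(\<lambda>t. indicator {0..T} t *\<^sub>R (f t - g t)) \<in> borel_measurable lebesgue"
    using borel_measurable_diff_sep[of "\<lambda>t. indicator {0..T} t *\<^sub>R f t" lebesgue "\<lambda>t. indicator {0..T} t *\<^sub>R g t"]
      f g unfolding L2_on_def set_borel_measurable_def by (simp add: scaleR_diff_right)
  have "integrable lebesgue (\<lambda>t. indicator {0..T} t *\<^sub>R (norm (f t - g t))\<^sup>2)"
  proof (rule Bochner_Integration.integrable_bound)
    show "integrable lebesgue (\<lambda>t. 2 * (indicator {0..T} t *\<^sub>R (norm (f t))\<^sup>2) + 2 * (indicator {0..T} t *\<^sub>R (norm (g t))\<^sup>2))"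
      using f g unfolding L2_on_def set_integrable_def by (intro Bochner_Integration.integrable_add Bochner_Integration.integrable_mult_right) auto
    have "(\<lambda>t. (norm (indicator {0..T} t *\<^sub>R (f t - g t)))\<^sup>2) \<in> borel_measurable lebesgue"
      using measurable_compose[OF m borel_measurable_norm] by measurable
    moreover have "(norm (indicator {0..T} t *\<^sub>R (f t - g t)))\<^sup>2 = indicator {0..T} t *\<^sub>R (norm (f t - g t))\<^sup>2" for t :: real
      by (simp add: indicator_def)
    ultimately show "(\<lambda>t. indicator {0..T} t *\<^sub>R (norm (f t - g t))\<^sup>2) \<in> borel_measurable lebesgue" by simp
    show "AE t in lebesgue. norm (indicator {0..T} t *\<^sub>R (norm (f t - g t))\<^sup>2)
      \<le> norm (2 * (indicator {0..T} t *\<^sub>R (norm (f t))\<^sup>2) + 2 * (indicator {0..T} t *\<^sub>R (norm (g t))\<^sup>2))"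
      using dist_sq_le[of "f _" "g _" 0] by (intro AE_I2) (simp add: indicator_def norm_minus_commute)
  qed
  then show ?thesis using m unfolding L2_on_def set_borel_measurable_def set_integrable_def by blast
qed

lemma L2_on_inner_integrable:
  fixes f :: "real \<Rightarrow> 'h"
  assumes f: "L2_on T f" and t: "t \<in> {0..T}"
  shows "set_integrable lebesgue {0..t} (\<lambda>s. f s \<bullet> \<phi>)"
proof -
  have m: "(\<lambda>t. indicator {0..T} t *\<^sub>R f t) \<in> borel_measurable lebesgue"
    using f unfolding L2_on_def set_borel_measurable_def by blast
  have "set_integrable lebesgue {0..T} (\<lambda>s. f s \<bullet> \<phi>)"
    unfolding set_integrable_def
  proof (rule Bochner_Integration.integrable_bound)
    show "integrable lebesgue (\<lambda>t. indicator {0..T} t *\<^sub>R (norm (f t))\<^sup>2 + indicator {0..T} t *\<^sub>R (norm \<phi>)\<^sup>2)"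
    proof (rule Bochner_Integration.integrable_add)
      show "integrable lebesgue (\<lambda>t. indicator {0..T} t *\<^sub>R (norm (f t))\<^sup>2)"
        using f unfolding L2_on_def set_integrable_def by blast
      show "integrable lebesgue (\<lambda>t. indicator {0..T} t *\<^sub>R (norm \<phi>)\<^sup>2)"
        by (intro absolutely_integrable_continuous_real[unfolded set_integrable_def] continuous_intros)
    qed
    have "(\<lambda>x. x \<bullet> \<phi>) \<in> borel_measurable borel"
      by (intro borel_measurable_continuous_onI continuous_intros)
    from measurable_compose[OF m this]
    show "(\<lambda>t. indicator {0..T} t *\<^sub>R (f t \<bullet> \<phi>)) \<in> borel_measurable lebesgue" by simp
    have "\<bar>f t \<bullet> \<phi>\<bar> \<le> (norm (f t))\<^sup>2 + (norm \<phi>)\<^sup>2" for t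
      using Cauchy_Schwarz_ineq2[of "f t" \<phi>] sum_squares_bound[of "norm (f t)" "norm \<phi>"]
        mult_nonneg_nonneg[OF norm_ge_zero[of "f t"] norm_ge_zero[of \<phi>]] by linarith
    then show "AE t in lebesgue. norm (indicator {0..T} t *\<^sub>R (f t \<bullet> \<phi>))
        \<le> norm (indicator {0..T} t *\<^sub>R (norm (f t))\<^sup>2 + indicator {0..T} t *\<^sub>R (norm \<phi>)\<^sup>2)"
      by (intro AE_I2) (simp add: indicator_def)
  qed
  then show ?thesis by (rule set_integrable_subset) (use t in auto)
qed

lemma Hsp1_diff: "w \<in> Hsp A 1 \<Longrightarrow> w' \<in> Hsp A 1 \<Longrightarrow> w - w' \<in> Hsp A 1 \<and>
    op_app (half_pow A 1) (w - w') = op_app (half_pow A 1) w - op_app (half_pow A 1) w'"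
  unfolding Hsp_eq using op_app_half_pow1 by (auto simp: R.diff[symmetric])

lemma Hsp2_diff: "w \<in> Hsp A 2 \<Longrightarrow> w' \<in> Hsp A 2 \<Longrightarrow> w - w' \<in> Hsp A 2 \<and>
    op_app (half_pow A 2) (w - w') = op_app (half_pow A 2) w - op_app (half_pow A 2) w'"
  unfolding Hsp_eq using op_app_half_pow2 by (auto simp: R.diff[symmetric] eval_nat_numeral)

text \<open>The approximating regular solutions in \<open>is_observation\<close> may have sources
  that are merely square integrable, so differences have to be formed in this generality and not
  only for \<open>cw\<close>.\<close>

lemma wave_sol_diff:
  assumes 1: "wave_sol A T f w v" and 2: "wave_sol A T g w' v'"
  shows "wave_sol A T (\<lambda>t. f t - g t) (\<lambda>t. w t - w' t) (\<lambda>t. v t - v' t)"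
  unfolding wave_sol_def
proof (intro conjI ballI)
  have H: "w t \<in> Hsp A 1" "w' t \<in> Hsp A 1" if "t \<in> {0..T}" for t
    using 1 2 that unfolding wave_sol_def by blast+
  let ?a = "\<lambda>u. op_app (half_pow A 1) u"
  have c: "continuous_on {0..T} (\<lambda>t. ?a (w t))" "continuous_on {0..T} (\<lambda>t. ?a (w' t))"
    "continuous_on {0..T} v" "continuous_on {0..T} v'" using 1 2 unfolding wave_sol_def by blast+
  have L: "L2_on T f" "L2_on T g" using 1 2 unfolding wave_sol_def by blast+
  show "L2_on T (\<lambda>t. f t - g t)" by (rule L2_on_diff[OF L])
  show "w t - w' t \<in> Hsp A 1" if "t \<in> {0..T}" for t using Hsp1_diff[OF H[OF that]] by blast
  have "continuous_on {0..T} (\<lambda>t. ?a (w t) - ?a (w' t))" by (intro continuous_intros c)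
  then show "continuous_on {0..T} (\<lambda>t. ?a (w t - w' t))"
    by (rule continuous_on_eq) (use Hsp1_diff[OF H] in simp)
  show "continuous_on {0..T} (\<lambda>t. v t - v' t)" by (intro continuous_intros c)
  show "((\<lambda>t. w t - w' t) has_vector_derivative v t - v' t) (at t within {0..T})" if "t \<in> {0..T}" for t
    using 1 2 that unfolding wave_sol_def by (intro has_vector_derivative_diff) blast+
  fix \<phi> t assume p: "\<phi> \<in> Hsp A 1" and t: "t \<in> {0..T}"
  have e1: "v t \<bullet> \<phi> - v 0 \<bullet> \<phi> + (LINT s:{0..t}|lebesgue. ?a (w s) \<bullet> ?a \<phi>) = (LINT s:{0..t}|lebesgue. f s \<bullet> \<phi>)"
    and e2: "v' t \<bullet> \<phi> - v' 0 \<bullet> \<phi> + (LINT s:{0..t}|lebesgue. ?a (w' s) \<bullet> ?a \<phi>) = (LINT s:{0..t}|lebesgue. g s \<bullet> \<phi>)"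
    using 1 2 p t unfolding wave_sol_def by blast+
  have sub: "{0..t} \<subseteq> {0..T}" using t by auto
  have "(LINT s:{0..t}|lebesgue. ?a (w s - w' s) \<bullet> ?a \<phi>)
      = (LINT s:{0..t}|lebesgue. ?a (w s) \<bullet> ?a \<phi> - ?a (w' s) \<bullet> ?a \<phi>)"
    using sub Hsp1_diff[OF H] by (intro set_lebesgue_integral_cong) (auto simp: inner_diff_left)
  also have "\<dots> = (LINT s:{0..t}|lebesgue. ?a (w s) \<bullet> ?a \<phi>) - (LINT s:{0..t}|lebesgue. ?a (w' s) \<bullet> ?a \<phi>)"
    by (intro set_integral_diff absolutely_integrable_continuous_real continuous_intros
        continuous_on_subset[OF c(1) sub] continuous_on_subset[OF c(2) sub])
  moreover have "(LINT s:{0..t}|lebesgue. (f s - g s) \<bullet> \<phi>)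
      = (LINT s:{0..t}|lebesgue. f s \<bullet> \<phi>) - (LINT s:{0..t}|lebesgue. g s \<bullet> \<phi>)"
    unfolding inner_diff_left by (intro set_integral_diff L2_on_inner_integrable[OF _ t] L)
  ultimately show "(v t - v' t) \<bullet> \<phi> - (v 0 - v' 0) \<bullet> \<phi> + (LINT s:{0..t}|lebesgue. ?a (w s - w' s) \<bullet> ?a \<phi>)
      = (LINT s:{0..t}|lebesgue. (f s - g s) \<bullet> \<phi>)"
    using e1 e2 by (simp add: inner_diff_left)
qed

lemma regular_sol_diff:
  assumes 1: "regular_sol A T f w v" and 2: "regular_sol A T g w' v'"
  shows "regular_sol A T (\<lambda>t. f t - g t) (\<lambda>t. w t - w' t) (\<lambda>t. v t - v' t)"
  unfolding regular_sol_def
proof (intro conjI ballI)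
  have H: "w t \<in> Hsp A 2" "w' t \<in> Hsp A 2" if "t \<in> {0..T}" for t
    using 1 2 that unfolding regular_sol_def by blast+
  show "wave_sol A T (\<lambda>t. f t - g t) (\<lambda>t. w t - w' t) (\<lambda>t. v t - v' t)"
    using 1 2 unfolding regular_sol_def by (intro wave_sol_diff) blast+
  show "w t - w' t \<in> Hsp A 2" if "t \<in> {0..T}" for t using Hsp2_diff[OF H[OF that]] by blast
  have "continuous_on {0..T} (\<lambda>t. op_app (half_pow A 2) (w t) - op_app (half_pow A 2) (w' t))"
    using 1 2 unfolding regular_sol_def by (intro continuous_intros) blast+
  then show "continuous_on {0..T} (\<lambda>t. op_app (half_pow A 2) (w t - w' t))"
    by (rule continuous_on_eq) (use Hsp2_diff[OF H] in simp)
qed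

lemma wave_sol_energy:
  assumes "wave_sol A T f w v"
  obtains x where "continuous_on {0..T} x" "continuous_on {0..T} v"
    "\<And>t. t \<in> {0..T} \<Longrightarrow> w t = R (x t)"
    "\<And>t. t \<in> {0..T} \<Longrightarrow> energy A 1 (w t) (v t) = 1/2 * (norm (x t, v t))\<^sup>2"
proof
  let ?x = "\<lambda>t. op_app (half_pow A 1) (w t)"
  show "continuous_on {0..T} ?x" "continuous_on {0..T} v" using assms unfolding wave_sol_def by blast+
  show w: "w t = R (?x t)" if "t \<in> {0..T}" for t
  proof -
    have "w t \<in> Hsp A 1" using assms that unfolding wave_sol_def by blast
    then obtain y where "w t = R y" unfolding Hsp_eq by auto
    then show ?thesis using op_app_half_pow1 by simp
  qed
  show "energy A 1 (w t) (v t) = 1/2 * (norm (?x t, v t))\<^sup>2" if "t \<in> {0..T}" for t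
    using energy1[of "?x t" "v t"] w[OF that] by simp
qed

lemma adm_bound_eq:
  assumes "0 \<le> T" "\<And>t. t \<in> {0..T} \<Longrightarrow> energy A 1 (w t) (v t) = e t" "continuous_on {0..T} e"
  shows "adm_bound A T f w v = e 0 + e T + integral {0..T} e + (LINT t:{0..T}|lebesgue. (norm (f t))\<^sup>2)"
proof -
  have "(LINT t:{0..T}|lebesgue. energy A 1 (w t) (v t)) = (LINT t:{0..T}|lebesgue. e t)"
    using assms(2) by (intro set_lebesgue_integral_cong) auto
  then show ?thesis unfolding adm_bound_def using assms LINT_continuous[OF assms(3)] by simp
qed

text \<open>Every term of \<open>adm_bound\<close> is built from squared norms, whence the factors 2
  in place of a triangle inequality.\<close>

lemma adm_bound_diff:
  assumes T: "0 \<le> T" and 1: "wave_sol A T f w v" and 2: "wave_sol A T g w' v'"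
  shows "adm_bound A T (\<lambda>t. f t - g t) (\<lambda>t. w t - w' t) (\<lambda>t. v t - v' t)
    \<le> 2 * adm_bound A T f w v + 2 * adm_bound A T g w' v'"
proof -
  obtain x where x: "continuous_on {0..T} x" "continuous_on {0..T} v"
    "\<And>t. t \<in> {0..T} \<Longrightarrow> w t = R (x t)"
    "\<And>t. t \<in> {0..T} \<Longrightarrow> energy A 1 (w t) (v t) = 1/2 * (norm (x t, v t))\<^sup>2"
    using wave_sol_energy[OF 1] by metis
  obtain y where y: "continuous_on {0..T} y" "continuous_on {0..T} v'"
    "\<And>t. t \<in> {0..T} \<Longrightarrow> w' t = R (y t)"
    "\<And>t. t \<in> {0..T} \<Longrightarrow> energy A 1 (w' t) (v' t) = 1/2 * (norm (y t, v' t))\<^sup>2"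
    using wave_sol_energy[OF 2] by metis
  have L: "L2_on T f" "L2_on T g" using 1 2 unfolding wave_sol_def by blast+
  define p q r where "p t = 1/2 * (norm (x t, v t))\<^sup>2" and "q t = 1/2 * (norm (y t, v' t))\<^sup>2"
    and "r t = 1/2 * (norm (x t - y t, v t - v' t))\<^sup>2" for t
  have cont: "continuous_on {0..T} p" "continuous_on {0..T} q" "continuous_on {0..T} r"
    unfolding p_def q_def r_def by (intro continuous_intros x y)+
  have le: "r t \<le> 2 * p t + 2 * q t" for t
    unfolding p_def q_def r_def using norm_diff_sq_le[of "(x t, v t)" "(y t, v' t)"] by simp
  have er: "energy A 1 (w t - w' t) (v t - v' t) = r t" if "t \<in> {0..T}" for t
    using energy1[of "x t - y t" "v t - v' t"] x(3)[OF that] y(3)[OF that] by (simp add: r_def R.diff)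
  have ir: "integral {0..T} r \<le> 2 * integral {0..T} p + 2 * integral {0..T} q"
  proof -
    have "integral {0..T} r \<le> integral {0..T} (\<lambda>t. 2 * p t + 2 * q t)"
      by (intro integral_le integrable_continuous_real continuous_intros cont le)
    also have "\<dots> = 2 * integral {0..T} p + 2 * integral {0..T} q"
      by (subst Henstock_Kurzweil_Integration.integral_add)
        (auto intro!: integrable_continuous_real continuous_intros cont)
    finally show ?thesis .
  qed
  have fi: "(LINT t:{0..T}|lebesgue. (norm (f t - g t))\<^sup>2)
    \<le> 2 * (LINT t:{0..T}|lebesgue. (norm (f t))\<^sup>2) + 2 * (LINT t:{0..T}|lebesgue. (norm (g t))\<^sup>2)"
  proof -
    have i: "set_integrable lebesgue {0..T} (\<lambda>t. 2 * (norm (f t))\<^sup>2)" "set_integrable lebesgue {0..T} (\<lambda>t. 2 * (norm (g t))\<^sup>2)"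
      using L unfolding L2_on_def by auto
    have "(LINT t:{0..T}|lebesgue. (norm (f t - g t))\<^sup>2)
       \<le> (LINT t:{0..T}|lebesgue. 2 * (norm (f t))\<^sup>2 + 2 * (norm (g t))\<^sup>2)"
    proof (rule set_integral_mono)
      show "set_integrable lebesgue {0..T} (\<lambda>t. (norm (f t - g t))\<^sup>2)"
        using L2_on_diff[OF L] unfolding L2_on_def by blast
      show "(norm (f t - g t))\<^sup>2 \<le> 2 * (norm (f t))\<^sup>2 + 2 * (norm (g t))\<^sup>2" for t
        using dist_sq_le[of "f t" "g t" 0] by simp
    qed (rule set_integral_add[OF i])
    also have "\<dots> = 2 * (LINT t:{0..T}|lebesgue. (norm (f t))\<^sup>2) + 2 * (LINT t:{0..T}|lebesgue. (norm (g t))\<^sup>2)"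
      using set_integral_add(2)[OF i] by simp
    finally show ?thesis .
  qed
  have ep: "energy A 1 (w t) (v t) = p t" if "t \<in> {0..T}" for t
    using x(4)[OF that] by (simp add: p_def)
  have eq: "energy A 1 (w' t) (v' t) = q t" if "t \<in> {0..T}" for t
    using y(4)[OF that] by (simp add: q_def)
  have 1: "adm_bound A T f w v = p 0 + p T + integral {0..T} p + (LINT t:{0..T}|lebesgue. (norm (f t))\<^sup>2)"
    by (rule adm_bound_eq[OF T ep cont(1)])
  have 2: "adm_bound A T g w' v' = q 0 + q T + integral {0..T} q + (LINT t:{0..T}|lebesgue. (norm (g t))\<^sup>2)"
    by (rule adm_bound_eq[OF T eq cont(2)])
  have 3: "adm_bound A T (\<lambda>t. f t - g t) (\<lambda>t. w t - w' t) (\<lambda>t. v t - v' t)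
     = r 0 + r T + integral {0..T} r + (LINT t:{0..T}|lebesgue. (norm (f t - g t))\<^sup>2)"
    by (rule adm_bound_eq[OF T er cont(3)])
  show ?thesis unfolding 1 2 3
    using add_mono[OF add_mono[OF add_mono[OF le[of 0] le[of T]] ir] fi] by (simp add: algebra_simps)
qed

end

subsection \<open>Observation of solutions of energy regularity\<close>

context wave
begin

text \<open>Below the cutoff \<open>R\<close> can be divided out:
  \<open>R (J k x) = R (R (N k x))\<close> exhibits the truncation as an element of the domain of
  \<open>A\<close> that depends continuously on time.\<close>

lemma regular_J:
  assumes w: "cw T f x v"
  shows "regular_sol A T (\<lambda>t. J k (f t)) (\<lambda>t. R (J k (x t))) (\<lambda>t. J k (v t))"
  unfolding regular_sol_def
proof (intro conjI ballI)
  have eq: "R (J k (x t)) = R (R (N k (x t)))" for t by (simp add: R_N)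
  show "wave_sol A T (\<lambda>t. J k (f t)) (\<lambda>t. R (J k (x t))) (\<lambda>t. J k (v t))"
    by (rule cw_imp_wave_sol[OF cw_J[OF w]])
  show "R (J k (x t)) \<in> Hsp A 2" for t
    unfolding eq Hsp_eq by (simp add: eval_nat_numeral)
  show "continuous_on {0..T} (\<lambda>t. op_app (half_pow A 2) (R (J k (x t))))"
    unfolding eq op_app_half_pow2 by (intro N.continuous_on cwD(2)[OF w])
qed

lemma observation_diff:
  assumes B: "observation_op A G B" and x: "x \<in> Hsp A 2 \<times> UNIV" "y \<in> Hsp A 2 \<times> UNIV"
  shows "B x - B y = B (x - y)"
proof -
  obtain w u where y: "y = (w, u)" "w \<in> Hsp A 2" using x(2) by auto
  have "0 \<in> Hsp A 2" unfolding Hsp_eq by (rule range_eqI[of _ _ 0]) (simp add: eval_nat_numeral R.zero)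
  then have "- w \<in> Hsp A 2" using Hsp2_diff[of 0 w] y by simp
  then have m: "(-1) *\<^sub>R y \<in> Hsp A 2 \<times> UNIV" using y by simp
  have "B (x + (-1) *\<^sub>R y) = B x + B ((-1) *\<^sub>R y)" 
    using B unfolding observation_op_def by (elim conjE) (erule bspec[OF bspec[OF _ x(1)] m])
  moreover have "B ((-1) *\<^sub>R y) = (-1) *\<^sub>R B y" using B x(2) unfolding observation_op_def by blast
  ultimately show ?thesis by simp
qed

lemma observation_continuous:
  assumes B: "observation_op A G B" and w: "regular_sol A T f w v"
  shows "continuous_on {0..T} (\<lambda>t. B (w t, v t))"
  unfolding continuous_on_def
proof
  fix t assume t: "t \<in> {0..T}"
  obtain M where M: "\<And>w v. w \<in> Hsp A 2 \<Longrightarrow> norm (B (w, v)) \<le> M * sqrt ((Hnorm A 2 w)\<^sup>2 + (norm v)\<^sup>2)"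
    using B unfolding observation_op_def by blast
  let ?h = "\<lambda>t. op_app (half_pow A 2) (w t)"
  have H: "w s \<in> Hsp A 2" if "s \<in> {0..T}" for s using w that unfolding regular_sol_def by blast
  have c: "continuous_on {0..T} ?h" "continuous_on {0..T} v"
    using w unfolding regular_sol_def wave_sol_def by blast+
  let ?g = "\<lambda>s. M * norm (?h s - ?h t, v s - v t)"
  have le: "norm (B (w s, v s) - B (w t, v t)) \<le> ?g s" if s: "s \<in> {0..T}" for s
  proof -
    have "B (w s, v s) - B (w t, v t) = B (w s - w t, v s - v t)"
      using observation_diff[OF B, of "(w s, v s)" "(w t, v t)"] H[OF s] H[OF t] by simp
    then show ?thesis using M[of "w s - w t" "v s - v t"] Hsp2_diff[OF H[OF s] H[OF t]]
      by (simp add: Hnorm_def norm_Pair)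
  qed
  have "continuous_on {0..T} ?g" by (intro continuous_intros c)
  then have "(?g \<longlongrightarrow> ?g t) (at t within {0..T})" using t unfolding continuous_on_def by blast
  then have "(?g \<longlongrightarrow> 0) (at t within {0..T})" by (simp add: norm_Pair)
  then have "((\<lambda>s. B (w s, v s) - B (w t, v t)) \<longlongrightarrow> 0) (at t within {0..T})"
    by (rule Lim_null_comparison[rotated]) (use le in \<open>auto simp: eventually_at_filter\<close>)
  then show "((\<lambda>s. B (w s, v s)) \<longlongrightarrow> B (w t, v t)) (at t within {0..T})" by (rule LIM_zero_cancel)
qed

abbreviation adm_J :: "real \<Rightarrow> (real \<Rightarrow> 'h) \<Rightarrow> (real \<Rightarrow> 'h) \<Rightarrow> (real \<Rightarrow> 'h) \<Rightarrow> nat \<Rightarrow> real" where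
  "adm_J T f x v k \<equiv>
    adm_bound A T (\<lambda>t. J k (f t) - f t) (\<lambda>t. R (J k (x t)) - R (x t)) (\<lambda>t. J k (v t) - v t)"

text \<open>Truncations approximate a solution in the very quantity that defines the extension by
  density. The integrals converge by domination, \<open>J k\<close> being contractions.\<close>

lemma adm_J_lim:
  assumes T: "0 \<le> T" and w: "cw T f x v"
  shows "(\<lambda>k. adm_J T f x v k) \<longlonglongrightarrow> 0"
proof -
  note c = cwD(1-3)[OF w]
  define e where "e k t = 1/2 * (norm (J k (x t) - x t, J k (v t) - v t))\<^sup>2" for k t
  define g where "g k t = (norm (J k (f t) - f t))\<^sup>2" for k t
  have ec: "continuous_on {0..T} (e k)" and gc: "continuous_on {0..T} (g k)" for k
    unfolding e_def g_def by (intro continuous_intros J.continuous_on c)+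
  have en: "energy A 1 (R (J k (x t)) - R (x t)) (J k (v t) - v t) = e k t" for k t
    using energy1[of "J k (x t) - x t"] by (simp add: e_def R.diff)
  have eq: "adm_J T f x v k
      = e k 0 + e k T + integral {0..T} (e k) + integral {0..T} (g k)" for k
    using adm_bound_eq[OF T en ec] LINT_continuous[OF gc] by (simp add: g_def)
  have el: "(\<lambda>k. e k t) \<longlonglongrightarrow> 0" and gl: "(\<lambda>k. g k t) \<longlonglongrightarrow> 0" for t
  proof -
    have "(\<lambda>k. e k t) \<longlonglongrightarrow> 1/2 * (norm (x t - x t, v t - v t))\<^sup>2" "(\<lambda>k. g k t) \<longlonglongrightarrow> (norm (f t - f t))\<^sup>2"
      unfolding e_def g_def by (intro tendsto_intros J_lim)+
    then show "(\<lambda>k. e k t) \<longlonglongrightarrow> 0" "(\<lambda>k. g k t) \<longlonglongrightarrow> 0" by (simp_all add: norm_Pair)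
  qed
  have Jd: "(norm (J k y - y))\<^sup>2 \<le> 4 * (norm y)\<^sup>2" for k y
    using norm_diff_sq_le[of "J k y" y] power_mono[OF norm_J[of k y] norm_ge_zero, of 2] by linarith
  have ei: "(\<lambda>k. integral {0..T} (e k)) \<longlonglongrightarrow> integral {0..T} (\<lambda>t. 0)"
  proof (rule dominated_convergence(2))
    show "e k integrable_on {0..T}" for k by (intro integrable_continuous_real ec)
    show "(\<lambda>t. 2 * (norm (x t))\<^sup>2 + 2 * (norm (v t))\<^sup>2) integrable_on {0..T}"
      by (intro integrable_continuous_real continuous_intros c)
    show "norm (e k t) \<le> 2 * (norm (x t))\<^sup>2 + 2 * (norm (v t))\<^sup>2" for k t
      unfolding e_def using Jd[of k "x t"] Jd[of k "v t"] by (simp add: norm_Pair)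
  qed (use el in blast)
  have gi: "(\<lambda>k. integral {0..T} (g k)) \<longlonglongrightarrow> integral {0..T} (\<lambda>t. 0)"
  proof (rule dominated_convergence(2))
    show "g k integrable_on {0..T}" for k by (intro integrable_continuous_real gc)
    show "(\<lambda>t. 4 * (norm (f t))\<^sup>2) integrable_on {0..T}"
      by (intro integrable_continuous_real continuous_intros c)
    show "norm (g k t) \<le> 4 * (norm (f t))\<^sup>2" for k t unfolding g_def using Jd by simp
  qed (use gl in blast)
  have "(\<lambda>k. e k 0 + e k T + integral {0..T} (e k) + integral {0..T} (g k)) \<longlonglongrightarrow> 0 + 0 + integral {0..T} (\<lambda>t. 0) + integral {0..T} (\<lambda>t. 0)"
    by (intro tendsto_add el ei gi)
  then show ?thesis unfolding eq by simp
qed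

text \<open>Observations of two regular approximations of one solution differ by no more than the
  distances of these approximations to it. Admissibility is applied to the difference of the two,
  and the solution is inserted by \<open>adm_bound_diff\<close>. Existence and uniqueness of the
  observation both rest on this.\<close>

lemma admissible_diff:
  assumes B: "admissible A G B" and T: "T > 0"
  obtains K where "K > 0"
    "\<And>f w v F W V F' W' V'. wave_sol A T f w v \<Longrightarrow> regular_sol A T F W V \<Longrightarrow> regular_sol A T F' W' V' \<Longrightarrow>
    (LINT t:{0..T}|lebesgue. (norm (B (W t, V t) - B (W' t, V' t)))\<^sup>2)
    \<le> K * (adm_bound A T (\<lambda>t. F t - f t) (\<lambda>t. W t - w t) (\<lambda>t. V t - v t)
      + adm_bound A T (\<lambda>t. F' t - f t) (\<lambda>t. W' t - w t) (\<lambda>t. V' t - v t))"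
proof -
  obtain D where D: "D > 0" "\<And>f w v. regular_sol A T f w v \<Longrightarrow>
     (LINT t:{0..T}|lebesgue. (norm (B (w t, v t)))\<^sup>2) \<le> D * adm_bound A T f w v"
    using B T unfolding admissible_def by blast
  have op: "observation_op A G B" using B unfolding admissible_def by blast
  show thesis
  proof (rule that[of "2 * D"])
    fix f w v F W V F' W' V'
    assume w: "wave_sol A T f w v" and 1: "regular_sol A T F W V" and 2: "regular_sol A T F' W' V'"
    let ?a1 = "adm_bound A T (\<lambda>t. F t - f t) (\<lambda>t. W t - w t) (\<lambda>t. V t - v t)"
    let ?a2 = "adm_bound A T (\<lambda>t. F' t - f t) (\<lambda>t. W' t - w t) (\<lambda>t. V' t - v t)"
    have w1: "wave_sol A T F W V" and w2: "wave_sol A T F' W' V'" using 1 2 unfolding regular_sol_def by blast+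
    have "(LINT t:{0..T}|lebesgue. (norm (B (W t, V t) - B (W' t, V' t)))\<^sup>2)
       = (LINT t:{0..T}|lebesgue. (norm (B (W t - W' t, V t - V' t)))\<^sup>2)"
    proof (rule set_lebesgue_integral_cong)
      have "B (W t, V t) - B (W' t, V' t) = B (W t - W' t, V t - V' t)" if "t \<in> {0..T}" for t
        using observation_diff[OF op, of "(W t, V t)" "(W' t, V' t)"] 1 2 that unfolding regular_sol_def by simp
      then show "\<forall>t. t \<in> {0..T} \<longrightarrow> (norm (B (W t, V t) - B (W' t, V' t)))\<^sup>2 = (norm (B (W t - W' t, V t - V' t)))\<^sup>2"
        by simp
    qed simp
    also have "\<dots> \<le> D * adm_bound A T (\<lambda>t. F t - F' t) (\<lambda>t. W t - W' t) (\<lambda>t. V t - V' t)"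
      by (rule D(2)[OF regular_sol_diff[OF 1 2]])
    also have "\<dots> \<le> D * (2 * ?a1 + 2 * ?a2)"
    proof (rule mult_left_mono)
      show "adm_bound A T (\<lambda>t. F t - F' t) (\<lambda>t. W t - W' t) (\<lambda>t. V t - V' t) \<le> 2 * ?a1 + 2 * ?a2"
        using adm_bound_diff[OF less_imp_le[OF T] wave_sol_diff[OF w1 w] wave_sol_diff[OF w2 w]] by simp
    qed (use D(1) in simp)
    finally show "(LINT t:{0..T}|lebesgue. (norm (B (W t, V t) - B (W' t, V' t)))\<^sup>2) \<le> 2 * D * (?a1 + ?a2)"
      by (simp add: algebra_simps)
  qed (use D(1) in simp)
qed

text \<open>The truncations have Cauchy observations by \<open>admissible_diff\<close>. A
  subsequence converging in \<open>L^2\<close> suffices, as \<open>is_observation\<close> asks for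
  some approximating sequence.\<close>

lemma observation_exists:
  fixes B :: "'h \<times> 'h \<Rightarrow> 'g::{real_inner,complete_space}"
  assumes B: "admissible A G B" and T: "T > 0" and w: "cw T f x v"
  shows "\<exists>y. is_observation A B T f (\<lambda>t. R (x t)) v y"
proof -
  have op: "observation_op A G B" using B unfolding admissible_def by blast
  define b where "b k t = B (R (J k (x t)), J k (v t))" for k t
  define ad where "ad k = adm_J T f x v k" for k
  have ad: "ad \<longlonglongrightarrow> 0" unfolding ad_def by (rule adm_J_lim[OF less_imp_le[OF T] w])
  obtain D where D: "D > 0" "\<And>k l. (LINT t:{0..T}|lebesgue. (norm (b k t - b l t))\<^sup>2) \<le> D * (ad k + ad l)"
  proof -
    obtain D where D: "D > 0"
      "\<And>f w v F W V F' W' V'. wave_sol A T f w v \<Longrightarrow> regular_sol A T F W V \<Longrightarrow> regular_sol A T F' W' V' \<Longrightarrow>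
       (LINT t:{0..T}|lebesgue. (norm (B (W t, V t) - B (W' t, V' t)))\<^sup>2)
       \<le> D * (adm_bound A T (\<lambda>t. F t - f t) (\<lambda>t. W t - w t) (\<lambda>t. V t - v t)
      + adm_bound A T (\<lambda>t. F' t - f t) (\<lambda>t. W' t - w t) (\<lambda>t. V' t - v t))"
      by (rule admissible_diff[OF B T]) blast
    show ?thesis
      by (rule that[OF D(1)]) (unfold b_def ad_def, rule D(2)[OF cw_imp_wave_sol[OF w] regular_J[OF w] regular_J[OF w]])
  qed
  have "\<exists>N. \<forall>k\<ge>N. \<forall>l\<ge>N. (LINT t:{0..T}|lebesgue. (norm (b k t - b l t))\<^sup>2) \<le> \<epsilon>" if "\<epsilon> > 0" for \<epsilon>
  proof -
    have "\<epsilon> / (2 * D) > 0" using that D(1) by simp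
    then obtain N where N: "\<And>k. k \<ge> N \<Longrightarrow> ad k < \<epsilon> / (2 * D)"
      using order_tendstoD(2)[OF ad] unfolding eventually_sequentially by blast
    show ?thesis
    proof (intro exI allI impI)
      fix k l assume "k \<ge> N" "l \<ge> N"
      then have "ad k + ad l \<le> \<epsilon> / D" using N[of k] N[of l] by (simp add: field_simps)
      then have "D * (ad k + ad l) \<le> \<epsilon>" using D(1) by (simp add: field_simps)
      then show "(LINT t:{0..T}|lebesgue. (norm (b k t - b l t))\<^sup>2) \<le> \<epsilon>" using D(2)[of k l] by linarith
    qed
  qed
  moreover have "continuous_on {0..T} (b k)" for k
    unfolding b_def by (rule observation_continuous[OF op regular_J[OF w]])
  ultimately obtain y s where ys: "L2_on T y" "strict_mono (s :: nat \<Rightarrow> nat)"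
    "\<forall>j. set_integrable lebesgue {0..T} (\<lambda>t. (norm (b (s j) t - y t))\<^sup>2)"
    "(\<lambda>j. LINT t:{0..T}|lebesgue. (norm (b (s j) t - y t))\<^sup>2) \<longlonglongrightarrow> 0"
    using L2_complete[of T b] by blast
  have "(\<lambda>j. ad (s j)) \<longlonglongrightarrow> 0" using LIMSEQ_subseq_LIMSEQ[OF ad ys(2)] by (simp add: o_def)
  then have "is_observation A B T f (\<lambda>t. R (x t)) v y"
    unfolding is_observation_def using ys regular_J[OF w] unfolding b_def ad_def
    by (intro conjI exI[of _ "\<lambda>j t. J (s j) (f t)"] exI[of _ "\<lambda>j t. R (J (s j) (x t))"]
        exI[of _ "\<lambda>j t. J (s j) (v t)"]) auto
  then show ?thesis by blast
qed

text \<open>Observation of the truncated solution, computed from \<open>x\<close> and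
  \<open>v\<close> alone, without reference to the source or to the choice inside
  \<open>observation\<close>.\<close>

definition BJ :: "('h \<times> 'h \<Rightarrow> 'g::real_normed_vector) \<Rightarrow> nat \<Rightarrow> real \<Rightarrow> (real \<Rightarrow> 'h) \<Rightarrow> (real \<Rightarrow> 'h) \<Rightarrow> real" where
  "BJ B k T x v = (LINT t:{0..T}|lebesgue. (norm (B (R (J k (x t)), J k (v t))))\<^sup>2)"

text \<open>Whichever \<open>y\<close> was chosen, the sequence that witnesses it and the
  truncations approximate the same solution, so \<open>admissible_diff\<close> makes their
  observations merge. Hence all choices have the same norm and \<open>observed\<close> is well
  determined.\<close>

lemma observation_limit:
  fixes B :: "'h \<times> 'h \<Rightarrow> 'g::{real_inner,complete_space}"
  assumes B: "admissible A G B" and T: "T > 0" and w: "cw T f x v"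
    and y: "is_observation A B T f (\<lambda>t. R (x t)) v y"
  shows "(\<lambda>k. BJ B k T x v) \<longlonglongrightarrow> (LINT t:{0..T}|lebesgue. (norm (y t))\<^sup>2)"
proof -
  have op: "observation_op A G B" using B unfolding admissible_def by blast
  obtain F W V where reg: "\<And>k::nat. regular_sol A T (F k) (W k) (V k)"
    and al: "(\<lambda>k. adm_bound A T (\<lambda>t. F k t - f t) (\<lambda>t. W k t - R (x t)) (\<lambda>t. V k t - v t)) \<longlonglongrightarrow> 0"
    and int: "\<And>k. set_integrable lebesgue {0..T} (\<lambda>t. (norm (B (W k t, V k t) - y t))\<^sup>2)"
    and lim: "(\<lambda>k. LINT t:{0..T}|lebesgue. (norm (B (W k t, V k t) - y t))\<^sup>2) \<longlonglongrightarrow> 0"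
    and yL: "L2_on T y"
    using y unfolding is_observation_def by blast
  define b where "b k t = B (R (J k (x t)), J k (v t))" for k t
  define d where "d k t = B (W k t, V k t)" for k t
  have bc: "continuous_on {0..T} (b k)" and dc: "continuous_on {0..T} (d k)" for k
    unfolding b_def d_def by (rule observation_continuous[OF op regular_J[OF w]] observation_continuous[OF op reg])+
  define P where "P = (LINT t:{0..T}|lebesgue. (norm (y t))\<^sup>2)"
  define Q where "Q k = (LINT t:{0..T}|lebesgue. (norm (b k t))\<^sup>2)" for k
  define r1 where "r1 k = (LINT t:{0..T}|lebesgue. (norm (b k t - d k t))\<^sup>2)" for k
  define r2 where "r2 k = (LINT t:{0..T}|lebesgue. (norm (d k t - y t))\<^sup>2)" for k
  have iy: "set_integrable lebesgue {0..T} (\<lambda>t. (norm (y t))\<^sup>2)" using yL unfolding L2_on_def by blast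
  have ib: "set_integrable lebesgue {0..T} (\<lambda>t. (norm (b k t))\<^sup>2)" for k
    by (intro absolutely_integrable_continuous_real continuous_intros bc)
  have i1: "set_integrable lebesgue {0..T} (\<lambda>t. (norm (b k t - d k t))\<^sup>2)" for k
    by (intro absolutely_integrable_continuous_real continuous_intros bc dc)
  have i2: "set_integrable lebesgue {0..T} (\<lambda>t. (norm (d k t - y t))\<^sup>2)" for k
    using int unfolding d_def by blast
  define ad where "ad k = adm_J T f x v k" for k
  define ad' where "ad' k = adm_bound A T (\<lambda>t. F k t - f t) (\<lambda>t. W k t - R (x t)) (\<lambda>t. V k t - v t)" for k
  have nn: "0 \<le> (LINT t:{0..T}|lebesgue. (norm (h t))\<^sup>2)" for h :: "real \<Rightarrow> 'g"
    unfolding set_lebesgue_integral_def by (intro integral_nonneg_AE) simp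
  obtain D where D: "D > 0" "\<And>k. r1 k \<le> D * (ad k + ad' k)"
  proof -
    obtain D where D: "D > 0"
      "\<And>f w v F W V F' W' V'. wave_sol A T f w v \<Longrightarrow> regular_sol A T F W V \<Longrightarrow> regular_sol A T F' W' V' \<Longrightarrow>
       (LINT t:{0..T}|lebesgue. (norm (B (W t, V t) - B (W' t, V' t)))\<^sup>2)
       \<le> D * (adm_bound A T (\<lambda>t. F t - f t) (\<lambda>t. W t - w t) (\<lambda>t. V t - v t)
      + adm_bound A T (\<lambda>t. F' t - f t) (\<lambda>t. W' t - w t) (\<lambda>t. V' t - v t))"
      by (rule admissible_diff[OF B T]) blast
    show ?thesis
      by (rule that[OF D(1)])
        (unfold r1_def b_def d_def ad_def ad'_def, rule D(2)[OF cw_imp_wave_sol[OF w] regular_J[OF w] reg])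
  qed
  have "(\<lambda>k. D * (ad k + ad' k)) \<longlonglongrightarrow> D * (0 + 0)"
    unfolding ad_def ad'_def by (intro tendsto_intros al adm_J_lim[OF less_imp_le[OF T] w])
  then have D0: "(\<lambda>k. D * (ad k + ad' k)) \<longlonglongrightarrow> 0" by simp
  have r1l: "r1 \<longlonglongrightarrow> 0"
    by (rule tendsto_sandwich[OF always_eventually always_eventually tendsto_const D0])
      (use D(2) nn in \<open>simp_all add: r1_def\<close>)
  \<comment> \<open>Stated for two functions at distance \<open>norm (b k t - y t)\<close> so that
    it serves both directions of \<open>young_limit\<close>.\<close>
  have mono: "(LINT t:{0..T}|lebesgue. (norm (p t))\<^sup>2) \<le> (1 + \<delta>) * (LINT t:{0..T}|lebesgue. (norm (q t))\<^sup>2)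
      + (1 + 1/\<delta>) * (2 * r1 k + 2 * r2 k)"
    if \<delta>: "\<delta> > 0" and ip: "set_integrable lebesgue {0..T} (\<lambda>t. (norm (p t))\<^sup>2)"
      and iq: "set_integrable lebesgue {0..T} (\<lambda>t. (norm (q t))\<^sup>2)"
      and pq: "\<And>t. norm (p t - q t) = norm (b k t - y t)" for \<delta> k and p q :: "real \<Rightarrow> 'g"
  proof -
    have "(LINT t:{0..T}|lebesgue. (norm (p t))\<^sup>2) \<le> (LINT t:{0..T}|lebesgue. (1 + \<delta>) * (norm (q t))\<^sup>2
      + (1 + 1/\<delta>) * (2 * (norm (b k t - d k t))\<^sup>2 + 2 * (norm (d k t - y t))\<^sup>2))"
    proof (rule set_integral_mono[OF ip])
      show "set_integrable lebesgue {0..T} (\<lambda>t. (1 + \<delta>) * (norm (q t))\<^sup>2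
         + (1 + 1/\<delta>) * (2 * (norm (b k t - d k t))\<^sup>2 + 2 * (norm (d k t - y t))\<^sup>2))"
        by (intro set_integral_add(1) set_integrable_mult_right impI iq i1 i2)
      fix t
      have "norm (p t) \<le> norm (q t) + norm (b k t - y t)"
        using norm_triangle_sub[of "p t" "q t"] pq[of t] by simp
      then have "(norm (p t))\<^sup>2 \<le> (1 + \<delta>) * (norm (q t))\<^sup>2 + (1 + 1/\<delta>) * (norm (b k t - y t))\<^sup>2"
        by (intro young_sq \<delta>) auto
      also have "\<dots> \<le> (1 + \<delta>) * (norm (q t))\<^sup>2
         + (1 + 1/\<delta>) * (2 * (norm (b k t - d k t))\<^sup>2 + 2 * (norm (d k t - y t))\<^sup>2)"
        using \<delta> by (intro add_left_mono mult_left_mono dist_sq_le) simp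
      finally show "(norm (p t))\<^sup>2 \<le> (1 + \<delta>) * (norm (q t))\<^sup>2
         + (1 + 1/\<delta>) * (2 * (norm (b k t - d k t))\<^sup>2 + 2 * (norm (d k t - y t))\<^sup>2)" .
    qed
    also have "\<dots> = (1 + \<delta>) * (LINT t:{0..T}|lebesgue. (norm (q t))\<^sup>2)
      + (1 + 1/\<delta>) * (2 * r1 k + 2 * r2 k)"
      unfolding r1_def r2_def
      by (simp only: set_integral_add(2) set_integral_add(1) set_integrable_mult_right set_integral_mult_right iq i1 i2 if_True)
    finally show ?thesis .
  qed
  have "Q \<longlonglongrightarrow> P"
  proof (rule young_limit[where \<rho> = "\<lambda>k. 2 * r1 k + 2 * r2 k"])
    show "P \<ge> 0" "Q k \<ge> 0" for k unfolding P_def Q_def by (rule nn)+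
    show "2 * r1 k + 2 * r2 k \<ge> 0" for k
      unfolding r1_def r2_def using nn[of "\<lambda>t. b k t - d k t"] nn[of "\<lambda>t. d k t - y t"] by linarith
    have "(\<lambda>k. 2 * r1 k + 2 * r2 k) \<longlonglongrightarrow> 2 * 0 + 2 * 0"
      by (intro tendsto_intros r1l lim[folded d_def, folded r2_def])
    then show "(\<lambda>k. 2 * r1 k + 2 * r2 k) \<longlonglongrightarrow> 0" by simp
    show "P \<le> (1 + \<delta>) * Q k + (1 + 1/\<delta>) * (2 * r1 k + 2 * r2 k)" if "\<delta> > 0" for k \<delta>
      unfolding P_def Q_def by (rule mono[OF that iy ib]) (rule norm_minus_commute)
    show "Q k \<le> (1 + \<delta>) * P + (1 + 1/\<delta>) * (2 * r1 k + 2 * r2 k)" if "\<delta> > 0" for k \<delta>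
      unfolding P_def Q_def by (rule mono[OF that ib iy]) simp
  qed
  then show ?thesis unfolding Q_def P_def b_def BJ_def .
qed

lemma BJ_tendsto_observed:
  fixes B :: "'h \<times> 'h \<Rightarrow> 'g::{real_inner,complete_space}"
  assumes B: "admissible A G B" and T: "T > 0" and w: "cw T f x v"
  shows "(\<lambda>k. BJ B k T x v) \<longlonglongrightarrow> observed A B T f (\<lambda>t. R (x t)) v"
proof -
  have "is_observation A B T f (\<lambda>t. R (x t)) v (observation A B T f (\<lambda>t. R (x t)) v)"
    unfolding observation_def by (rule someI_ex[OF observation_exists[OF B T w]])
  from observation_limit[OF B T w this] show ?thesis unfolding observed_def .
qed

text \<open>Solutions are functions on the whole line; the values of \<open>w\<close> outside
  \<open>[0, T]\<close> must not influence the observation.\<close>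

lemma observed_cong:
  assumes T: "0 \<le> T" and eq: "\<And>t. t \<in> {0..T} \<Longrightarrow> w t = w' t"
  shows "observed A B T f w v = observed A B T f w' v"
proof -
  have "adm_bound A T g (\<lambda>t. W t - w t) u = adm_bound A T g (\<lambda>t. W t - w' t) u" for g W u
  proof -
    have "(LINT t:{0..T}|lebesgue. energy A 1 (W t - w t) (u t)) = (LINT t:{0..T}|lebesgue. energy A 1 (W t - w' t) (u t))"
      by (rule set_lebesgue_integral_cong) (use eq in auto)
    then show ?thesis unfolding adm_bound_def using eq[of 0] eq[of T] T by simp
  qed
  then have "is_observation A B T f w v = is_observation A B T f w' v"
    unfolding is_observation_def by (intro ext) simp
  then show ?thesis unfolding observed_def observation_def by simp
qed

end

subsection \<open>Observation functionals\<close>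

lemma integral_windows_le:
  fixes h :: "real \<Rightarrow> real"
  assumes h: "continuous_on {0..T} h" "\<And>t. t \<in> {0..T} \<Longrightarrow> 0 \<le> h t"
    and b: "0 \<le> b" "0 < \<tau>" "b + real n * \<tau> \<le> T"
  shows "(\<Sum>j<n. integral {0..\<tau>} (\<lambda>t. h (b + real j * \<tau> + t))) \<le> integral {0..T} h"
proof -
  have hi: "h integrable_on {p..q}" if "0 \<le> p" "q \<le> T" for p q
    by (intro integrable_continuous_real continuous_on_subset[OF h(1)]) (use that in auto)
  have "(\<Sum>j<m. integral {0..\<tau>} (\<lambda>t. h (b + real j * \<tau> + t))) = integral {b..b + real m * \<tau>} h" if "m \<le> n" for m
    using that
  proof (induction m)
    case (Suc m)
    have "real (Suc m) * \<tau> \<le> real n * \<tau>" using Suc.prems b(2) by (intro mult_right_mono) auto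
    then have le: "b + real m * \<tau> + \<tau> \<le> T" using b(3) by (simp add: distrib_right)
    have p: "0 \<le> real m * \<tau>" using b(2) by simp
    have "integral {0..\<tau>} (\<lambda>t. h (b + real m * \<tau> + t)) = integral {b + real m * \<tau>..b + real m * \<tau> + \<tau>} h"
      using integral_shift_Icc_real[of 0 \<tau> h "b + real m * \<tau>"] by (simp add: o_def add_ac)
    moreover have "integral {b..b + real m * \<tau>} h + integral {b + real m * \<tau>..b + real m * \<tau> + \<tau>} h
        = integral {b..b + real m * \<tau> + \<tau>} h"
      by (rule Henstock_Kurzweil_Integration.integral_combine) (use b p le in \<open>auto intro!: hi\<close>)
    ultimately show ?case using Suc by (simp add: distrib_right add_ac)
  qed simp
  from this[OF order_refl]
  have "(\<Sum>j<n. integral {0..\<tau>} (\<lambda>t. h (b + real j * \<tau> + t))) = integral {b..b + real n * \<tau>} h" .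
  also have "\<dots> \<le> integral {0..T} h"
    by (rule integral_subset_le) (use b h in \<open>auto intro!: hi\<close>)
  finally show ?thesis .
qed

context wave
begin

text \<open>Interface shared by \<open>|P w'|^2\<close> and \<open>|B (w, w')|^2\<close>:
  superadditivity over consecutive windows, a quadratic triangle inequality, and boundedness by the
  size of state and source. The functional takes \<open>x\<close> and \<open>v\<close> only; the
  source appears in the definition to say which pairs are solutions, and in the bound.\<close>

definition obs_fun :: "(real \<Rightarrow> (real \<Rightarrow> 'h) \<Rightarrow> (real \<Rightarrow> 'h) \<Rightarrow> real) \<Rightarrow> bool" where
  "obs_fun q \<longleftrightarrow>
    (\<forall>T f x v b \<tau>. \<forall>n::nat. cw T f x v \<longrightarrow> 0 < T \<longrightarrow> 0 \<le> b \<longrightarrow> 0 < \<tau> \<longrightarrow> b + real n * \<tau> \<le> T \<longrightarrow>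
       (\<Sum>j<n. q \<tau> (\<lambda>t. x (b + real j * \<tau> + t)) (\<lambda>t. v (b + real j * \<tau> + t))) \<le> q T x v) \<and>
    (\<forall>T f x v g y u. 0 < T \<longrightarrow> cw T f x v \<longrightarrow> cw T g y u \<longrightarrow>
       q T (\<lambda>t. x t - y t) (\<lambda>t. v t - u t) \<le> 2 * q T x v + 2 * q T y u) \<and>
    (\<forall>T>0. \<exists>K\<ge>0. \<forall>f x v M L. cw T f x v \<longrightarrow> (\<forall>t\<in>{0..T}. norm (x t, v t) \<le> M) \<longrightarrow>
       (\<forall>t\<in>{0..T}. norm (f t) \<le> L) \<longrightarrow> q T x v \<le> K * (M\<^sup>2 + L\<^sup>2))"

definition free_observable :: "(real \<Rightarrow> (real \<Rightarrow> 'h) \<Rightarrow> (real \<Rightarrow> 'h) \<Rightarrow> real) \<Rightarrow> bool" where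
  "free_observable q \<longleftrightarrow> (\<exists>T0>0. \<forall>T>T0. \<exists>r>0. \<forall>x v. cw T (\<lambda>t. 0) x v \<longrightarrow>
     r * (norm (x 0, v 0))\<^sup>2 \<le> q T x v)"

lemma obs_fun_windows:
  fixes n :: nat
  assumes "obs_fun q" "cw T f x v" "0 < T" "0 \<le> b" "0 < \<tau>" "b + real n * \<tau> \<le> T"
  shows "(\<Sum>j<n. q \<tau> (\<lambda>t. x (b + real j * \<tau> + t)) (\<lambda>t. v (b + real j * \<tau> + t))) \<le> q T x v"
  using assms unfolding obs_fun_def by blast

lemma obs_fun_diff:
  assumes "obs_fun q" "0 < T" "cw T f x v" "cw T g y u"
  shows "q T (\<lambda>t. x t - y t) (\<lambda>t. v t - u t) \<le> 2 * q T x v + 2 * q T y u"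
proof -
  have "\<forall>T f x v g y u. 0 < T \<longrightarrow> cw T f x v \<longrightarrow> cw T g y u \<longrightarrow>
       q T (\<lambda>t. x t - y t) (\<lambda>t. v t - u t) \<le> 2 * q T x v + 2 * q T y u"
    using assms(1) unfolding obs_fun_def by (elim conjE)
  from this[rule_format, OF assms(2-4)] show ?thesis .
qed

lemma obs_fun_bound:
  assumes "obs_fun q" "0 < T"
  obtains K where "K \<ge> 0" "\<And>f x v M L. cw T f x v \<Longrightarrow> (\<And>t. t \<in> {0..T} \<Longrightarrow> norm (x t, v t) \<le> M) \<Longrightarrow>
       (\<And>t. t \<in> {0..T} \<Longrightarrow> norm (f t) \<le> L) \<Longrightarrow> q T x v \<le> K * (M\<^sup>2 + L\<^sup>2)"
  using assms unfolding obs_fun_def by meson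

text \<open>The instance with no window: an empty sum is at most \<open>q T x v\<close>.\<close>

lemma obs_fun_nonneg:
  assumes "obs_fun q" "cw T f x v" "0 < T"
  shows "0 \<le> q T x v"
  using obs_fun_windows[OF assms order_refl zero_less_one, where n = 0] assms(3) by simp

text \<open>Compare with the free wave with the same initial data. By
  \<open>cw_norm_lipschitz\<close> the difference is at most \<open>L * T\<close> in norm and its
  source at most \<open>L\<close>, so its observation costs \<open>K * (T^2 + 1) * L^2\<close>;
  writing the free wave as solution minus difference doubles both terms.\<close>

lemma perturbed_observability:
  assumes q: "obs_fun q" and T: "0 < T"
    and r: "r \<ge> 0" "\<And>x v. cw T (\<lambda>t. 0) x v \<Longrightarrow> r * (norm (x 0, v 0))\<^sup>2 \<le> q T x v"
  obtains K where "K \<ge> 0" "\<And>f x v L. cw T f x v \<Longrightarrow> (\<And>t. t \<in> {0..T} \<Longrightarrow> norm (f t) \<le> L) \<Longrightarrow>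
      r * (norm (x 0, v 0))\<^sup>2 \<le> 2 * q T x v + K * L\<^sup>2"
proof -
  obtain K where K: "K \<ge> 0" "\<And>f x v M L. cw T f x v \<Longrightarrow> (\<And>t. t \<in> {0..T} \<Longrightarrow> norm (x t, v t) \<le> M) \<Longrightarrow>
       (\<And>t. t \<in> {0..T} \<Longrightarrow> norm (f t) \<le> L) \<Longrightarrow> q T x v \<le> K * (M\<^sup>2 + L\<^sup>2)"
    by (rule obs_fun_bound[OF q T]) blast
  show thesis
  proof (rule that[of "2 * K * (T\<^sup>2 + 1)"])
    show "0 \<le> 2 * K * (T\<^sup>2 + 1)" using K(1) by simp
    fix f x v L assume w: "cw T f x v" and L: "\<And>t. t \<in> {0..T} \<Longrightarrow> norm (f t) \<le> L"
    have "0 \<le> L" using order_trans[OF norm_ge_zero L[of 0]] T by simp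
    obtain y u where yu: "cw T (\<lambda>t. 0) y u" "y 0 = x 0" "u 0 = v 0" using free_wave_exists by blast
    have d: "cw T (\<lambda>t. f t - 0) (\<lambda>t. x t - y t) (\<lambda>t. v t - u t)" by (rule cw_diff[OF w yu(1)])
    have "norm (x t - y t, v t - u t) \<le> L * T" if t: "t \<in> {0..T}" for t
    proof -
      have "\<bar>norm (x t - y t, v t - u t) - norm (x 0 - y 0, v 0 - u 0)\<bar> \<le> L * (t - 0)"
        by (rule cw_norm_lipschitz[OF d]) (use t L in auto)
      also have "\<dots> \<le> L * T" using t \<open>0 \<le> L\<close> by (simp add: mult_left_mono)
      finally show ?thesis using yu by simp
    qed
    then have "q T (\<lambda>t. x t - y t) (\<lambda>t. v t - u t) \<le> K * ((L * T)\<^sup>2 + L\<^sup>2)"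
      by (rule K(2)[OF d]) (use L in simp_all)
    moreover have "q T (\<lambda>t. x t - (x t - y t)) (\<lambda>t. v t - (v t - u t))
       \<le> 2 * q T x v + 2 * q T (\<lambda>t. x t - y t) (\<lambda>t. v t - u t)"
      by (rule obs_fun_diff[OF q T w d])
    moreover have "r * (norm (x 0, v 0))\<^sup>2 \<le> q T y u" using r(2)[OF yu(1)] yu by simp
    ultimately show "r * (norm (x 0, v 0))\<^sup>2 \<le> 2 * q T x v + 2 * K * (T\<^sup>2 + 1) * L\<^sup>2"
      by (simp add: power_mult_distrib algebra_simps)
  qed
qed

text \<open>The constants \<open>r\<close> and \<open>K\<close> belong to a window of fixed length
  \<open>\<tau>\<close>, so \<open>C\<close> and \<open>T1\<close> do not depend on the final time;
  the factor \<open>T\<close> in the conclusion is the number of windows up to a constant.\<close>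

lemma long_time_observability:
  assumes q: "obs_fun q" and fo: "free_observable q" and \<kappa>: "\<kappa> \<ge> 0"
  obtains C T1 where "C > 0" "T1 \<ge> 1"
    "\<And>T f x v \<sigma> s. T \<ge> T1 \<Longrightarrow> cw T f x v \<Longrightarrow> s \<in> {0..T} \<Longrightarrow> norm (x s, v s) = \<sigma> \<Longrightarrow>
      (\<And>t. t \<in> {0..T} \<Longrightarrow> norm (f t) \<le> (\<kappa> / T) * \<sigma>) \<Longrightarrow> T * \<sigma>\<^sup>2 \<le> C * q T x v"
proof -
  obtain T0 where T0: "T0 > 0" "\<And>T. T > T0 \<Longrightarrow> \<exists>r>0. \<forall>x v. cw T (\<lambda>t. 0) x v \<longrightarrow>
     r * (norm (x 0, v 0))\<^sup>2 \<le> q T x v" using fo unfolding free_observable_def by blast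
  define \<tau> where "\<tau> = T0 + 1"
  have \<tau>: "\<tau> > 0" "\<tau> > T0" using T0 by (simp_all add: \<tau>_def)
  obtain r where r: "r > 0" "\<And>x v. cw \<tau> (\<lambda>t. 0) x v \<Longrightarrow> r * (norm (x 0, v 0))\<^sup>2 \<le> q \<tau> x v"
    using T0(2)[OF \<tau>(2)] by blast
  obtain K where K: "K \<ge> 0" "\<And>f x v L. cw \<tau> f x v \<Longrightarrow> (\<And>t. t \<in> {0..\<tau>} \<Longrightarrow> norm (f t) \<le> L) \<Longrightarrow>
      r * (norm (x 0, v 0))\<^sup>2 \<le> 2 * q \<tau> x v + K * L\<^sup>2"
    by (rule perturbed_observability[OF q \<tau>(1) less_imp_le[OF r(1)] r(2)]) blast+
  \<comment> \<open>\<open>\<kappa> * \<delta> \<le> 1/2\<close> limits the loss of the norm over a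
    time \<open>\<delta> * T\<close> to \<open>\<sigma> / 2\<close>;
    \<open>\<delta> \<le> 1/2\<close> leaves room for such an interval on one side of
    \<open>s\<close>.\<close>
  define \<delta> where "\<delta> = 1 / (2 * (\<kappa> + 1))"
  have \<delta>: "\<delta> > 0" "\<delta> \<le> 1/2" "\<kappa> * \<delta> \<le> 1/2" using \<kappa> by (auto simp: \<delta>_def field_simps)
  \<comment> \<open>The entry \<open>2 * \<tau> / \<delta>\<close> ensures
    \<open>\<delta> * T \<ge> 2 * \<tau>\<close>, so that rounding down the number of windows costs
    at most a factor 2; the last entry makes the source term of a window at most half of
    \<open>r * (\<sigma> / 2)^2\<close>.\<close>
  define T1 where "T1 = max 1 (max (2 * \<tau> / \<delta>) (8 * K * \<kappa>\<^sup>2 / r))"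
  show thesis
  proof (rule that[of "32 * \<tau> / (\<delta> * r)" T1])
    show "0 < 32 * \<tau> / (\<delta> * r)" using \<tau> \<delta> r by simp
    show "1 \<le> T1" unfolding T1_def by simp
    fix T f x v \<sigma> s
    assume T: "T1 \<le> T" and w: "cw T f x v" and s: "s \<in> {0..T}" and \<sigma>: "norm (x s, v s) = \<sigma>"
      and f: "\<And>t. t \<in> {0..T} \<Longrightarrow> norm (f t) \<le> (\<kappa> / T) * \<sigma>"
    have T1: "T \<ge> 1" "2 * \<tau> / \<delta> \<le> T" "8 * K * \<kappa>\<^sup>2 / r \<le> T" using T unfolding T1_def by auto
    have Tp: "T > 0" using T1 by simp
    have \<sigma>0: "\<sigma> \<ge> 0" using \<sigma> by (metis norm_ge_zero)
    have \<delta>T: "2 * \<tau> \<le> \<delta> * T" using T1(2) \<delta>(1) by (simp add: field_simps)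
    \<comment> \<open>The interval of length \<open>\<delta> * T\<close> starts at \<open>s\<close>
      if \<open>s\<close> lies in the first half of \<open>[0, T]\<close>, and ends at
      \<open>s\<close> otherwise.\<close>
    define b where "b = (if s \<le> T / 2 then s else s - \<delta> * T)"
    have \<delta>T2: "\<delta> * T \<le> T / 2" using \<delta>(2) Tp by (simp add: mult_right_mono[of \<delta> "1/2" T])
    have b: "0 \<le> b" "b + \<delta> * T \<le> T" and bs: "\<And>t. t \<in> {b..b + \<delta> * T} \<Longrightarrow> \<bar>t - s\<bar> \<le> \<delta> * T"
      using s \<delta>T2 \<delta>T \<tau> unfolding b_def by (auto split: if_splits)
    have half: "\<sigma> / 2 \<le> norm (x t, v t)" if t: "t \<in> {b..b + \<delta> * T}" for t
    proof -
      have tT: "t \<in> {0..T}" using t b by auto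
      have "\<bar>norm (x t, v t) - norm (x s, v s)\<bar> \<le> (\<kappa> / T * \<sigma>) * \<bar>t - s\<bar>"
      proof (cases "s \<le> t")
        case True
        then show ?thesis using cw_norm_lipschitz[OF w, of s t "\<kappa> / T * \<sigma>"] s tT f by auto
      next
        case False
        then show ?thesis using cw_norm_lipschitz[OF w, of t s "\<kappa> / T * \<sigma>"] s tT f
          by (auto simp: abs_minus_commute)
      qed
      also have "\<dots> \<le> (\<kappa> / T * \<sigma>) * (\<delta> * T)"
        using bs[OF t] \<kappa> Tp \<sigma>0 by (intro mult_left_mono) auto
      also have "\<dots> = (\<kappa> * \<delta>) * \<sigma>" using Tp by simp
      also have "\<dots> \<le> 1/2 * \<sigma>" by (rule mult_right_mono[OF \<delta>(3) \<sigma>0])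
      finally show ?thesis using \<sigma> by linarith
    qed
    define n where "n = nat \<lfloor>\<delta> * T / \<tau>\<rfloor>"
    have n: "real n \<le> \<delta> * T / \<tau>" "\<delta> * T / \<tau> - 1 \<le> real n"
      using \<delta>T \<tau> unfolding n_def by (simp_all add: of_nat_nat)
    have n1: "real n * \<tau> \<le> \<delta> * T" using n(1) \<tau>(1) by (simp add: field_simps)
    have n2: "\<delta> * T / (2 * \<tau>) \<le> real n" using n(2) \<delta>T \<tau>(1) by (simp add: field_simps)
    have win: "r * (\<sigma> / 2)\<^sup>2 \<le> 2 * q \<tau> (\<lambda>t. x (b + real j * \<tau> + t)) (\<lambda>t. v (b + real j * \<tau> + t))
        + K * (\<kappa> / T * \<sigma>)\<^sup>2" if j: "j < n" for j
    proof -
      have "(real j + 1) * \<tau> \<le> real n * \<tau>" using j \<tau>(1) by (intro mult_right_mono) auto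
      then have jt: "real j * \<tau> + \<tau> \<le> \<delta> * T" using n1 by (simp add: distrib_right)
      have j0: "0 \<le> real j * \<tau>" using \<tau> by simp
      have c: "cw \<tau> (\<lambda>t. f (b + real j * \<tau> + t)) (\<lambda>t. x (b + real j * \<tau> + t)) (\<lambda>t. v (b + real j * \<tau> + t))"
        by (rule cw_shift[OF w]) (use b j0 jt in auto)
      have "r * (norm (x (b + real j * \<tau> + 0), v (b + real j * \<tau> + 0)))\<^sup>2
         \<le> 2 * q \<tau> (\<lambda>t. x (b + real j * \<tau> + t)) (\<lambda>t. v (b + real j * \<tau> + t)) + K * (\<kappa> / T * \<sigma>)\<^sup>2"
        by (rule K(2)[OF c]) (use b j0 jt f in auto)
      moreover have "(\<sigma> / 2)\<^sup>2 \<le> (norm (x (b + real j * \<tau> + 0), v (b + real j * \<tau> + 0)))\<^sup>2"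
        by (intro power_mono half) (use j0 jt \<tau> \<sigma>0 in auto)
      then have "r * (\<sigma> / 2)\<^sup>2 \<le> r * (norm (x (b + real j * \<tau> + 0), v (b + real j * \<tau> + 0)))\<^sup>2"
        using r(1) by (intro mult_left_mono) auto
      ultimately show ?thesis by linarith
    qed
    have "real n * (r * (\<sigma> / 2)\<^sup>2) = (\<Sum>j<n. r * (\<sigma> / 2)\<^sup>2)" by simp
    also have "\<dots> \<le> (\<Sum>j<n. 2 * q \<tau> (\<lambda>t. x (b + real j * \<tau> + t)) (\<lambda>t. v (b + real j * \<tau> + t))
        + K * (\<kappa> / T * \<sigma>)\<^sup>2)"
      by (intro sum_mono win) simp
    also have "\<dots> = 2 * (\<Sum>j<n. q \<tau> (\<lambda>t. x (b + real j * \<tau> + t)) (\<lambda>t. v (b + real j * \<tau> + t)))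
        + real n * (K * (\<kappa> / T * \<sigma>)\<^sup>2)"
      by (simp add: sum.distrib sum_distrib_left)
    also have "\<dots> \<le> 2 * q T x v + real n * (K * (\<kappa> / T * \<sigma>)\<^sup>2)"
      using obs_fun_windows[OF q w Tp b(1) \<tau>(1), of n] n1 b(2) by simp
    finally have main: "real n * (r * (\<sigma> / 2)\<^sup>2) \<le> 2 * q T x v + real n * (K * (\<kappa> / T * \<sigma>)\<^sup>2)" .
    have "K * (\<kappa> / T * \<sigma>)\<^sup>2 \<le> r / 8 * \<sigma>\<^sup>2"
    proof -
      have "8 * K * \<kappa>\<^sup>2 \<le> r * T" using T1(3) r(1) by (simp add: field_simps)
      also have "\<dots> \<le> r * T\<^sup>2" using r(1) T1(1) by (simp add: power2_eq_square)
      finally have "K * \<kappa>\<^sup>2 / T\<^sup>2 \<le> r / 8" using Tp by (simp add: field_simps)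
      then have "K * \<kappa>\<^sup>2 / T\<^sup>2 * \<sigma>\<^sup>2 \<le> r / 8 * \<sigma>\<^sup>2" by (rule mult_right_mono) simp
      then show ?thesis by (simp add: power_mult_distrib power_divide)
    qed
    then have "real n * (K * (\<kappa> / T * \<sigma>)\<^sup>2) \<le> real n * (r / 8 * \<sigma>\<^sup>2)" by (rule mult_left_mono) simp
    moreover have "real n * (r * (\<sigma> / 2)\<^sup>2) = 2 * (real n * (r / 8 * \<sigma>\<^sup>2))"
      by (simp add: power2_eq_square)
    ultimately have m2: "real n * (r / 8 * \<sigma>\<^sup>2) \<le> 2 * q T x v" using main by linarith
    \<comment> \<open>At least \<open>\<delta> * T / (2 * \<tau>)\<close> windows, each worth
      \<open>r / 8 * \<sigma>^2\<close> after the source is absorbed: this is where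
      \<open>32 * \<tau> / (\<delta> * r)\<close> comes from.\<close>
    have "\<delta> * T / (2 * \<tau>) * (r / 8 * \<sigma>\<^sup>2) \<le> real n * (r / 8 * \<sigma>\<^sup>2)"
      by (rule mult_right_mono[OF n2]) (use r(1) in simp)
    then have "\<delta> * T / (2 * \<tau>) * (r / 8 * \<sigma>\<^sup>2) \<le> 2 * q T x v" using m2 by linarith
    then show "T * \<sigma>\<^sup>2 \<le> 32 * \<tau> / (\<delta> * r) * q T x v"
      using \<delta>(1) r(1) \<tau>(1) by (simp add: field_simps)
  qed
qed

section \<open>The two concrete observation functionals\<close>

definition qP :: "('h \<Rightarrow>\<^sub>L 'h) \<Rightarrow> real \<Rightarrow> (real \<Rightarrow> 'h) \<Rightarrow> (real \<Rightarrow> 'h) \<Rightarrow> real" where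
  "qP P T x v = (LINT t:{0..T}|lebesgue. (norm (P (v t)))\<^sup>2)"

text \<open>Defined from the truncations rather than as \<open>observed\<close>, since
  \<open>observed\<close> also takes the source as an argument; \<open>qB_lim\<close> shows that
  both agree on solutions.\<close>

definition qB :: "('h \<times> 'h \<Rightarrow> 'g::real_normed_vector) \<Rightarrow> real \<Rightarrow> (real \<Rightarrow> 'h) \<Rightarrow> (real \<Rightarrow> 'h) \<Rightarrow> real" where
  "qB B T x v = lim (\<lambda>k. BJ B k T x v)"

lemma qP_eq:
  assumes "cw T f x v" shows "qP P T x v = integral {0..T} (\<lambda>t. (norm (P (v t)))\<^sup>2)"
  unfolding qP_def by (intro LINT_continuous continuous_intros cwD(3)[OF assms])

lemma obs_fun_qP: "obs_fun (qP P)"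
  unfolding obs_fun_def
proof (intro conjI allI impI)
  fix T f x v b \<tau> and n :: nat
  assume w: "cw T f x v" and T: "0 < T" and b: "0 \<le> b" "0 < \<tau>" "b + real n * \<tau> \<le> T"
  have c: "continuous_on {0..T} (\<lambda>t. (norm (P (v t)))\<^sup>2)" by (intro continuous_intros cwD(3)[OF w])
  have "qP P \<tau> (\<lambda>t. x (b + real j * \<tau> + t)) (\<lambda>t. v (b + real j * \<tau> + t))
     = integral {0..\<tau>} (\<lambda>t. (norm (P (v (b + real j * \<tau> + t))))\<^sup>2)" if "j < n" for j
  proof (rule qP_eq[OF cw_shift[OF w]])
    have "(real j + 1) * \<tau> \<le> real n * \<tau>" using that b(2) by (intro mult_right_mono) auto
    then show "b + real j * \<tau> + \<tau> \<le> T" using b(3) by (simp add: distrib_right)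
  qed (use b in simp)
  then show "(\<Sum>j<n. qP P \<tau> (\<lambda>t. x (b + real j * \<tau> + t)) (\<lambda>t. v (b + real j * \<tau> + t))) \<le> qP P T x v"
    using integral_windows_le[OF c _ b] qP_eq[OF w] by simp
next
  fix T f x v g y u assume T: "0 < T" and w: "cw T f x v" and z: "cw T g y u"
  note d = cw_diff[OF w z]
  note cc = cwD(3)[OF w] cwD(3)[OF z]
  have "integral {0..T} (\<lambda>t. (norm (P (v t - u t)))\<^sup>2)
     \<le> integral {0..T} (\<lambda>t. 2 * (norm (P (v t)))\<^sup>2 + 2 * (norm (P (u t)))\<^sup>2)"
    unfolding blinfun.diff_right
    by (intro integral_le integrable_continuous_real continuous_intros cc norm_diff_sq_le)
  also have "\<dots> = 2 * integral {0..T} (\<lambda>t. (norm (P (v t)))\<^sup>2) + 2 * integral {0..T} (\<lambda>t. (norm (P (u t)))\<^sup>2)"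
    by (subst Henstock_Kurzweil_Integration.integral_add)
      (auto intro!: integrable_continuous_real continuous_intros cc)
  finally show "qP P T (\<lambda>t. x t - y t) (\<lambda>t. v t - u t) \<le> 2 * qP P T x v + 2 * qP P T y u"
    unfolding qP_eq[OF d] qP_eq[OF w] qP_eq[OF z] .
next
  fix T :: real assume T: "T > 0"
  show "\<exists>K\<ge>0. \<forall>f x v M L. cw T f x v \<longrightarrow> (\<forall>t\<in>{0..T}. norm (x t, v t) \<le> M) \<longrightarrow>
       (\<forall>t\<in>{0..T}. norm (f t) \<le> L) \<longrightarrow> qP P T x v \<le> K * (M\<^sup>2 + L\<^sup>2)"
  proof (intro exI[of _ "(norm P)\<^sup>2 * T"] conjI allI impI)
    fix f x v M L
    assume w: "cw T f x v" and M: "\<forall>t\<in>{0..T}. norm (x t, v t) \<le> M"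
    have M0: "0 \<le> M" using M T norm_ge_zero order_trans by (metis atLeastAtMost_iff less_imp_le order_refl)
    have "qP P T x v \<le> integral {0..T} (\<lambda>t. (norm P * M)\<^sup>2)"
      unfolding qP_eq[OF w]
    proof (rule integral_le)
      show "(\<lambda>t. (norm (P (v t)))\<^sup>2) integrable_on {0..T}"
        by (intro integrable_continuous_real continuous_intros cwD(3)[OF w])
      show "(norm (P (v t)))\<^sup>2 \<le> (norm P * M)\<^sup>2" if "t \<in> {0..T}" for t
      proof (rule power_mono)
        have "norm (v t) \<le> M" using M that norm_snd_le[of "v t" "x t"] by force
        then have "norm P * norm (v t) \<le> norm P * M" by (intro mult_left_mono) auto
        then show "norm (P (v t)) \<le> norm P * M" using norm_blinfun[of P "v t"] by linarith
      qed simp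
    qed (intro integrable_continuous_real continuous_intros)
    also have "\<dots> = (norm P)\<^sup>2 * T * M\<^sup>2" using T by (simp add: power_mult_distrib)
    also have "\<dots> \<le> (norm P)\<^sup>2 * T * (M\<^sup>2 + L\<^sup>2)" using T by (intro mult_left_mono) auto
    finally show "qP P T x v \<le> (norm P)\<^sup>2 * T * (M\<^sup>2 + L\<^sup>2)" .
  qed (use T in simp)
qed

lemma qB_lim:
  fixes B :: "'h \<times> 'h \<Rightarrow> 'g::{real_inner,complete_space}"
  assumes "admissible A G B" "T > 0" "cw T f x v"
  shows "(\<lambda>k. BJ B k T x v) \<longlonglongrightarrow> qB B T x v" "qB B T x v = observed A B T f (\<lambda>t. R (x t)) v"
  using BJ_tendsto_observed[OF assms] limI unfolding qB_def by metis+

lemma BJ_continuous: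
  assumes "admissible A G B" "cw T f x v"
  shows "continuous_on {0..T} (\<lambda>t. (norm (B (R (J k (x t)), J k (v t))))\<^sup>2)"
proof -
  have op: "observation_op A G B" using assms unfolding admissible_def by blast
  show ?thesis by (intro continuous_intros observation_continuous[OF op regular_J[OF assms(2)]])
qed

lemma BJ_eq:
  assumes "admissible A G B" "cw T f x v"
  shows "BJ B k T x v = integral {0..T} (\<lambda>t. (norm (B (R (J k (x t)), J k (v t))))\<^sup>2)"
  unfolding BJ_def by (rule LINT_continuous[OF BJ_continuous[OF assms]])

text \<open>Each property holds for the truncated observations, which are integrals of continuous
  functions, with constants independent of the truncation, and survives the limit. The bound is the
  admissibility inequality, whose right-hand side is at most \<open>(1 + T) * (M^2 + L^2)\<close> up
  to the factor \<open>D\<close>.\<close>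

lemma obs_fun_qB:
  fixes B :: "'h \<times> 'h \<Rightarrow> 'g::{real_inner,complete_space}"
  assumes B: "admissible A G B"
  shows "obs_fun (qB B)"
  unfolding obs_fun_def
proof (intro conjI allI impI)
  fix T f x v b \<tau> and n :: nat
  assume w: "cw T f x v" and T: "0 < T" and b: "0 \<le> b" "0 < \<tau>" "b + real n * \<tau> \<le> T"
  have s: "cw \<tau> (\<lambda>t. f (b + real j * \<tau> + t)) (\<lambda>t. x (b + real j * \<tau> + t)) (\<lambda>t. v (b + real j * \<tau> + t))"
    if "j < n" for j
  proof (rule cw_shift[OF w])
    have "(real j + 1) * \<tau> \<le> real n * \<tau>" using that b(2) by (intro mult_right_mono) auto
    then show "b + real j * \<tau> + \<tau> \<le> T" using b(3) by (simp add: distrib_right)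
  qed (use b in simp)
  show "(\<Sum>j<n. qB B \<tau> (\<lambda>t. x (b + real j * \<tau> + t)) (\<lambda>t. v (b + real j * \<tau> + t))) \<le> qB B T x v"
  proof (rule LIMSEQ_le[OF tendsto_sum qB_lim(1)[OF B T w]])
    show "(\<lambda>k. BJ B k \<tau> (\<lambda>t. x (b + real j * \<tau> + t)) (\<lambda>t. v (b + real j * \<tau> + t)))
       \<longlonglongrightarrow> qB B \<tau> (\<lambda>t. x (b + real j * \<tau> + t)) (\<lambda>t. v (b + real j * \<tau> + t))" if "j \<in> {..<n}" for j
      by (rule qB_lim(1)[OF B b(2) s]) (use that in simp)
    have "(\<Sum>j<n. BJ B k \<tau> (\<lambda>t. x (b + real j * \<tau> + t)) (\<lambda>t. v (b + real j * \<tau> + t))) \<le> BJ B k T x v" for k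
      using integral_windows_le[OF BJ_continuous[OF B w, of k] _ b] BJ_eq[OF B s, of _ k] BJ_eq[OF B w, of k] by simp
    then show "\<exists>N. \<forall>k\<ge>N. (\<Sum>j<n. BJ B k \<tau> (\<lambda>t. x (b + real j * \<tau> + t)) (\<lambda>t. v (b + real j * \<tau> + t))) \<le> BJ B k T x v"
      by blast
  qed
next
  fix T f x v g y u assume T: "0 < T" and w: "cw T f x v" and z: "cw T g y u"
  note d = cw_diff[OF w z]
  have op: "observation_op A G B" using B unfolding admissible_def by blast
  have k: "BJ B k T (\<lambda>t. x t - y t) (\<lambda>t. v t - u t) \<le> 2 * BJ B k T x v + 2 * BJ B k T y u" for k
  proof -
    let ?p = "\<lambda>t. B (R (J k (x t)), J k (v t))" and ?q = "\<lambda>t. B (R (J k (y t)), J k (u t))"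
    note cc = BJ_continuous[OF B w, of k] BJ_continuous[OF B z, of k]
    have H: "(R (J k p), q) \<in> Hsp A 2 \<times> UNIV" for p q
      using R_N[of k p] unfolding Hsp_eq by (simp add: eval_nat_numeral) (metis rangeI)
    have eq: "B (R (J k (x t - y t)), J k (v t - u t)) = ?p t - ?q t" for t
      using observation_diff[OF op H H] by (simp add: R.diff J.diff)
    have "BJ B k T (\<lambda>t. x t - y t) (\<lambda>t. v t - u t) \<le> integral {0..T} (\<lambda>t. 2 * (norm (?p t))\<^sup>2 + 2 * (norm (?q t))\<^sup>2)"
      unfolding BJ_eq[OF B d]
    proof (rule integral_le)
      show "(\<lambda>t. (norm (B (R (J k (x t - y t)), J k (v t - u t))))\<^sup>2) integrable_on {0..T}"
        by (intro integrable_continuous_real BJ_continuous[OF B d])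
      show "(\<lambda>t. 2 * (norm (?p t))\<^sup>2 + 2 * (norm (?q t))\<^sup>2) integrable_on {0..T}"
        by (intro integrable_continuous_real continuous_on_add continuous_on_mult continuous_on_const cc)
    qed (unfold eq, rule norm_diff_sq_le)
    also have "\<dots> = 2 * integral {0..T} (\<lambda>t. (norm (?p t))\<^sup>2) + 2 * integral {0..T} (\<lambda>t. (norm (?q t))\<^sup>2)"
      by (subst Henstock_Kurzweil_Integration.integral_add)
        (auto intro!: integrable_continuous_real continuous_on_mult continuous_on_const cc)
    finally show ?thesis unfolding BJ_eq[OF B w] BJ_eq[OF B z] .
  qed
  show "qB B T (\<lambda>t. x t - y t) (\<lambda>t. v t - u t) \<le> 2 * qB B T x v + 2 * qB B T y u"
    by (rule LIMSEQ_le[OF qB_lim(1)[OF B T d] tendsto_add[OF tendsto_mult[OF tendsto_const qB_lim(1)[OF B T w]]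
          tendsto_mult[OF tendsto_const qB_lim(1)[OF B T z]]]]) (use k in blast)
next
  fix T :: real assume T: "T > 0"
  obtain D where D: "D > 0" "\<And>f w v. regular_sol A T f w v \<Longrightarrow>
     (LINT t:{0..T}|lebesgue. (norm (B (w t, v t)))\<^sup>2) \<le> D * adm_bound A T f w v"
    using B T unfolding admissible_def by blast
  show "\<exists>K\<ge>0. \<forall>f x v M L. cw T f x v \<longrightarrow> (\<forall>t\<in>{0..T}. norm (x t, v t) \<le> M) \<longrightarrow>
       (\<forall>t\<in>{0..T}. norm (f t) \<le> L) \<longrightarrow> qB B T x v \<le> K * (M\<^sup>2 + L\<^sup>2)"
  proof (intro exI[of _ "D * (1 + T)"] conjI allI impI)
    show "0 \<le> D * (1 + T)" using D(1) T by simp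
    fix f x v M L
    assume w: "cw T f x v" and M: "\<forall>t\<in>{0..T}. norm (x t, v t) \<le> M" and L: "\<forall>t\<in>{0..T}. norm (f t) \<le> L"
    have "BJ B k T x v \<le> D * (1 + T) * (M\<^sup>2 + L\<^sup>2)" for k
    proof -
      define e where "e t = 1/2 * (norm (J k (x t), J k (v t)))\<^sup>2" for t
      have ec: "continuous_on {0..T} e" unfolding e_def
        by (intro continuous_intros J.continuous_on cwD[OF w])
      have eM: "e t \<le> 1/2 * M\<^sup>2" if t: "t \<in> {0..T}" for t
      proof -
        have "(norm (J k (x t), J k (v t)))\<^sup>2 \<le> (norm (x t, v t))\<^sup>2"
          by (simp add: norm_Pair add_mono power_mono norm_J)
        also have "\<dots> \<le> M\<^sup>2" using M t by (intro power_mono) auto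
        finally show ?thesis by (simp add: e_def)
      qed
      have "integral {0..T} e \<le> integral {0..T} (\<lambda>t. 1/2 * M\<^sup>2)"
        by (intro integral_le integrable_continuous_real ec continuous_intros eM)
      then have 1: "integral {0..T} e \<le> T * (1/2 * M\<^sup>2)" using T by simp
      have fc: "continuous_on {0..T} (\<lambda>t. (norm (J k (f t)))\<^sup>2)"
        by (intro continuous_intros J.continuous_on cwD[OF w])
      have "integral {0..T} (\<lambda>t. (norm (J k (f t)))\<^sup>2) \<le> integral {0..T} (\<lambda>t. L\<^sup>2)"
      proof (rule integral_le)
        show "(norm (J k (f t)))\<^sup>2 \<le> L\<^sup>2" if "t \<in> {0..T}" for t
          using L that norm_J[of k "f t"] by (intro power_mono) (auto intro: order_trans)
      qed (intro integrable_continuous_real fc continuous_intros)+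
      then have 2: "(LINT t:{0..T}|lebesgue. (norm (J k (f t)))\<^sup>2) \<le> T * L\<^sup>2"
        using LINT_continuous[OF fc] T by simp
      have en: "energy A 1 (R (J k (x t))) (J k (v t)) = e t" for t using energy1 by (simp add: e_def)
      have "adm_bound A T (\<lambda>t. J k (f t)) (\<lambda>t. R (J k (x t))) (\<lambda>t. J k (v t))
         = e 0 + e T + integral {0..T} e + (LINT t:{0..T}|lebesgue. (norm (J k (f t)))\<^sup>2)"
        by (rule adm_bound_eq[OF less_imp_le[OF T] en ec])
      also have "\<dots> \<le> 1/2 * M\<^sup>2 + 1/2 * M\<^sup>2 + T * (1/2 * M\<^sup>2) + T * L\<^sup>2"
        using eM[of 0] eM[of T] T by (intro add_mono 1 2) auto
      also have "\<dots> \<le> (1 + T) * (M\<^sup>2 + L\<^sup>2)" using T by (simp add: distrib_right distrib_left)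
      finally have "adm_bound A T (\<lambda>t. J k (f t)) (\<lambda>t. R (J k (x t))) (\<lambda>t. J k (v t)) \<le> (1 + T) * (M\<^sup>2 + L\<^sup>2)" .
      then have "D * adm_bound A T (\<lambda>t. J k (f t)) (\<lambda>t. R (J k (x t))) (\<lambda>t. J k (v t)) \<le> D * ((1 + T) * (M\<^sup>2 + L\<^sup>2))"
        using D(1) by (intro mult_left_mono) auto
      then show ?thesis using D(2)[OF regular_J[OF w, of k]] unfolding BJ_def by (simp add: mult.assoc)
    qed
    then show "qB B T x v \<le> D * (1 + T) * (M\<^sup>2 + L\<^sup>2)"
      by (intro LIMSEQ_le_const2[OF qB_lim(1)[OF B T w]]) blast
  qed
qed

lemma free_observable_qB:
  fixes B :: "'h \<times> 'h \<Rightarrow> 'g::{real_inner,complete_space}"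
  assumes B: "admissible A G B" and obs: "observable A B"
  shows "free_observable (qB B)"
proof -
  obtain T0 where T0: "T0 > 0" "\<And>T. T > T0 \<Longrightarrow> \<exists>r>0. \<forall>w v. wave_sol A T (\<lambda>t. 0) w v \<longrightarrow>
      observed A B T (\<lambda>t. 0) w v \<ge> r * energy A 1 (w 0) (v 0)" using obs unfolding observable_def by blast
  show ?thesis unfolding free_observable_def
  proof (rule exI[of _ T0], intro conjI T0(1) allI impI)
    fix T assume T: "T > T0"
    obtain r where r: "r > 0" "\<And>w v. wave_sol A T (\<lambda>t. 0) w v \<Longrightarrow>
      observed A B T (\<lambda>t. 0) w v \<ge> r * energy A 1 (w 0) (v 0)" using T0(2)[OF T] by blast
    show "\<exists>r>0. \<forall>x v. cw T (\<lambda>t. 0) x v \<longrightarrow> r * (norm (x 0, v 0))\<^sup>2 \<le> qB B T x v"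
    proof (intro exI[of _ "r/2"] conjI allI impI)
      fix x v assume w: "cw T (\<lambda>t. 0) x v"
      show "r/2 * (norm (x 0, v 0))\<^sup>2 \<le> qB B T x v"
        using r(2)[OF cw_imp_wave_sol[OF w]] qB_lim(2)[OF B _ w] T T0(1) energy1[of "x 0" "v 0"] by simp
    qed (use r in simp)
  qed
qed

lemma free_observable_qP:
  fixes P :: "'h \<Rightarrow>\<^sub>L 'h"
  assumes "\<exists>T0>0. \<forall>T>T0. \<exists>\<gamma>>0. \<forall>w v. wave_sol A T (\<lambda>t. 0) w v \<longrightarrow>
        (LINT t:{0..T}|lebesgue. (norm (P (v t)))\<^sup>2) \<ge> \<gamma> * energy A 1 (w 0) (v 0)"
  shows "free_observable (qP P)"
proof -
  obtain T0 where T0: "T0 > 0" "\<And>T. T > T0 \<Longrightarrow> \<exists>r>0. \<forall>w v. wave_sol A T (\<lambda>t. 0) w v \<longrightarrow>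
      (LINT t:{0..T}|lebesgue. (norm (P (v t)))\<^sup>2) \<ge> r * energy A 1 (w 0) (v 0)" using assms by blast
  show ?thesis unfolding free_observable_def
  proof (rule exI[of _ T0], intro conjI T0(1) allI impI)
    fix T assume T: "T > T0"
    obtain r where r: "r > 0" "\<And>w v. wave_sol A T (\<lambda>t. 0) w v \<Longrightarrow>
      (LINT t:{0..T}|lebesgue. (norm (P (v t)))\<^sup>2) \<ge> r * energy A 1 (w 0) (v 0)" using T0(2)[OF T] by blast
    show "\<exists>r>0. \<forall>x v. cw T (\<lambda>t. 0) x v \<longrightarrow> r * (norm (x 0, v 0))\<^sup>2 \<le> qP P T x v"
    proof (intro exI[of _ "r/2"] conjI allI impI)
      fix x v assume w: "cw T (\<lambda>t. 0) x v"
      show "r/2 * (norm (x 0, v 0))\<^sup>2 \<le> qP P T x v"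
        using r(2)[OF cw_imp_wave_sol[OF w]] energy1[of "x 0" "v 0"] unfolding qP_def by simp
    qed (use r in simp)
  qed
qed

end

subsection \<open>Cascades and their primitives in time\<close>

text \<open>\<open>CB\<close> expresses boundedness of \<open>C (Suc j) j\<close> on
  \<open>H_{-k}\<close>; the range \<open>k \<le> n - j\<close> is that of the coupling hypothesis
  for \<open>i = Suc j\<close>. A single \<open>M\<close> serves all couplings and orders.\<close>

locale cascade = wave E a c A D
  for E :: "'h::{real_inner,complete_space} set" and a c A D +
  fixes n :: nat and C :: "nat \<Rightarrow> nat \<Rightarrow> 'h \<Rightarrow>\<^sub>L 'h" and M :: real
  assumes M0: "M \<ge> 0"
    and CB: "1 \<le> j \<Longrightarrow> j < n \<Longrightarrow> k \<le> n - j \<Longrightarrow>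
      norm ((R ^^ k) (C (Suc j) j x)) \<le> M * norm ((R ^^ k) x)"
begin

sublocale Rp: bounded_linear "R ^^ k" for k by (rule R_pow_bl)

text \<open>The square root of twice the energy of order \<open>1 - k\<close> of the component
  \<open>i\<close>.\<close>

definition rn :: "nat \<Rightarrow> (nat \<Rightarrow> real \<Rightarrow> 'h) \<times> (nat \<Rightarrow> real \<Rightarrow> 'h) \<Rightarrow> nat \<Rightarrow> real \<Rightarrow> real" where
  "rn k p i t = norm ((R ^^ k) (fst p i t), (R ^^ k) (snd p i t))"

text \<open>A state is a pair of the families \<open>A\<^sup>1\<^sup>/\<^sup>2 u\<^sub>i\<close> and \<open>u\<^sub>i'\<close>, with the convention \<open>u\<^sub>0 = 0\<close>.\<close>

definition casc :: "real \<Rightarrow> (nat \<Rightarrow> real \<Rightarrow> 'h) \<times> (nat \<Rightarrow> real \<Rightarrow> 'h) \<Rightarrow> bool" where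
  "casc T p \<longleftrightarrow> (\<forall>t. fst p 0 t = 0) \<and>
     (\<forall>j<n. cw T (\<lambda>t. - C (Suc j) j (R (fst p j t))) (fst p (Suc j)) (snd p (Suc j)))"

text \<open>\<open>lift\<close> is the inverse of time differentiation on solutions of the cascade: the new
  displacements \<open>z\<^sub>i\<close> satisfy \<open>z\<^sub>i' = u\<^sub>i\<close> and \<open>A z\<^sub>i = - u\<^sub>i' - C z\<^sub>i\<^sub>-\<^sub>1\<close>.\<close>

primrec lx :: "(nat \<Rightarrow> real \<Rightarrow> 'h) \<Rightarrow> nat \<Rightarrow> real \<Rightarrow> 'h" where
  "lx v 0 = (\<lambda>t. 0)"
| "lx v (Suc j) = (\<lambda>t. - R (v (Suc j) t) - R (C (Suc j) j (R (lx v j t))))"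

definition lift :: "(nat \<Rightarrow> real \<Rightarrow> 'h) \<times> (nat \<Rightarrow> real \<Rightarrow> 'h) \<Rightarrow> (nat \<Rightarrow> real \<Rightarrow> 'h) \<times> (nat \<Rightarrow> real \<Rightarrow> 'h)" where
  "lift p = (lx (snd p), \<lambda>i t. R (fst p i t))"

text \<open>For the new displacements and velocities, the equation of second order is the defining
  formula of \<open>lx\<close> combined with \<open>(R x)' = v\<close>. Only the relation between
  displacement and velocity needs an induction along the chain, in which the coupling terms
  cancel.\<close>

lemma casc_lift:
  assumes p: "casc T p"
  shows "casc T (lift p)"
proof -
  obtain x v where xv: "p = (x, v)" by (cases p)
  have x0: "x 0 t = 0" for t using p unfolding casc_def xv by simp
  have w: "cw T (\<lambda>t. - C (Suc j) j (R (x j t))) (x (Suc j)) (v (Suc j))" if "j < n" for j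
    using p that unfolding casc_def xv by simp
  have CR: "bounded_linear (\<lambda>z. R (C i j z))" for i j
    by (rule bounded_linear_compose[OF R_bl blinfun.bounded_linear_right])
  have main: "continuous_on {0..T} (lx v j) \<and>
      (\<forall>t\<in>{0..T}. ((\<lambda>t. R (lx v j t)) has_vector_derivative R (x j t)) (at t within {0..T}))" if "j \<le> n" for j
    using that
  proof (induction j)
    case 0
    show ?case by (simp add: R.zero x0)
  next
    case (Suc j)
    then have j: "j < n" and c: "continuous_on {0..T} (lx v j)"
      and d: "\<And>t. t \<in> {0..T} \<Longrightarrow> ((\<lambda>t. R (lx v j t)) has_vector_derivative R (x j t)) (at t within {0..T})" by auto
    note cw = cwD[OF w[OF j]]
    show ?case
    proof (intro conjI ballI)
      show "continuous_on {0..T} (lx v (Suc j))"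
        unfolding lx.simps by (intro continuous_intros bounded_linear.continuous_on[OF CR] R.continuous_on c cw)
      fix t assume t: "t \<in> {0..T}"
      have "((\<lambda>t. - R (R (v (Suc j) t)) - R (R (C (Suc j) j (R (lx v j t))))) has_vector_derivative
         - R (R (- C (Suc j) j (R (x j t))) - x (Suc j) t) - R (R (C (Suc j) j (R (x j t))))) (at t within {0..T})"
        by (intro has_vector_derivative_diff has_vector_derivative_minus
            bounded_linear.has_vector_derivative[OF R_bl] bounded_linear.has_vector_derivative[OF CR] cw(5) d t)
      then show "((\<lambda>t. R (lx v (Suc j) t)) has_vector_derivative R (x (Suc j) t)) (at t within {0..T})"
        by (simp add: R.diff R.neg)
    qed
  qed
  have "cw T (\<lambda>t. - C (Suc j) j (R (lx v j t))) (lx v (Suc j)) (\<lambda>t. R (x (Suc j) t))" if j: "j < n" for j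
    unfolding cw_def
  proof (intro conjI ballI)
    note cw = cwD[OF w[OF j]]
    show "continuous_on {0..T} (\<lambda>t. - C (Suc j) j (R (lx v j t)))"
      using main[of j] j by (intro continuous_intros R.continuous_on) auto
    show "continuous_on {0..T} (lx v (Suc j))" using main[of "Suc j"] j by simp
    show "continuous_on {0..T} (\<lambda>t. R (x (Suc j) t))" by (intro R.continuous_on cw)
    fix t assume t: "t \<in> {0..T}"
    show "((\<lambda>t. R (lx v (Suc j) t)) has_vector_derivative R (x (Suc j) t)) (at t within {0..T})"
      using main[of "Suc j"] j t by simp
    show "((\<lambda>t. R (R (x (Suc j) t))) has_vector_derivative R (- C (Suc j) j (R (lx v j t))) - lx v (Suc j) t) (at t within {0..T})"
      using bounded_linear.has_vector_derivative[OF R_bl cw(4)[OF t]] by (simp add: R.neg)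
  qed
  then show ?thesis unfolding casc_def lift_def xv by simp
qed

lemma casc_lift_pow: "casc T p \<Longrightarrow> casc T ((lift ^^ m) p)"
  by (induction m) (simp_all add: casc_lift)

lemma cascD: "casc T p \<Longrightarrow> j < n \<Longrightarrow> cw T (\<lambda>t. - C (Suc j) j (R (fst p j t))) (fst p (Suc j)) (snd p (Suc j))"
  unfolding casc_def by blast

lemma rn_nonneg: "0 \<le> rn k p i t"
  unfolding rn_def by simp

lemma norm_fst_le_rn: "norm ((R ^^ k) (fst p i t)) \<le> rn k p i t"
  unfolding rn_def by (rule norm_fst_le)

lemma norm_snd_le_rn: "norm ((R ^^ k) (snd p i t)) \<le> rn k p i t"
  unfolding rn_def by (rule norm_snd_le)

text \<open>Energy norm of the component \<open>i\<close> after its \<open>n - i\<close> primitives;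
  the top component is not lifted. The supremum of \<open>NN p i\<close> over time is
  \<open>\<sigma>_i\<close> up to the factor \<open>sqrt 2\<close>.\<close>

definition NN :: "(nat \<Rightarrow> real \<Rightarrow> 'h) \<times> (nat \<Rightarrow> real \<Rightarrow> 'h) \<Rightarrow> nat \<Rightarrow> real \<Rightarrow> real" where
  "NN p i t = rn 0 ((lift ^^ (n - i)) p) i t"

lemma NN_nonneg: "0 \<le> NN p i t"
  unfolding NN_def by (rule rn_nonneg)

text \<open>One missing primitive is paid for by one power of \<open>R\<close>: up to a sign and
  exchange of the two entries, \<open>R\<close> applied to a component is its lift, except for the
  coupling with the component below, which \<open>CB\<close> controls at order
  \<open>Suc k\<close>.\<close>

lemma rn_lift_le:
  assumes "k < n - j" "j < n"
  shows "rn (Suc k) p (Suc j) t \<le> rn k (lift p) (Suc j) t + M * (1 / c) * (if j = 0 then 0 else rn (Suc k) (lift p) j t)"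
proof -
  let ?y = "fst (lift p)" and ?u = "snd (lift p)"
  have u: "R (fst p (Suc j) t) = ?u (Suc j) t" unfolding lift_def by simp
  have v: "R (snd p (Suc j) t) = - ?y (Suc j) t - R (C (Suc j) j (R (?y j t)))" unfolding lift_def by simp
  have e1: "(R ^^ Suc k) (fst p (Suc j) t) = (R ^^ k) (?u (Suc j) t)"
    by (simp add: funpow_swap1 u)
  have e2: "(R ^^ Suc k) (snd p (Suc j) t) = - (R ^^ k) (?y (Suc j) t) - (R ^^ Suc k) (C (Suc j) j (R (?y j t)))"
    by (simp add: funpow_swap1 v Rp.diff Rp.neg)
  let ?z = "(R ^^ Suc k) (C (Suc j) j (R (?y j t)))"
  have "rn (Suc k) p (Suc j) t = norm (((R ^^ k) (?u (Suc j) t), - (R ^^ k) (?y (Suc j) t)) - (0, ?z))"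
    unfolding rn_def e1 e2 by simp
  also have "\<dots> \<le> norm ((R ^^ k) (?u (Suc j) t), - (R ^^ k) (?y (Suc j) t)) + norm (0::'h, ?z)"
    by (rule norm_triangle_ineq4)
  also have "norm ((R ^^ k) (?u (Suc j) t), - (R ^^ k) (?y (Suc j) t)) = rn k (lift p) (Suc j) t"
    unfolding rn_def by (simp add: norm_Pair add.commute)
  also have "norm (0::'h, ?z) = norm ?z" by (simp add: norm_Pair)
  also have "norm ?z \<le> M * (1 / c) * (if j = 0 then 0 else rn (Suc k) (lift p) j t)"
  proof (cases "j = 0")
    case True
    then have "?y j t = 0" unfolding lift_def by simp
    then show ?thesis using True by (simp add: R.zero Rp.zero)
  next
    case False
    have "norm ?z \<le> M * norm ((R ^^ Suc k) (R (?y j t)))"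
      by (rule CB) (use False assms in auto)
    also have "(R ^^ Suc k) (R (?y j t)) = R ((R ^^ Suc k) (?y j t))" by (simp add: funpow_swap1)
    also have "M * norm (R ((R ^^ Suc k) (?y j t))) \<le> M * ((1 / c) * rn (Suc k) (lift p) j t)"
    proof (rule mult_left_mono[OF _ M0])
      have "norm (R ((R ^^ Suc k) (?y j t))) \<le> (1 / c) * norm ((R ^^ Suc k) (?y j t))" by (rule norm_R)
      also have "\<dots> \<le> (1 / c) * rn (Suc k) (lift p) j t"
        using c_pos by (intro mult_left_mono norm_fst_le_rn) simp
      finally show "norm (R ((R ^^ Suc k) (?y j t))) \<le> (1 / c) * rn (Suc k) (lift p) j t" .
    qed
    finally show ?thesis using False by (simp add: mult.assoc)
  qed
  finally show ?thesis by simp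
qed

text \<open>\<open>rn_lift_le\<close> is iterated until all \<open>n - i\<close> primitives are
  present. Its correction term concerns the component \<open>j\<close> of the lifted state at order
  \<open>Suc k\<close>, where the number of primitives plus the order is again the full count
  \<open>n - j\<close>, so the induction hypothesis for the lower component applies.\<close>

lemma rn_le_natural_ex:
  "i \<le> n \<Longrightarrow> 1 \<le> i \<Longrightarrow> k \<le> n - i \<Longrightarrow>
    \<exists>K\<ge>0. \<forall>p t. rn k ((lift ^^ (n - i - k)) p) i t \<le> K * (\<Sum>j=1..i. NN p j t)"
proof (induction i arbitrary: k)
  case (Suc j)
  note IH = Suc.IH and pr = Suc.prems(1)
  from Suc.prems(3) show ?case
  proof (induction k)
    case 0
    have "rn 0 ((lift ^^ (n - Suc j - 0)) p) (Suc j) t \<le> 1 * (\<Sum>j=1..Suc j. NN p j t)" for p t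
      using member_le_sum[of "Suc j" "{1..Suc j}" "\<lambda>j. NN p j t"] NN_nonneg by (simp add: NN_def)
    then show ?case by (intro exI[of _ 1]) simp
  next
    case (Suc k)
    then obtain K1 where K1: "K1 \<ge> 0"
      "\<And>p t. rn k ((lift ^^ (n - Suc j - k)) p) (Suc j) t \<le> K1 * (\<Sum>j=1..Suc j. NN p j t)" by auto
    have kj: "k < n - j" "j < n" using Suc.prems pr by auto
    have L: "lift ((lift ^^ (n - Suc j - Suc k)) p) = (lift ^^ (n - Suc j - k)) p" for p
    proof -
      have "n - Suc j - k = Suc (n - Suc j - Suc k)" using Suc.prems by simp
      then show ?thesis by simp
    qed
    obtain K2 where K2: "K2 \<ge> 0"
      "\<And>p t. (if j = 0 then 0 else rn (Suc k) ((lift ^^ (n - Suc j - k)) p) j t) \<le> K2 * (\<Sum>j=1..Suc j. NN p j t)"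
    proof (cases "j = 0")
      case True
      then show ?thesis using that[of 0] by simp
    next
      case False
      have "\<exists>K\<ge>0. \<forall>p t. rn (Suc k) ((lift ^^ (n - j - Suc k)) p) j t \<le> K * (\<Sum>j=1..j. NN p j t)"
        by (rule IH) (use False kj Suc.prems in auto)
      then obtain K where K: "K \<ge> 0"
        "\<And>p t. rn (Suc k) ((lift ^^ (n - j - Suc k)) p) j t \<le> K * (\<Sum>j=1..j. NN p j t)" by blast
      have "rn (Suc k) ((lift ^^ (n - Suc j - k)) p) j t \<le> K * (\<Sum>j=1..Suc j. NN p j t)" for p t
      proof -
        have "rn (Suc k) ((lift ^^ (n - Suc j - k)) p) j t \<le> K * (\<Sum>j=1..j. NN p j t)"
          using K(2)[of p t] by simp
        also have "\<dots> \<le> K * (\<Sum>j=1..Suc j. NN p j t)"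
          using K(1) NN_nonneg by (intro mult_left_mono) auto
        finally show ?thesis .
      qed
      then show ?thesis using that[of K] K(1) False by simp
    qed
    show ?case
    proof (intro exI[of _ "K1 + M * (1 / c) * K2"] conjI allI)
      show "0 \<le> K1 + M * (1 / c) * K2" using K1(1) K2(1) M0 c_pos by simp
      fix p t
      have "rn (Suc k) ((lift ^^ (n - Suc j - Suc k)) p) (Suc j) t
         \<le> rn k ((lift ^^ (n - Suc j - k)) p) (Suc j) t
           + M * (1 / c) * (if j = 0 then 0 else rn (Suc k) ((lift ^^ (n - Suc j - k)) p) j t)"
        using rn_lift_le[OF kj, of "(lift ^^ (n - Suc j - Suc k)) p" t] unfolding L .
      also have "\<dots> \<le> K1 * (\<Sum>j=1..Suc j. NN p j t) + M * (1 / c) * (K2 * (\<Sum>j=1..Suc j. NN p j t))"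
        using M0 c_pos by (intro add_mono mult_left_mono K1 K2) simp
      finally show "rn (Suc k) ((lift ^^ (n - Suc j - Suc k)) p) (Suc j) t
         \<le> (K1 + M * (1 / c) * K2) * (\<Sum>j=1..Suc j. NN p j t)" by (simp add: distrib_right mult.assoc)
    qed
  qed
qed simp

lemma rn_le_natural:
  obtains K where "K \<ge> 0"
    "\<And>i k m p t. 1 \<le> i \<Longrightarrow> i \<le> n \<Longrightarrow> m + k = n - i \<Longrightarrow>
       rn k ((lift ^^ m) p) i t \<le> K * (\<Sum>j=1..i. NN p j t)"
proof -
  have "\<forall>i k. \<exists>K. i \<le> n \<longrightarrow> 1 \<le> i \<longrightarrow> k \<le> n - i \<longrightarrow> K \<ge> 0 \<and>
     (\<forall>p t. rn k ((lift ^^ (n - i - k)) p) i t \<le> K * (\<Sum>j=1..i. NN p j t))"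
    using rn_le_natural_ex by blast
  then obtain K where K: "\<And>i k. i \<le> n \<Longrightarrow> 1 \<le> i \<Longrightarrow> k \<le> n - i \<Longrightarrow> K i k \<ge> 0 \<and>
     (\<forall>p t. rn k ((lift ^^ (n - i - k)) p) i t \<le> K i k * (\<Sum>j=1..i. NN p j t))" by metis
  show thesis
  proof (rule that[of "\<Sum>i\<le>n. \<Sum>k\<le>n. \<bar>K i k\<bar>"])
    show "0 \<le> (\<Sum>i\<le>n. \<Sum>k\<le>n. \<bar>K i k\<bar>)" by (intro sum_nonneg) simp
    fix i k m p t assume i: "1 \<le> i" "i \<le> n" "m + k = n - i"
    have m: "m = n - i - k" "k \<le> n - i" using i(3) by auto
    have "rn k ((lift ^^ m) p) i t \<le> K i k * (\<Sum>j=1..i. NN p j t)"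
      unfolding m(1) using K[OF i(2,1) m(2)] by blast
    also have "\<dots> \<le> (\<Sum>i\<le>n. \<Sum>k\<le>n. \<bar>K i k\<bar>) * (\<Sum>j=1..i. NN p j t)"
    proof (rule mult_right_mono)
      have "\<bar>K i k\<bar> \<le> (\<Sum>k\<le>n. \<bar>K i k\<bar>)" by (rule member_le_sum) (use i in auto)
      also have "\<dots> \<le> (\<Sum>i\<le>n. \<Sum>k\<le>n. \<bar>K i k\<bar>)"
        by (rule member_le_sum[of i _ "\<lambda>i. \<Sum>k\<le>n. \<bar>K i k\<bar>"]) (use i in \<open>auto intro: sum_nonneg\<close>)
      finally show "K i k \<le> (\<Sum>i\<le>n. \<Sum>k\<le>n. \<bar>K i k\<bar>)" by simp
      show "0 \<le> (\<Sum>j=1..i. NN p j t)" by (intro sum_nonneg NN_nonneg)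
    qed
    finally show "rn k ((lift ^^ m) p) i t \<le> (\<Sum>i\<le>n. \<Sum>k\<le>n. \<bar>K i k\<bar>) * (\<Sum>j=1..i. NN p j t)" .
  qed
qed

text \<open>The displacement \<open>R x\<close> in the source is one order smoother than
  \<open>x\<close>: the source of the next component at order \<open>k\<close> is controlled by the
  previous component at order \<open>Suc k\<close>. This is why the weights \<open>n - i\<close>
  decrease by one along the chain. The constant may depend on \<open>T\<close> here.\<close>

lemma rn_growth_ex:
  assumes T: "T \<ge> 0"
  shows "j < n \<Longrightarrow> \<exists>K\<ge>0. \<forall>p t. casc T p \<longrightarrow> t \<in> {0..T} \<longrightarrow>
    rn (n - Suc j) p (Suc j) t \<le> K * (\<Sum>i=1..Suc j. rn (n - i) p i 0)"
proof (induction j)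
  case 0
  show ?case
  proof (intro exI[of _ 1] conjI allI impI)
    fix p t assume p: "casc T p" and t: "t \<in> {0..T}"
    have x0: "fst p 0 s = 0" for s using p unfolding casc_def by blast
    have w: "cw T (\<lambda>t. (R ^^ (n - 1)) (- C (Suc 0) 0 (R (fst p 0 t)))) (\<lambda>t. (R ^^ (n - 1)) (fst p 1 t)) (\<lambda>t. (R ^^ (n - 1)) (snd p 1 t))"
      using cw_R_pow[OF cascD[OF p 0], of "n - 1"] by simp
    have "\<bar>rn (n - 1) p 1 t - rn (n - 1) p 1 0\<bar> \<le> 0 * (t - 0)"
      unfolding rn_def by (rule cw_norm_lipschitz[OF w]) (use t x0 in \<open>simp_all add: R.zero Rp.zero\<close>)
    then show "rn (n - Suc 0) p (Suc 0) t \<le> 1 * (\<Sum>i=1..Suc 0. rn (n - i) p i 0)" by simp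
  qed simp
next
  case (Suc j)
  then obtain K where K: "K \<ge> 0" "\<And>p t. casc T p \<Longrightarrow> t \<in> {0..T} \<Longrightarrow>
    rn (n - Suc j) p (Suc j) t \<le> K * (\<Sum>i=1..Suc j. rn (n - i) p i 0)" by auto
  let ?k = "n - Suc (Suc j)"
  have k: "n - Suc j = Suc ?k" using Suc.prems by simp
  show ?case
  proof (intro exI[of _ "1 + M * K * T"] conjI allI impI)
    show "0 \<le> 1 + M * K * T" using M0 K(1) T by simp
    fix p t assume p: "casc T p" and t: "t \<in> {0..T}"
    define S where "S = (\<Sum>i=1..Suc j. rn (n - i) p i 0)"
    have S0: "S \<ge> 0" unfolding S_def by (intro sum_nonneg rn_nonneg)
    have w: "cw T (\<lambda>t. (R ^^ ?k) (- C (Suc (Suc j)) (Suc j) (R (fst p (Suc j) t)))) (\<lambda>t. (R ^^ ?k) (fst p (Suc (Suc j)) t)) (\<lambda>t. (R ^^ ?k) (snd p (Suc (Suc j)) t))"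
      using cw_R_pow[OF cascD[OF p Suc.prems]] .
    have "\<bar>rn ?k p (Suc (Suc j)) t - rn ?k p (Suc (Suc j)) 0\<bar> \<le> M * (K * S) * (t - 0)"
      unfolding rn_def
    proof (rule cw_norm_lipschitz[OF w])
      fix s assume s: "s \<in> {0..t}"
      have "norm ((R ^^ ?k) (- C (Suc (Suc j)) (Suc j) (R (fst p (Suc j) s)))) \<le> M * norm ((R ^^ ?k) (R (fst p (Suc j) s)))"
        unfolding Rp.neg norm_minus_cancel by (rule CB) (use Suc.prems in auto)
      also have "(R ^^ ?k) (R (fst p (Suc j) s)) = (R ^^ (n - Suc j)) (fst p (Suc j) s)"
        unfolding k by (simp add: funpow_swap1)
      also have "M * norm \<dots> \<le> M * (K * S)"
        using order_trans[OF norm_fst_le_rn K(2)[OF p]] s t unfolding S_def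
        by (intro mult_left_mono M0) auto
      finally show "norm ((R ^^ ?k) (- C (Suc (Suc j)) (Suc j) (R (fst p (Suc j) s)))) \<le> M * (K * S)" .
    qed (use t in auto)
    also have "\<dots> \<le> M * (K * S) * T" using t M0 K(1) S0 by (intro mult_left_mono) auto
    finally have "rn ?k p (Suc (Suc j)) t \<le> rn ?k p (Suc (Suc j)) 0 + M * K * T * S" by (simp add: mult_ac)
    moreover have "(\<Sum>i=1..Suc (Suc j). rn (n - i) p i 0) = S + rn ?k p (Suc (Suc j)) 0" unfolding S_def by simp
    moreover have "0 \<le> M * K * T * rn ?k p (Suc (Suc j)) 0" using M0 K(1) T rn_nonneg by simp
    ultimately show "rn ?k p (Suc (Suc j)) t \<le> (1 + M * K * T) * (\<Sum>i=1..Suc (Suc j). rn (n - i) p i 0)"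
      using S0 by (simp add: distrib_right distrib_left)
  qed
qed

lemma rn_continuous:
  assumes p: "casc T p" and i: "1 \<le> i" "i \<le> n"
  shows "continuous_on {0..T} (rn k p i)"
proof -
  obtain j where j: "i = Suc j" "j < n" using i by (cases i) auto
  note c = cwD[OF cascD[OF p j(2)]]
  show ?thesis unfolding rn_def[abs_def] j(1) by (intro continuous_intros Rp.continuous_on c)
qed

end

subsection \<open>Long-time estimates for cascades\<close>

context cascade
begin

text \<open>The component \<open>Suc i\<close> is used on two levels. In \<open>Z\<close> it has all
  its primitives, and its velocity is the displacement of the same component in \<open>Y\<close>,
  one primitive earlier. Observability of \<open>P\<close> is applied in \<open>Z\<close>;
  coercivity and the duality identity for the components \<open>Suc i\<close> and
  \<open>Suc (Suc i)\<close> are applied in \<open>Y\<close>, where the upper one has its natural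
  energy. For \<open>i = 0\<close> the component below is the zero function.\<close>

lemma lower_component_step:
  fixes P :: "'h \<Rightarrow>\<^sub>L 'h"
  assumes i: "Suc i < n"
    and co: "\<alpha> > 0" "\<And>w. \<alpha> * (norm (P w))\<^sup>2 \<le> C (Suc (Suc i)) (Suc i) w \<bullet> w"
    and fo: "free_observable (qP P)"
    and \<kappa>: "\<kappa> \<ge> 0" and IH: "\<And>T p \<sigma> j t. T \<ge> T1 \<Longrightarrow> casc T p \<Longrightarrow> (\<And>t. t \<in> {0..T} \<Longrightarrow> NN p (Suc i) t \<le> \<sigma>) \<Longrightarrow>
        1 \<le> j \<Longrightarrow> j \<le> i \<Longrightarrow> t \<in> {0..T} \<Longrightarrow> NN p j t \<le> (\<kappa> / T) * \<sigma>"
  shows "\<exists>\<Theta>\<ge>0. \<exists>T2\<ge>1. \<forall>T\<ge>T2. T \<ge> T1 \<longrightarrow> (\<forall>p \<sigma>. casc T p \<longrightarrow> (\<forall>t\<in>{0..T}. NN p (Suc (Suc i)) t \<le> \<sigma>) \<longrightarrow>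
      (\<forall>t\<in>{0..T}. NN p (Suc i) t \<le> (\<Theta> / T) * \<sigma>))"
proof -
  obtain K where K: "K \<ge> 0" "\<And>i k m p t. 1 \<le> i \<Longrightarrow> i \<le> n \<Longrightarrow> m + k = n - i \<Longrightarrow>
       rn k ((lift ^^ m) p) i t \<le> K * (\<Sum>j=1..i. NN p j t)" by (rule rn_le_natural) blast
  \<comment> \<open>Bounds the component \<open>i\<close>, on every level and order adding up to
    \<open>n - i\<close>, by \<open>\<Lambda> / T\<close> times the maximum \<open>\<sigma>'\<close>
    of the component \<open>Suc i\<close>: at most \<open>n\<close> terms
    \<open>\<kappa> / T\<close> enter the sum from \<open>rn_le_natural\<close>.\<close>
  define \<Lambda> where "\<Lambda> = K * (real n * \<kappa>)"
  have \<Lambda>0: "\<Lambda> \<ge> 0" using K(1) \<kappa> by (simp add: \<Lambda>_def)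
  obtain Cq T2 where LT: "Cq > 0" "T2 \<ge> 1"
    "\<And>T f x v \<sigma> s. T \<ge> T2 \<Longrightarrow> cw T f x v \<Longrightarrow> s \<in> {0..T} \<Longrightarrow> norm (x s, v s) = \<sigma> \<Longrightarrow>
      (\<And>t. t \<in> {0..T} \<Longrightarrow> norm (f t) \<le> (M * \<Lambda> / T) * \<sigma>) \<Longrightarrow> T * \<sigma>\<^sup>2 \<le> Cq * qP P T x v"
    by (rule long_time_observability[OF obs_fun_qP fo, of "M * \<Lambda>"]) (use M0 \<Lambda>0 in simp, blast)
  \<comment> \<open>The same count for the component \<open>Suc i\<close>, to which it contributes
    its own \<open>\<sigma>'\<close>; here \<open>1 / T\<close> is simply bounded by 1.\<close>
  define \<Gamma> where "\<Gamma> = K * (real n * \<kappa> + 1)"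
  have \<Gamma>0: "\<Gamma> \<ge> 0" using K(1) \<kappa> by (simp add: \<Gamma>_def)
  \<comment> \<open>\<open>4 * \<Gamma>\<close> comes from the four boundary terms of the duality
    identity, \<open>M * \<Lambda>\<close> from integrating a source of size \<open>1 / T\<close>
    over a length \<open>T\<close>, and \<open>Cq / \<alpha>\<close> from observability and
    coercivity.\<close>
  define \<Theta> where "\<Theta> = (Cq / \<alpha>) * (4 * \<Gamma> + M * \<Lambda>)"
  have \<Theta>0: "\<Theta> \<ge> 0" using LT(1) co(1) \<Gamma>0 M0 \<Lambda>0 by (simp add: \<Theta>_def)
  have "NN p (Suc i) t \<le> (\<Theta> / T) * \<sigma>"
    if T: "T \<ge> T2" "T \<ge> T1" and p: "casc T p" and \<sigma>: "\<And>t. t \<in> {0..T} \<Longrightarrow> NN p (Suc (Suc i)) t \<le> \<sigma>"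
      and t: "t \<in> {0..T}" for T p \<sigma> t
  proof -
    have Tp: "T > 0" "T \<ge> 1" using T(1) LT(2) by auto
    define Y where "Y = (lift ^^ (n - Suc (Suc i))) p"
    define Z where "Z = (lift ^^ (n - Suc i)) p"
    have ZY: "Z = lift Y"
    proof -
      have "n - Suc i = Suc (n - Suc (Suc i))" using i by simp
      then show ?thesis unfolding Y_def Z_def by simp
    qed
    have Yc: "casc T Y" and Zc: "casc T Z" unfolding Y_def Z_def by (rule casc_lift_pow[OF p])+
    have sndZ: "snd Z (Suc i) t = R (fst Y (Suc i) t)" for t unfolding ZY lift_def by simp
    have NNZ: "NN p (Suc i) t = rn 0 Z (Suc i) t" for t unfolding NN_def Z_def ..
    have NNY: "NN p (Suc (Suc i)) t = rn 0 Y (Suc (Suc i)) t" for t unfolding NN_def Y_def ..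
    have "continuous_on {0..T} (rn 0 Z (Suc i))" by (rule rn_continuous[OF Zc]) (use i in auto)
    then obtain s where s: "s \<in> {0..T}" "\<And>t. t \<in> {0..T} \<Longrightarrow> rn 0 Z (Suc i) t \<le> rn 0 Z (Suc i) s"
      using continuous_attains_sup[of "{0..T}" "rn 0 Z (Suc i)"] Tp by fastforce
    define \<sigma>' where "\<sigma>' = rn 0 Z (Suc i) s"
    have \<sigma>': "NN p (Suc i) t \<le> \<sigma>'" if "t \<in> {0..T}" for t using s(2)[OF that] unfolding NNZ \<sigma>'_def .
    have \<sigma>'0: "\<sigma>' \<ge> 0" unfolding \<sigma>'_def by (rule rn_nonneg)
    have \<sigma>0: "\<sigma> \<ge> 0" using order_trans[OF NN_nonneg \<sigma>[OF s(1)]] .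
    have lowsum: "(\<Sum>j=1..i. NN p j t) \<le> real n * \<kappa> / T * \<sigma>'" if t: "t \<in> {0..T}" for t
    proof -
      have "(\<Sum>j=1..i. NN p j t) \<le> (\<Sum>j=1..i. (\<kappa> / T) * \<sigma>')"
        by (intro sum_mono IH[OF T(2) p \<sigma>' _ _ t]) auto
      also have "\<dots> = real i * ((\<kappa> / T) * \<sigma>')" by simp
      also have "\<dots> \<le> real n * ((\<kappa> / T) * \<sigma>')" using i \<kappa> Tp \<sigma>'0 by (intro mult_right_mono) auto
      finally show ?thesis by simp
    qed
    have low: "rn k ((lift ^^ m) p) i t \<le> (\<Lambda> / T) * \<sigma>'" if "1 \<le> i" "m + k = n - i" "t \<in> {0..T}" for m k t
    proof -
      have "rn k ((lift ^^ m) p) i t \<le> K * (\<Sum>j=1..i. NN p j t)" by (rule K(2)) (use that i in auto)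
      also have "\<dots> \<le> K * (real n * \<kappa> / T * \<sigma>')" by (intro mult_left_mono lowsum that K(1))
      finally show ?thesis by (simp add: \<Lambda>_def)
    qed
    have mid: "rn 1 Y (Suc i) t \<le> \<Gamma> * \<sigma>'" if t: "t \<in> {0..T}" for t
    proof -
      have "rn 1 Y (Suc i) t \<le> K * (\<Sum>j=1..Suc i. NN p j t)" unfolding Y_def by (rule K(2)) (use i in auto)
      also have "\<dots> \<le> K * (real n * \<kappa> / T * \<sigma>' + \<sigma>')"
        using lowsum[OF t] \<sigma>'[OF t] by (intro mult_left_mono K(1)) simp
      also have "\<dots> \<le> K * (real n * \<kappa> * \<sigma>' + \<sigma>')"
      proof -
        have "real n * \<kappa> / T \<le> real n * \<kappa> / 1" using Tp(2) \<kappa> by (intro divide_left_mono) auto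
        then have "real n * \<kappa> / T * \<sigma>' \<le> real n * \<kappa> / 1 * \<sigma>'" by (rule mult_right_mono[OF _ \<sigma>'0])
        then show ?thesis by (intro mult_left_mono K(1)) simp
      qed
      finally show ?thesis by (simp add: \<Gamma>_def algebra_simps)
    qed
    \<comment> \<open>A source this small relative to the maximum \<open>\<sigma>'\<close> is what
      \<open>long_time_observability\<close> asks for, to be applied at the maximum point
      \<open>s\<close>.\<close>
    have srcZ: "norm (- C (Suc i) i (R (fst Z i t))) \<le> (M * \<Lambda> / T) * \<sigma>'" if t: "t \<in> {0..T}" for t
    proof (cases "i = 0")
      case True
      then have "fst Z i t = 0" using Zc unfolding casc_def by blast
      then show ?thesis using M0 \<Lambda>0 Tp \<sigma>'0 by (simp add: R.zero)
    next
      case False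
      have "norm (- C (Suc i) i (R (fst Z i t))) \<le> M * norm (R (fst Z i t))"
        using CB[of i 0 "R (fst Z i t)"] False i by simp
      also have "\<dots> \<le> M * ((\<Lambda> / T) * \<sigma>')"
      proof (rule mult_left_mono[OF _ M0])
        have "norm (R (fst Z i t)) \<le> rn 1 Z i t" using norm_fst_le_rn[of 1 Z i t] by simp
        also have "\<dots> \<le> (\<Lambda> / T) * \<sigma>'" unfolding Z_def by (rule low) (use False i t in auto)
        finally show "norm (R (fst Z i t)) \<le> (\<Lambda> / T) * \<sigma>'" .
      qed
      finally show ?thesis by simp
    qed
    have wZ: "cw T (\<lambda>t. - C (Suc i) i (R (fst Z i t))) (fst Z (Suc i)) (snd Z (Suc i))"
      by (rule cascD[OF Zc]) (use i in simp)
    have "T * \<sigma>'\<^sup>2 \<le> Cq * qP P T (fst Z (Suc i)) (snd Z (Suc i))"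
      by (rule LT(3)[OF T(1) wZ s(1)]) (use srcZ in \<open>simp_all add: \<sigma>'_def rn_def\<close>)
    also have "qP P T (fst Z (Suc i)) (snd Z (Suc i)) = integral {0..T} (\<lambda>t. (norm (P (R (fst Y (Suc i) t))))\<^sup>2)"
      unfolding qP_eq[OF wZ] sndZ ..
    finally have step1: "T * \<sigma>'\<^sup>2 \<le> Cq * integral {0..T} (\<lambda>t. (norm (P (R (fst Y (Suc i) t))))\<^sup>2)" .
    define y0 y1 y2 v1 v2 where "y0 = fst Y i" and "y1 = fst Y (Suc i)" and "y2 = fst Y (Suc (Suc i))"
      and "v1 = snd Y (Suc i)" and "v2 = snd Y (Suc (Suc i))"
    define f1 f2 where "f1 t = - C (Suc i) i (R (y0 t))" and "f2 t = - C (Suc (Suc i)) (Suc i) (R (y1 t))" for t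
    have w1: "cw T f1 y1 v1" unfolding f1_def[abs_def] y0_def y1_def v1_def by (rule cascD[OF Yc]) (use i in simp)
    have w2: "cw T f2 y2 v2" unfolding f2_def[abs_def] y1_def y2_def v2_def by (rule cascD[OF Yc i])
    note cc = cwD(1-3)[OF w1] cwD(1-3)[OF w2]
    have y2: "norm (y2 t) \<le> \<sigma>" if "t \<in> {0..T}" for t
      using norm_fst_le_rn[of 0 Y "Suc (Suc i)" t] \<sigma>[OF that] unfolding NNY y2_def by simp
    have v2: "norm (v2 t) \<le> \<sigma>" if "t \<in> {0..T}" for t
      using norm_snd_le_rn[of 0 Y "Suc (Suc i)" t] \<sigma>[OF that] unfolding NNY v2_def by simp
    \<comment> \<open>Only \<open>y2\<close> and \<open>v2\<close> are controlled in
      \<open>H\<close>; for the component \<open>Suc i\<close> the level \<open>Y\<close> gives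
      control of \<open>R (y1 t)\<close> and \<open>R (v1 t)\<close>, so \<open>R\<close> is moved
      onto \<open>v1\<close>.\<close>
    have b1: "\<bar>v1 t \<bullet> R (y2 t)\<bar> \<le> \<Gamma> * \<sigma>' * \<sigma>" if t: "t \<in> {0..T}" for t
    proof -
      have "norm (R (v1 t)) \<le> \<Gamma> * \<sigma>'"
        using norm_snd_le_rn[of 1 Y "Suc i" t] mid[OF t] unfolding v1_def by simp
      then have "norm (R (v1 t)) * norm (y2 t) \<le> \<Gamma> * \<sigma>' * \<sigma>"
        using y2[OF t] \<Gamma>0 \<sigma>'0 by (intro mult_mono) auto
      then show ?thesis using Cauchy_Schwarz_ineq2[of "R (v1 t)" "y2 t"] unfolding R_sym by linarith
    qed
    have b2: "\<bar>v2 t \<bullet> R (y1 t)\<bar> \<le> \<Gamma> * \<sigma>' * \<sigma>" if t: "t \<in> {0..T}" for t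
    proof -
      have "norm (R (y1 t)) \<le> \<Gamma> * \<sigma>'"
        using norm_fst_le_rn[of 1 Y "Suc i" t] mid[OF t] unfolding y1_def by simp
      then have "norm (v2 t) * norm (R (y1 t)) \<le> \<sigma> * (\<Gamma> * \<sigma>')"
        using v2[OF t] \<sigma>0 by (intro mult_mono) auto
      then show ?thesis using Cauchy_Schwarz_ineq2[of "v2 t" "R (y1 t)"] by (simp add: mult_ac)
    qed
    have b3: "\<bar>f1 t \<bullet> R (y2 t)\<bar> \<le> M * \<Lambda> / T * \<sigma>' * \<sigma>" if t: "t \<in> {0..T}" for t
    proof (cases "i = 0")
      case True
      then have "y0 t = 0" using Yc unfolding casc_def y0_def by blast
      then show ?thesis using M0 \<Lambda>0 Tp \<sigma>'0 \<sigma>0 by (simp add: f1_def R.zero)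
    next
      case False
      have "norm (R (f1 t)) \<le> M * norm (R (R (y0 t)))"
        using CB[of i 1 "R (y0 t)"] False i by (simp add: f1_def R.neg)
      also have "\<dots> \<le> M * ((\<Lambda> / T) * \<sigma>')"
      proof (rule mult_left_mono[OF _ M0])
        \<comment> \<open>In \<open>Y\<close> the component \<open>i\<close> lacks two of its
          \<open>n - i\<close> primitives, hence the order 2.\<close>
        have "norm (R (R (y0 t))) \<le> rn 2 Y i t"
          using norm_fst_le_rn[of 2 Y i t] unfolding y0_def by (simp add: eval_nat_numeral)
        also have "\<dots> \<le> (\<Lambda> / T) * \<sigma>'" unfolding Y_def by (rule low) (use False i t in auto)
        finally show "norm (R (R (y0 t))) \<le> (\<Lambda> / T) * \<sigma>'" .
      qed
      finally have "norm (R (f1 t)) \<le> M * \<Lambda> / T * \<sigma>'" by simp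
      then have "norm (R (f1 t)) * norm (y2 t) \<le> M * \<Lambda> / T * \<sigma>' * \<sigma>"
        using y2[OF t] M0 \<Lambda>0 Tp \<sigma>'0 by (intro mult_mono) auto
      then show ?thesis using Cauchy_Schwarz_ineq2[of "R (f1 t)" "y2 t"] unfolding R_sym by linarith
    qed
    have ints: "(\<lambda>t. f1 t \<bullet> R (y2 t)) integrable_on {0..T}" "(\<lambda>t. f2 t \<bullet> R (y1 t)) integrable_on {0..T}"
      "(\<lambda>t. (norm (P (R (y1 t))))\<^sup>2) integrable_on {0..T}"
      by (intro integrable_continuous_real continuous_intros R.continuous_on cc)+
    \<comment> \<open>\<open>- (f2 t \<bullet> R (y1 t))\<close> is the quadratic form of the
      coupling at the displacement \<open>R (y1 t)\<close>, so coercivity applies pointwise.\<close>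
    have "integral {0..T} (\<lambda>t. \<alpha> * (norm (P (R (y1 t))))\<^sup>2) \<le> integral {0..T} (\<lambda>t. - (f2 t \<bullet> R (y1 t)))"
    proof (rule integral_le)
      show "(\<lambda>t. \<alpha> * (norm (P (R (y1 t))))\<^sup>2) integrable_on {0..T}"
        by (intro integrable_continuous_real continuous_intros R.continuous_on cc)
      show "(\<lambda>t. - (f2 t \<bullet> R (y1 t))) integrable_on {0..T}"
        by (intro integrable_continuous_real continuous_intros R.continuous_on cc)
    qed (use co(2) in \<open>simp add: f2_def\<close>)
    then have "\<alpha> * integral {0..T} (\<lambda>t. (norm (P (R (y1 t))))\<^sup>2) \<le> - integral {0..T} (\<lambda>t. f2 t \<bullet> R (y1 t))"
      by simp
    also have "\<dots> = ((v1 T \<bullet> R (y2 T) - v2 T \<bullet> R (y1 T)) - (v1 0 \<bullet> R (y2 0) - v2 0 \<bullet> R (y1 0)))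
         - integral {0..T} (\<lambda>t. f1 t \<bullet> R (y2 t))"
      using cw_duality[OF w1 w2 less_imp_le[OF Tp(1)]] Henstock_Kurzweil_Integration.integral_diff[OF ints(1,2)] by simp
    also have "\<dots> \<le> 4 * (\<Gamma> * \<sigma>' * \<sigma>) + M * \<Lambda> * \<sigma>' * \<sigma>"
    proof -
      have "norm (integral {0..T} (\<lambda>t. f1 t \<bullet> R (y2 t))) \<le> integral {0..T} (\<lambda>t. M * \<Lambda> / T * \<sigma>' * \<sigma>)"
        by (rule integral_norm_bound_integral[OF ints(1)])
          (use b3 in \<open>auto intro!: integrable_continuous_real continuous_intros\<close>)
      also have "\<dots> = M * \<Lambda> * \<sigma>' * \<sigma>" using Tp by simp
      finally have i3: "\<bar>integral {0..T} (\<lambda>t. f1 t \<bullet> R (y2 t))\<bar> \<le> M * \<Lambda> * \<sigma>' * \<sigma>" by simp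
      have 0: "0 \<in> {0..T}" and 1: "T \<in> {0..T}" using Tp by auto
      show ?thesis using b1[OF 0] b1[OF 1] b2[OF 0] b2[OF 1] i3 by linarith
    qed
    finally have "\<alpha> * integral {0..T} (\<lambda>t. (norm (P (R (y1 t))))\<^sup>2) \<le> (4 * \<Gamma> + M * \<Lambda>) * (\<sigma>' * \<sigma>)"
      by (simp add: algebra_simps)
    then have "integral {0..T} (\<lambda>t. (norm (P (R (y1 t))))\<^sup>2) \<le> (4 * \<Gamma> + M * \<Lambda>) * (\<sigma>' * \<sigma>) / \<alpha>"
      using co(1) by (simp add: field_simps)
    then have "Cq * integral {0..T} (\<lambda>t. (norm (P (R (y1 t))))\<^sup>2) \<le> Cq * ((4 * \<Gamma> + M * \<Lambda>) * (\<sigma>' * \<sigma>) / \<alpha>)"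
      using LT(1) by (intro mult_left_mono) auto
    then have "T * \<sigma>'\<^sup>2 \<le> \<Theta> * (\<sigma>' * \<sigma>)"
      using step1 unfolding y1_def \<Theta>_def by simp
    \<comment> \<open>The left-hand side is quadratic in \<open>\<sigma>'\<close> and its bound only
      linear, so one factor \<open>\<sigma>'\<close> cancels.\<close>
    then have "\<sigma>' * \<sigma>' \<le> (\<Theta> / T * \<sigma>) * \<sigma>'" using Tp by (simp add: field_simps power2_eq_square)
    then have "\<sigma>' \<le> \<Theta> / T * \<sigma>"
      by (rule mult_self_le_imp_le) (use \<Theta>0 Tp \<sigma>0 \<sigma>'0 in auto)
    then show ?thesis using \<sigma>'[OF t] by linarith
  qed
  then show ?thesis using \<Theta>0 LT(2) by blast
qed

text \<open>Induction up the chain, each step feeding the smallness of the lower components into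
  \<open>lower_component_step\<close>; for \<open>i = 0\<close> there is no lower component. Two
  successive comparisons would give \<open>1 / T^2\<close>; since \<open>T \<ge> 1\<close>, one
  factor is dropped, and \<open>\<Theta> * (1 + \<kappa>)\<close> covers the old components and the
  new one.\<close>

lemma lower_components_bound:
  fixes P :: "nat \<Rightarrow> 'h \<Rightarrow>\<^sub>L 'h"
  assumes co: "\<And>j. 1 \<le> j \<Longrightarrow> j < n \<Longrightarrow> \<exists>\<alpha>>0. \<forall>w. \<alpha> * (norm (P (Suc j) w))\<^sup>2 \<le> C (Suc j) j w \<bullet> w"
    and fo: "\<And>j. 1 \<le> j \<Longrightarrow> j < n \<Longrightarrow> free_observable (qP (P (Suc j)))"
  shows "i < n \<Longrightarrow> \<exists>\<kappa>\<ge>0. \<exists>T1\<ge>1. \<forall>T\<ge>T1. \<forall>p \<sigma>. casc T p \<longrightarrow> (\<forall>t\<in>{0..T}. NN p (Suc i) t \<le> \<sigma>) \<longrightarrow>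
     (\<forall>j\<in>{1..i}. \<forall>t\<in>{0..T}. NN p j t \<le> (\<kappa> / T) * \<sigma>)"
proof (induction i)
  case 0
  show ?case by (rule exI[of _ 0], rule conjI[OF order_refl], rule exI[of _ 1]) simp
next
  case (Suc i)
  then obtain \<kappa> T1 where \<kappa>: "\<kappa> \<ge> 0" "T1 \<ge> 1" and IH: "\<forall>T\<ge>T1. \<forall>p \<sigma>. casc T p \<longrightarrow>
     (\<forall>t\<in>{0..T}. NN p (Suc i) t \<le> \<sigma>) \<longrightarrow> (\<forall>j\<in>{1..i}. \<forall>t\<in>{0..T}. NN p j t \<le> (\<kappa> / T) * \<sigma>)"
    by auto
  have IH': "NN p j t \<le> (\<kappa> / T) * \<sigma>" if "T \<ge> T1" "casc T p" "\<And>t. t \<in> {0..T} \<Longrightarrow> NN p (Suc i) t \<le> \<sigma>"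
    "1 \<le> j" "j \<le> i" "t \<in> {0..T}" for T p \<sigma> j t
    by (rule IH[rule_format, OF that(1,2)]) (use that in auto)
  obtain \<alpha> where \<alpha>: "\<alpha> > 0" "\<And>w. \<alpha> * (norm (P (Suc (Suc i)) w))\<^sup>2 \<le> C (Suc (Suc i)) (Suc i) w \<bullet> w"
    using co[of "Suc i"] Suc.prems by auto
  have f: "free_observable (qP (P (Suc (Suc i))))" by (rule fo) (use Suc.prems in auto)
  obtain \<Theta> T2 where \<Theta>: "\<Theta> \<ge> 0" "T2 \<ge> 1" and st: "\<forall>T\<ge>T2. T \<ge> T1 \<longrightarrow> (\<forall>p \<sigma>. casc T p \<longrightarrow>
      (\<forall>t\<in>{0..T}. NN p (Suc (Suc i)) t \<le> \<sigma>) \<longrightarrow> (\<forall>t\<in>{0..T}. NN p (Suc i) t \<le> (\<Theta> / T) * \<sigma>))"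
    using lower_component_step[OF Suc.prems \<alpha> f \<kappa>(1) IH'] by blast
  have nonneg: "0 \<le> \<Theta> * (1 + \<kappa>)" using \<Theta> \<kappa> by simp
  show ?case
  proof (rule exI[of _ "\<Theta> * (1 + \<kappa>)"], rule conjI[OF nonneg], rule exI[of _ "max T1 T2"],
      intro conjI allI impI ballI)
    show "1 \<le> max T1 T2" using \<kappa> by simp
    fix T p \<sigma> j t
    assume T: "max T1 T2 \<le> T" and p: "casc T p" and \<sigma>: "\<forall>t\<in>{0..T}. NN p (Suc (Suc i)) t \<le> \<sigma>"
      and j: "j \<in> {1..Suc i}" and t: "t \<in> {0..T}"
    have Tp: "T \<ge> 1" using T \<kappa> by simp
    have \<sigma>0: "\<sigma> \<ge> 0" using order_trans[OF NN_nonneg] \<sigma> t by blast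
    have top: "NN p (Suc i) s \<le> (\<Theta> / T) * \<sigma>" if "s \<in> {0..T}" for s
      by (rule st[rule_format, OF _ _ p]) (use T \<sigma> that in auto)
    show "NN p j t \<le> (\<Theta> * (1 + \<kappa>) / T) * \<sigma>"
    proof (cases "j = Suc i")
      case True
      have "(\<Theta> / T) * \<sigma> \<le> (\<Theta> * (1 + \<kappa>) / T) * \<sigma>"
        using \<Theta>(1) \<kappa>(1) Tp \<sigma>0 by (intro mult_right_mono divide_right_mono) (auto simp: distrib_left)
      then show ?thesis using top[OF t] True by simp
    next
      case False
      have "NN p j t \<le> (\<kappa> / T) * ((\<Theta> / T) * \<sigma>)"
        by (rule IH'[OF _ p top]) (use T j False t in auto)
      also have "\<dots> \<le> (\<kappa> / 1) * ((\<Theta> / T) * \<sigma>)"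
        using \<kappa>(1) \<Theta>(1) Tp \<sigma>0 by (intro mult_right_mono frac_le) auto
      also have "\<dots> = (\<Theta> * \<kappa> / T) * \<sigma>" by simp
      also have "\<dots> \<le> (\<Theta> * (1 + \<kappa>) / T) * \<sigma>"
        using \<Theta>(1) \<kappa>(1) Tp \<sigma>0 by (intro mult_right_mono divide_right_mono) (auto simp: distrib_left)
      finally show ?thesis .
    qed
  qed
qed

text \<open>\<open>q\<close> observes the top component without primitives, which gives
  \<open>T \<sigma>^2 \<le> Cq * q\<close>. The lower components are smaller by
  \<open>\<Lambda> / T\<close>, and squaring this turns \<open>1 / T\<close> into
  \<open>1 / T^3\<close>. \<open>K\<close> is fixed before \<open>T\<close>, as uniformity in
  \<open>T\<close> demands.\<close>

lemma top_estimate: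
  fixes P :: "nat \<Rightarrow> 'h \<Rightarrow>\<^sub>L 'h"
  assumes n2: "n \<ge> 2"
    and co: "\<And>j. 1 \<le> j \<Longrightarrow> j < n \<Longrightarrow> \<exists>\<alpha>>0. \<forall>w. \<alpha> * (norm (P (Suc j) w))\<^sup>2 \<le> C (Suc j) j w \<bullet> w"
    and fo: "\<And>j. 1 \<le> j \<Longrightarrow> j < n \<Longrightarrow> free_observable (qP (P (Suc j)))"
    and q: "obs_fun q" "free_observable q"
  obtains K T1 where "K > 0" "T1 \<ge> 1"
    "\<And>T p t. T \<ge> T1 \<Longrightarrow> casc T p \<Longrightarrow> t \<in> {0..T} \<Longrightarrow> (rn 0 p n t)\<^sup>2 \<le> K / T * q T (fst p n) (snd p n)"
    "\<And>T p t i. T \<ge> T1 \<Longrightarrow> casc T p \<Longrightarrow> t \<in> {0..T} \<Longrightarrow> 1 \<le> i \<Longrightarrow> i < n \<Longrightarrow>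
       (rn (n - i) p i t)\<^sup>2 \<le> K / T^3 * q T (fst p n) (snd p n)"
proof -
  obtain m where m: "n = Suc m" "m \<ge> 1" using n2 by (cases n) auto
  obtain \<kappa> T1 where \<kappa>: "\<kappa> \<ge> 0" "T1 \<ge> 1" and LB: "\<forall>T\<ge>T1. \<forall>p \<sigma>. casc T p \<longrightarrow> (\<forall>t\<in>{0..T}. NN p (Suc m) t \<le> \<sigma>) \<longrightarrow>
     (\<forall>j\<in>{1..m}. \<forall>t\<in>{0..T}. NN p j t \<le> (\<kappa> / T) * \<sigma>)"
    using lower_components_bound[OF co fo, of m] m by auto
  obtain K where K: "K \<ge> 0" "\<And>i k m p t. 1 \<le> i \<Longrightarrow> i \<le> n \<Longrightarrow> m + k = n - i \<Longrightarrow>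
       rn k ((lift ^^ m) p) i t \<le> K * (\<Sum>j=1..i. NN p j t)" by (rule rn_le_natural) blast
  define \<Lambda> where "\<Lambda> = K * (real n * \<kappa>)"
  have \<Lambda>0: "\<Lambda> \<ge> 0" using K(1) \<kappa> by (simp add: \<Lambda>_def)
  obtain Cq T2 where LT: "Cq > 0" "T2 \<ge> 1"
    "\<And>T f x v \<sigma> s. T \<ge> T2 \<Longrightarrow> cw T f x v \<Longrightarrow> s \<in> {0..T} \<Longrightarrow> norm (x s, v s) = \<sigma> \<Longrightarrow>
      (\<And>t. t \<in> {0..T} \<Longrightarrow> norm (f t) \<le> (M * \<Lambda> / T) * \<sigma>) \<Longrightarrow> T * \<sigma>\<^sup>2 \<le> Cq * q T x v"
    by (rule long_time_observability[OF q, of "M * \<Lambda>"]) (use M0 \<Lambda>0 in simp, blast)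
  have est: "(rn 0 p n t)\<^sup>2 \<le> Cq / T * q T (fst p n) (snd p n) \<and>
      (1 \<le> i \<longrightarrow> i < n \<longrightarrow> (rn (n - i) p i t)\<^sup>2 \<le> (\<Lambda>\<^sup>2 * Cq) / T^3 * q T (fst p n) (snd p n))"
    if T: "T \<ge> max T1 T2" and p: "casc T p" and t: "t \<in> {0..T}" for T p t i
  proof -
    have Tp: "T \<ge> 1" "T > 0" using T \<kappa> by auto
    have "continuous_on {0..T} (rn 0 p n)" by (rule rn_continuous[OF p]) (use m in auto)
    then obtain s where s: "s \<in> {0..T}" "\<And>t. t \<in> {0..T} \<Longrightarrow> rn 0 p n t \<le> rn 0 p n s"
      using continuous_attains_sup[of "{0..T}" "rn 0 p n"] Tp by fastforce
    define \<sigma> where "\<sigma> = rn 0 p n s"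
    have \<sigma>0: "\<sigma> \<ge> 0" unfolding \<sigma>_def by (rule rn_nonneg)
    have NNn: "NN p n t = rn 0 p n t" for t unfolding NN_def by simp
    have low: "NN p j t \<le> (\<kappa> / T) * \<sigma>" if "j \<in> {1..m}" "t \<in> {0..T}" for j t
      by (rule LB[rule_format, OF _ p]) (use T s(2) that in \<open>auto simp: m(1)[symmetric] NNn \<sigma>_def\<close>)
    have lowr: "rn (n - i) p i t \<le> (\<Lambda> / T) * \<sigma>" if "1 \<le> i" "i < n" "t \<in> {0..T}" for i t
    proof -
      \<comment> \<open>No primitive is taken here: all \<open>n - i\<close> of them are replaced by
        powers of \<open>R\<close>, which is the energy of order \<open>1 + i - n\<close>.\<close>
      have "rn (n - i) ((lift ^^ 0) p) i t \<le> K * (\<Sum>j=1..i. NN p j t)" by (rule K(2)) (use that in auto)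
      also have "(\<Sum>j=1..i. NN p j t) \<le> (\<Sum>j=1..i. (\<kappa> / T) * \<sigma>)"
        by (intro sum_mono low) (use that m in auto)
      also have "(\<Sum>j=1..i. (\<kappa> / T) * \<sigma>) = real i * ((\<kappa> / T) * \<sigma>)" by simp
      also have "\<dots> \<le> real n * ((\<kappa> / T) * \<sigma>)" using that \<kappa> Tp \<sigma>0 by (intro mult_right_mono) auto
      finally show ?thesis using K(1) by (simp add: \<Lambda>_def mult_left_mono)
    qed
    have w: "cw T (\<lambda>t. - C n m (R (fst p m t))) (fst p n) (snd p n)"
      unfolding m(1) by (rule cascD[OF p]) (use m in simp)
    have "norm (- C n m (R (fst p m t))) \<le> (M * \<Lambda> / T) * \<sigma>" if t: "t \<in> {0..T}" for t
    proof -
      have "norm (- C n m (R (fst p m t))) \<le> M * norm (R (fst p m t))"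
        using CB[of m 0 "R (fst p m t)"] m by simp
      also have "\<dots> \<le> M * ((\<Lambda> / T) * \<sigma>)"
      proof (rule mult_left_mono[OF _ M0])
        have "n - m = 1" using m by simp
        then show "norm (R (fst p m t)) \<le> (\<Lambda> / T) * \<sigma>"
          using norm_fst_le_rn[of 1 p m t] lowr[of m t] m t by simp
      qed
      finally show ?thesis by simp
    qed
    then have "T * \<sigma>\<^sup>2 \<le> Cq * q T (fst p n) (snd p n)"
      by (intro LT(3)[OF _ w s(1)]) (use T in \<open>simp_all add: \<sigma>_def rn_def\<close>)
    then have main: "\<sigma>\<^sup>2 \<le> Cq / T * q T (fst p n) (snd p n)" using Tp by (simp add: field_simps)
    have "(rn 0 p n t)\<^sup>2 \<le> \<sigma>\<^sup>2" using s(2)[OF t] unfolding \<sigma>_def by (intro power_mono rn_nonneg)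
    moreover have "(rn (n - i) p i t)\<^sup>2 \<le> (\<Lambda>\<^sup>2 * Cq) / T^3 * q T (fst p n) (snd p n)" if "1 \<le> i" "i < n"
    proof -
      have "(rn (n - i) p i t)\<^sup>2 \<le> ((\<Lambda> / T) * \<sigma>)\<^sup>2" by (intro power_mono lowr that t rn_nonneg)
      also have "\<dots> = (\<Lambda> / T)\<^sup>2 * \<sigma>\<^sup>2" by (rule power_mult_distrib)
      also have "\<dots> \<le> (\<Lambda> / T)\<^sup>2 * (Cq / T * q T (fst p n) (snd p n))" by (intro mult_left_mono main) simp
      also have "\<dots> = (\<Lambda>\<^sup>2 * Cq) / T^3 * q T (fst p n) (snd p n)"
        by (simp add: power_divide power2_eq_square power3_eq_cube)
      finally show ?thesis .
    qed
    ultimately show ?thesis using main by simp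
  qed
  show thesis
  proof (rule that[of "(1 + \<Lambda>\<^sup>2) * Cq" "max T1 T2"])
    show "0 < (1 + \<Lambda>\<^sup>2) * Cq" using LT(1) by (simp add: add_pos_nonneg)
    show "1 \<le> max T1 T2" using \<kappa> by simp
    fix T p t assume T: "T \<ge> max T1 T2" and p: "casc T p" and t: "t \<in> {0..T}"
    have Tp: "T > 0" using T \<kappa> by simp
    have w: "cw T (\<lambda>t. - C n m (R (fst p m t))) (fst p n) (snd p n)"
      unfolding m(1) by (rule cascD[OF p]) (use m in simp)
    have q0: "0 \<le> q T (fst p n) (snd p n)" by (rule obs_fun_nonneg[OF q(1) w Tp])
    have "Cq / T \<le> (1 + \<Lambda>\<^sup>2) * Cq / T" using LT(1) Tp by (intro divide_right_mono) (auto simp: distrib_right)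
    then have "Cq / T * q T (fst p n) (snd p n) \<le> (1 + \<Lambda>\<^sup>2) * Cq / T * q T (fst p n) (snd p n)"
      by (rule mult_right_mono[OF _ q0])
    then show "(rn 0 p n t)\<^sup>2 \<le> (1 + \<Lambda>\<^sup>2) * Cq / T * q T (fst p n) (snd p n)"
      by (rule order_trans[OF conjunct1[OF est[OF T p t, of 0]]])
    fix i assume i: "1 \<le> i" "i < n"
    have "\<Lambda>\<^sup>2 * Cq / T^3 \<le> (1 + \<Lambda>\<^sup>2) * Cq / T^3" using LT(1) Tp by (intro divide_right_mono) (auto simp: distrib_right)
    then have "\<Lambda>\<^sup>2 * Cq / T^3 * q T (fst p n) (snd p n) \<le> (1 + \<Lambda>\<^sup>2) * Cq / T^3 * q T (fst p n) (snd p n)"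
      by (rule mult_right_mono[OF _ q0])
    then show "(rn (n - i) p i t)\<^sup>2 \<le> (1 + \<Lambda>\<^sup>2) * Cq / T^3 * q T (fst p n) (snd p n)"
      by (rule order_trans[OF conjunct2[OF est[OF T p t, of i], rule_format, OF i]])
  qed
qed

end

section \<open>Components beyond the cascade\<close>

context wave
begin

abbreviation ext_src :: "(nat \<Rightarrow> nat \<Rightarrow> 'h \<Rightarrow>\<^sub>L 'h) \<Rightarrow> nat \<Rightarrow> nat \<Rightarrow> (nat \<Rightarrow> real \<Rightarrow> 'h) \<Rightarrow> real \<Rightarrow> 'h" where
  "ext_src C n i x t \<equiv> (\<Sum>k=n-1..i-1. C i k (R (x k t)))"

abbreviation ext_sol :: "(nat \<Rightarrow> nat \<Rightarrow> 'h \<Rightarrow>\<^sub>L 'h) \<Rightarrow> nat \<Rightarrow> nat \<Rightarrow> real \<Rightarrow>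
    (nat \<Rightarrow> real \<Rightarrow> 'h) \<Rightarrow> (nat \<Rightarrow> real \<Rightarrow> 'h) \<Rightarrow> bool" where
  "ext_sol C n p T x v \<equiv> \<forall>i\<in>{n+1..n+p}. cw T (\<lambda>t. - ext_src C n i x t) (x i) (v i)"

text \<open>One form for two uses, with \<open>s\<close> the size of the known quantities. For the
  direct inequality the initial values are bounded by \<open>s\<close>; for observability they are
  bounded by observations plus the size of the source, which is why that premise is quantified over
  bounds \<open>L\<close> of the source. Of the component \<open>n - 1\<close> only the displacement
  \<open>R x\<close> is controlled, which is all that enters the sources.\<close>

abbreviation propagates :: "(nat \<Rightarrow> nat \<Rightarrow> 'h \<Rightarrow>\<^sub>L 'h) \<Rightarrow> nat \<Rightarrow> nat \<Rightarrow> real \<Rightarrow> real \<Rightarrow> real \<Rightarrow> real \<Rightarrow> bool" where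
  "propagates C n p T K0 K1 K \<equiv> \<forall>x v s. 0 \<le> s \<longrightarrow>
    ext_sol C n p T x v \<longrightarrow>
    (\<forall>t\<in>{0..T}. norm (R (x (n - 1) t)) \<le> K0 * s) \<longrightarrow>
    (\<forall>t\<in>{0..T}. norm (x n t, v n t) \<le> K0 * s) \<longrightarrow>
    (\<forall>i\<in>{n+1..n+p}. \<forall>L. (\<forall>t\<in>{0..T}. norm (ext_src C n i x t) \<le> L) \<longrightarrow>
       norm (x i 0, v i 0) \<le> K1 * s + K1 * L) \<longrightarrow>
    (\<forall>t\<in>{0..T}. (\<forall>i\<in>{n..n+p}. norm (x i t, v i t) \<le> K * s) \<and>
       (\<forall>i\<in>{n+1..n+p}. norm (ext_src C n i x t) \<le> K * s))"

text \<open>The source of the component \<open>i\<close> involves displacements of lower index only.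
  So the last component is estimated in the order source, initial value, growth over
  \<open>[0, T]\<close>.\<close>

lemma propagate:
  fixes C :: "nat \<Rightarrow> nat \<Rightarrow> 'h \<Rightarrow>\<^sub>L 'h"
  assumes T: "T \<ge> 0" and K0: "K0 \<ge> 0" and K1: "K1 \<ge> 0" and n: "n \<ge> 1"
  shows "\<exists>K\<ge>0. propagates C n p T K0 K1 K"
proof (induction p)
  case 0
  show ?case by (intro exI[of _ K0]) (use K0 in auto)
next
  case (Suc p)
  then obtain K where K: "K \<ge> 0" and IH: "\<And>x v s. 0 \<le> s \<Longrightarrow>
    ext_sol C n p T x v \<Longrightarrow>
    (\<forall>t\<in>{0..T}. norm (R (x (n - 1) t)) \<le> K0 * s) \<Longrightarrow>
    (\<forall>t\<in>{0..T}. norm (x n t, v n t) \<le> K0 * s) \<Longrightarrow>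
    (\<forall>i\<in>{n+1..n+p}. \<forall>L. (\<forall>t\<in>{0..T}. norm (ext_src C n i x t) \<le> L) \<longrightarrow>
       norm (x i 0, v i 0) \<le> K1 * s + K1 * L) \<Longrightarrow>
    (\<forall>t\<in>{0..T}. (\<forall>i\<in>{n..n+p}. norm (x i t, v i t) \<le> K * s) \<and>
       (\<forall>i\<in>{n+1..n+p}. norm (ext_src C n i x t) \<le> K * s))" by blast
  let ?i = "n + Suc p"
  define L0 where "L0 = (\<Sum>k=n-1..?i-1. norm (C ?i k)) * (K0 + (1 / c) * K)"
  have L0: "L0 \<ge> 0" unfolding L0_def using K0 K c_pos by (intro mult_nonneg_nonneg sum_nonneg) auto
  \<comment> \<open>Summands for the earlier components, for the new source, and for the new state:
    initial value \<open>K1 + K1 * L0\<close> and growth \<open>L0 * T\<close>.\<close>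
  define K' where "K' = K + L0 + (K1 + K1 * L0 + L0 * T)"
  have K': "K \<le> K'" "L0 \<le> K'" "K1 + K1 * L0 + L0 * T \<le> K'"
    unfolding K'_def using K L0 K1 T by (auto intro!: add_nonneg_nonneg mult_nonneg_nonneg)
  show ?case
  proof (intro exI[of _ K'] conjI allI impI ballI)
    show "0 \<le> K'" using K K' by linarith
    fix x v s t i
    assume s: "0 \<le> s"
      and w: "\<forall>i\<in>{n+1..n+Suc p}. cw T (\<lambda>t. - ext_src C n i x t) (x i) (v i)"
      and b1: "\<forall>t\<in>{0..T}. norm (R (x (n - 1) t)) \<le> K0 * s"
      and b2: "\<forall>t\<in>{0..T}. norm (x n t, v n t) \<le> K0 * s"
      and b3: "\<forall>i\<in>{n+1..n+Suc p}. \<forall>L. (\<forall>t\<in>{0..T}. norm (ext_src C n i x t) \<le> L) \<longrightarrow>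
       norm (x i 0, v i 0) \<le> K1 * s + K1 * L"
      and t: "t \<in> {0..T}"
    have ih: "\<forall>t\<in>{0..T}. (\<forall>i\<in>{n..n+p}. norm (x i t, v i t) \<le> K * s) \<and>
       (\<forall>i\<in>{n+1..n+p}. norm (ext_src C n i x t) \<le> K * s)"
      by (rule IH[of s x v, OF s _ b1 b2]) (use w b3 in auto)
    have Rx: "norm (R (x k t)) \<le> (K0 + (1 / c) * K) * s" if k: "k \<in> {n-1..n+p}" and t: "t \<in> {0..T}" for k t
    proof (cases "k = n - 1")
      case True
      then have "norm (R (x k t)) \<le> K0 * s" using b1 t by simp
      also have "\<dots> \<le> (K0 + (1 / c) * K) * s" using s K c_pos by (intro mult_right_mono) auto
      finally show ?thesis .
    next
      case False
      have "norm (R (x k t)) \<le> (1 / c) * norm (x k t)" by (rule norm_R)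
      also have "\<dots> \<le> (1 / c) * (K * s)"
      proof (rule mult_left_mono)
        have "norm (x k t, v k t) \<le> K * s" using ih t k False by auto
        then show "norm (x k t) \<le> K * s" using norm_fst_le[of "x k t" "v k t"] by linarith
      qed (use c_pos in simp)
      also have "\<dots> \<le> (K0 + (1 / c) * K) * s" using s K0 by (simp add: distrib_right)
      finally show ?thesis .
    qed
    have src: "norm (\<Sum>k=n-1..?i-1. C ?i k (R (x k t))) \<le> L0 * s" if t: "t \<in> {0..T}" for t
    proof -
      have "norm (\<Sum>k=n-1..?i-1. C ?i k (R (x k t))) \<le> (\<Sum>k=n-1..?i-1. norm (C ?i k) * ((K0 + (1 / c) * K) * s))"
      proof (rule sum_norm_le)
        fix k assume k: "k \<in> {n-1..?i-1}"
        have "norm (C ?i k (R (x k t))) \<le> norm (C ?i k) * norm (R (x k t))" by (rule norm_blinfun)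
        also have "\<dots> \<le> norm (C ?i k) * ((K0 + (1 / c) * K) * s)" by (intro mult_left_mono Rx t) (use k in auto)
        finally show "norm (C ?i k (R (x k t))) \<le> norm (C ?i k) * ((K0 + (1 / c) * K) * s)" .
      qed
      also have "\<dots> = L0 * s" unfolding L0_def by (simp add: sum_distrib_right mult.assoc)
      finally show ?thesis .
    qed
    have X0: "norm (x ?i 0, v ?i 0) \<le> K1 * s + K1 * (L0 * s)" using b3 src by auto
    have wi: "cw T (\<lambda>t. - (\<Sum>k=n-1..?i-1. C ?i k (R (x k t)))) (x ?i) (v ?i)"
      by (rule bspec[OF w]) auto
    have "\<bar>norm (x ?i t, v ?i t) - norm (x ?i 0, v ?i 0)\<bar> \<le> (L0 * s) * (t - 0)"
    proof (rule cw_norm_lipschitz[OF wi])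
      fix r assume "r \<in> {0..t}"
      then show "norm (- (\<Sum>k=n-1..?i-1. C ?i k (R (x k r)))) \<le> L0 * s"
        unfolding norm_minus_cancel using t by (intro src) auto
    qed (use t in auto)
    also have "(L0 * s) * (t - 0) \<le> (L0 * s) * T" using t L0 s by (intro mult_left_mono) auto
    finally have Xt: "norm (x ?i t, v ?i t) \<le> (K1 + K1 * L0 + L0 * T) * s" using X0 by (simp add: algebra_simps)
    have mono: "a \<le> b \<Longrightarrow> a * s \<le> b * s" for a b :: real using s by (rule mult_right_mono[rotated])
    show "norm (x i t, v i t) \<le> K' * s" if "i \<in> {n..n+Suc p}"
    proof (cases "i = ?i")
      case True then show ?thesis using Xt mono[OF K'(3)] by simp
    next
      case False
      then have "norm (x i t, v i t) \<le> K * s" using ih t that by auto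
      then show ?thesis using mono[OF K'(1)] by linarith
    qed
    show "norm (ext_src C n i x t) \<le> K' * s" if "i \<in> {n+1..n+Suc p}"
    proof (cases "i = ?i")
      case True then show ?thesis using src[OF t] mono[OF K'(2)] by simp
    next
      case False
      then have "norm (ext_src C n i x t) \<le> K * s" using ih t that by auto
      then show ?thesis using mono[OF K'(1)] by linarith
    qed
  qed
qed

end

subsection \<open>Mixed cascades\<close>

context wave
begin

lemma R_pow_sym: "(R ^^ k) x \<bullet> y = x \<bullet> (R ^^ k) y"
  by (induction k arbitrary: x y) (simp_all add: R_sym funpow_swap1)

text \<open>Duality between \<open>H_k\<close> and \<open>H_{-k}\<close>. With
  \<open>z = R^k F x\<close>, the square of \<open>|z|\<close> is the pairing of \<open>x\<close>
  with the adjoint applied to \<open>R^k z\<close>, which by hypothesis is some \<open>R^k y\<close>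
  with \<open>y\<close> bounded by a multiple of \<open>|z|\<close>. Moving \<open>R^k\<close> onto
  \<open>x\<close> and cancelling \<open>|z|\<close> gives the bound.\<close>

lemma adjoint_bounded_imp_negative_order_bound:
  fixes F :: "'h \<Rightarrow>\<^sub>L 'h"
  assumes "bounded_on_Hsp A k (adjoint (blinfun_apply F))"
  shows "\<exists>K\<ge>0. \<forall>x. norm ((R ^^ k) (F x)) \<le> K * norm ((R ^^ k) x)"
proof -
  let ?G = "adjoint (blinfun_apply F)"
  obtain K where K: "\<And>w. w \<in> Hsp A k \<Longrightarrow> Hnorm A (int k) (?G w) \<le> K * Hnorm A (int k) w"
    and im: "?G ` Hsp A k \<subseteq> Hsp A k"
    using assms unfolding bounded_on_Hsp_def by blast
  have "norm ((R ^^ k) (F x)) \<le> \<bar>K\<bar> * norm ((R ^^ k) x)" for x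
  proof -
    define z where "z = (R ^^ k) (F x)"
    have zH: "(R ^^ k) z \<in> Hsp A k" unfolding Hsp_eq by simp
    then obtain y where y: "?G ((R ^^ k) z) = (R ^^ k) y" using im unfolding Hsp_eq by blast
    have "norm y \<le> K * norm z"
      using K[OF zH] unfolding y Hnorm_def op_app_half_pow .
    also have "\<dots> \<le> \<bar>K\<bar> * norm z" by (intro mult_right_mono) auto
    finally have ny: "norm y \<le> \<bar>K\<bar> * norm z" .
    have "z \<bullet> z = F x \<bullet> (R ^^ k) z" unfolding z_def by (rule R_pow_sym)
    also have "\<dots> = x \<bullet> (R ^^ k) y" unfolding adjoint_exists y ..
    also have "\<dots> = (R ^^ k) x \<bullet> y" by (rule R_pow_sym[symmetric])
    also have "\<dots> \<le> norm ((R ^^ k) x) * norm y" by (rule norm_cauchy_schwarz)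
    also have "\<dots> \<le> norm ((R ^^ k) x) * (\<bar>K\<bar> * norm z)" by (intro mult_left_mono ny) simp
    finally have "norm z * norm z \<le> (\<bar>K\<bar> * norm ((R ^^ k) x)) * norm z"
      by (simp add: power2_norm_eq_inner[symmetric] power2_eq_square mult_ac)
    then show ?thesis unfolding z_def[symmetric] by (rule mult_self_le_imp_le) simp_all
  qed
  then show ?thesis by (intro exI[of _ "\<bar>K\<bar>"]) simp
qed

lemma cw_cong_source:
  assumes w: "cw T f x v" and eq: "\<And>t. t \<in> {0..T} \<Longrightarrow> f t = g t"
  shows "cw T g x v"
proof -
  have "continuous_on {0..T} g" by (rule continuous_on_eq[OF cwD(1)[OF w] eq])
  then show ?thesis using w eq unfolding cw_def by simp
qed

text \<open>Displacements are differentiable, hence all coupling sources are continuous, which gives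
  access to \<open>cw\<close>. The convention \<open>x 0 = 0\<close> absorbs the first equation into
  the chain.\<close>

lemma mixed_cascade_sol_cw:
  fixes C :: "nat \<Rightarrow> nat \<Rightarrow> 'h \<Rightarrow>\<^sub>L 'h"
  assumes n: "n \<ge> 2" and sol: "mixed_cascade_sol A n p C T u v"
  obtains x where "x 0 = (\<lambda>t. 0)"
    "\<And>i t. i \<in> {1..n+p} \<Longrightarrow> t \<in> {0..T} \<Longrightarrow> u i t = R (x i t)"
    "\<And>i. i \<in> {1..n+p} \<Longrightarrow> cw T (cascade_source n C u i) (x i) (v i)"
    "\<And>j. j < n \<Longrightarrow> cw T (\<lambda>t. - C (Suc j) j (R (x j t))) (x (Suc j)) (v (Suc j))"
    "\<And>i. i \<in> {n+1..n+p} \<Longrightarrow> cw T (\<lambda>t. - ext_src C n i x t) (x i) (v i)"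
proof -
  have ws: "wave_sol A T (cascade_source n C u i) (u i) (v i)" if "i \<in> {1..n+p}" for i
    using sol that unfolding mixed_cascade_sol_def by blast
  have uc: "continuous_on {0..T} (u i)" if "i \<in> {1..n+p}" for i
    unfolding continuous_on_eq_continuous_within
  proof
    fix t assume "t \<in> {0..T}"
    then have "(u i has_vector_derivative v i t) (at t within {0..T})"
      using ws[OF that] unfolding wave_sol_def by blast
    then show "continuous (at t within {0..T}) (u i)" by (rule has_vector_derivative_continuous)
  qed
  have sc: "continuous_on {0..T} (cascade_source n C u i)" if i: "i \<in> {1..n+p}" for i
  proof -
    consider "i = 1" | "i \<noteq> 1" "i \<le> n" | "i \<noteq> 1" "\<not> i \<le> n" by blast
    then show ?thesis
    proof cases
      case 1
      then show ?thesis unfolding cascade_source_def[abs_def] by simp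
    next
      case 2
      have "continuous_on {0..T} (\<lambda>t. - C i (i - 1) (u (i - 1) t))"
        by (intro continuous_intros uc) (use 2 i in auto)
      then show ?thesis unfolding cascade_source_def[abs_def] using 2 by simp
    next
      case 3
      have "continuous_on {0..T} (\<lambda>t. - (\<Sum>k = n - 1..i - 1. C i k (u k t)))"
        by (intro continuous_intros uc) (use 3 i n in auto)
      then show ?thesis unfolding cascade_source_def[abs_def] using 3 by simp
    qed
  qed
  have "\<forall>i. \<exists>y. i \<in> {1..n+p} \<longrightarrow> cw T (cascade_source n C u i) y (v i) \<and> (\<forall>t\<in>{0..T}. u i t = R (y t))"
    using wave_sol_imp_cw[OF ws sc] by blast
  then obtain y where y: "\<And>i. i \<in> {1..n+p} \<Longrightarrow> cw T (cascade_source n C u i) (y i) (v i) \<and> (\<forall>t\<in>{0..T}. u i t = R (y i t))"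
    by metis
  define x where "x i = (if i = 0 then (\<lambda>t. 0) else y i)" for i
  have xy: "x i = y i" if "i \<in> {1..n+p}" for i using that by (simp add: x_def)
  have cx: "cw T (cascade_source n C u i) (x i) (v i)" if "i \<in> {1..n+p}" for i
    using y[OF that] xy[OF that] by simp
  have ux: "u i t = R (x i t)" if "i \<in> {1..n+p}" "t \<in> {0..T}" for i t
    using y[OF that(1)] xy[OF that(1)] that(2) by simp
  show thesis
  proof (rule that[OF _ ux cx])
    show "x 0 = (\<lambda>t. 0)" by (simp add: x_def)
    show "cw T (\<lambda>t. - C (Suc j) j (R (x j t))) (x (Suc j)) (v (Suc j))" if j: "j < n" for j
    proof (rule cw_cong_source[OF cx])
      show "Suc j \<in> {1..n+p}" using j by simp
      fix t assume t: "t \<in> {0..T}"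
      show "cascade_source n C u (Suc j) t = - C (Suc j) j (R (x j t))"
      proof (cases "j = 0")
        case True
        then show ?thesis by (simp add: cascade_source_def x_def R.zero)
      next
        case False
        then show ?thesis using ux[of j t] j t by (simp add: cascade_source_def)
      qed
    qed
    show "cw T (\<lambda>t. - ext_src C n i x t) (x i) (v i)" if i: "i \<in> {n+1..n+p}" for i
    proof (rule cw_cong_source[OF cx])
      show "i \<in> {1..n+p}" using i by simp
      fix t assume t: "t \<in> {0..T}"
      have "(\<Sum>k=n-1..i-1. C i k (u k t)) = ext_src C n i x t"
        by (intro sum.cong refl arg_cong[of _ _ "blinfun_apply (C i _)"] ux t) (use i n in auto)
      then show "cascade_source n C u i t = - ext_src C n i x t"
        using i n by (simp add: cascade_source_def)
    qed
  qed
qed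

end

context cascade
begin

text \<open>A solution with \<open>p\<close> extra components is also one for any smaller number, so
  an estimate of the component \<open>n + k\<close> may be stated for \<open>msol k\<close>.\<close>

definition msol :: "nat \<Rightarrow> real \<Rightarrow> (nat \<Rightarrow> real \<Rightarrow> 'h) \<Rightarrow> (nat \<Rightarrow> real \<Rightarrow> 'h) \<Rightarrow> bool" where
  "msol p T x v \<longleftrightarrow> casc T (x, v) \<and>
     ext_sol C n p T x v"

text \<open>All initial energies are measured by the single scale \<open>s = sqrt S\<close>.
  \<open>rn_growth_ex\<close> carries it through the cascade, \<open>propagate\<close> through the
  remaining components, and the boundedness of \<open>q j\<close> turns uniform bounds on state and
  source into bounds on observations.\<close>

lemma direct_estimate:
  assumes n2: "n \<ge> 2" and T: "T > 0" and q: "\<And>j. j \<le> p \<Longrightarrow> obs_fun (q j)"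
  shows "\<exists>K>0. \<forall>x v. msol p T x v \<longrightarrow> (\<Sum>j=0..p. q j T (x (n+j)) (v (n+j)))
    \<le> K * ((\<Sum>i=1..n. (rn (n - i) (x, v) i 0)\<^sup>2) + (\<Sum>j=1..p. (norm (x (n+j) 0, v (n+j) 0))\<^sup>2))"
proof -
  obtain m where m: "n = Suc (Suc m)" using n2 by (cases n; cases "n - 1") auto
  obtain Ka where Ka: "Ka \<ge> 0" "\<And>y t. casc T y \<Longrightarrow> t \<in> {0..T} \<Longrightarrow>
    rn 1 y (Suc m) t \<le> Ka * (\<Sum>i=1..Suc m. rn (n - i) y i 0)"
    using rn_growth_ex[OF less_imp_le[OF T], of m] m by auto
  obtain Kb where Kb: "Kb \<ge> 0" "\<And>y t. casc T y \<Longrightarrow> t \<in> {0..T} \<Longrightarrow>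
    rn 0 y n t \<le> Kb * (\<Sum>i=1..n. rn (n - i) y i 0)"
    using rn_growth_ex[OF less_imp_le[OF T], of "Suc m"] m by auto
  define K0 where "K0 = (Ka + Kb) * real n"
  have K0: "K0 \<ge> 0" using Ka(1) Kb(1) by (simp add: K0_def)
  obtain K where K: "K \<ge> 0" and pg: "propagates C n p T K0 1 K"
    using propagate[OF less_imp_le[OF T] K0 zero_le_one, of n p C] n2 by auto
  \<comment> \<open>Bounds the sources of all observed components relative to \<open>s\<close>:
    \<open>K\<close> for those beyond \<open>n\<close>, and \<open>M * K0\<close> for the
    \<open>n\<close>-th, whose source is the coupling with the component
    \<open>n - 1\<close>.\<close>
  define L where "L = K + M * K0"
  define bd where "bd j K \<longleftrightarrow> K \<ge> 0 \<and> (\<forall>f x v M L. cw T f x v \<longrightarrow> (\<forall>t\<in>{0..T}. norm (x t, v t) \<le> M) \<longrightarrow>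
       (\<forall>t\<in>{0..T}. norm (f t) \<le> L) \<longrightarrow> q j T x v \<le> K * (M\<^sup>2 + L\<^sup>2))" for j K
  have "\<exists>K. j \<le> p \<longrightarrow> bd j K" for j
  proof (cases "j \<le> p")
      case True
      obtain K where "K \<ge> 0" "\<And>f x v M L. cw T f x v \<Longrightarrow> (\<And>t. t \<in> {0..T} \<Longrightarrow> norm (x t, v t) \<le> M) \<Longrightarrow>
       (\<And>t. t \<in> {0..T} \<Longrightarrow> norm (f t) \<le> L) \<Longrightarrow> q j T x v \<le> K * (M\<^sup>2 + L\<^sup>2)"
        by (rule obs_fun_bound[OF q[OF True] T]) blast
      then show ?thesis unfolding bd_def by (intro exI[of _ K]) simp
  qed simp
  then obtain Q where QQ: "\<And>j. j \<le> p \<Longrightarrow> bd j (Q j)" by metis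
  have Q: "\<And>j. j \<le> p \<Longrightarrow> Q j \<ge> 0" "\<And>j f x v M L. j \<le> p \<Longrightarrow> cw T f x v \<Longrightarrow>
      (\<And>t. t \<in> {0..T} \<Longrightarrow> norm (x t, v t) \<le> M) \<Longrightarrow>
       (\<And>t. t \<in> {0..T} \<Longrightarrow> norm (f t) \<le> L) \<Longrightarrow> q j T x v \<le> Q j * (M\<^sup>2 + L\<^sup>2)"
    using QQ unfolding bd_def by simp_all
  define Z where "Z = (\<Sum>j=0..p. Q j * (K\<^sup>2 + L\<^sup>2))"
  have Z0: "Z \<ge> 0" unfolding Z_def using Q(1) by (intro sum_nonneg) simp
  show ?thesis
  proof (intro exI[of _ "Z + 1"] conjI allI impI)
    show "0 < Z + 1" using Z0 by simp
    fix x v assume sol: "msol p T x v"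
    then have ca: "casc T (x, v)"
      and ext: "ext_sol C n p T x v"
      unfolding msol_def by auto
    define S where "S = (\<Sum>i=1..n. (rn (n - i) (x, v) i 0)\<^sup>2) + (\<Sum>j=1..p. (norm (x (n+j) 0, v (n+j) 0))\<^sup>2)"
    define s where "s = sqrt S"
    have S1: "0 \<le> (\<Sum>i=1..n. (rn (n - i) (x, v) i 0)\<^sup>2)" "0 \<le> (\<Sum>j=1..p. (norm (x (n+j) 0, v (n+j) 0))\<^sup>2)"
      by (intro sum_nonneg; simp)+
    have S0: "S \<ge> 0" and s0: "s \<ge> 0" unfolding s_def S_def using S1 by simp_all
    have ri: "rn (n - i) (x, v) i 0 \<le> s" if "i \<in> {1..n}" for i
    proof -
      have "(rn (n - i) (x, v) i 0)\<^sup>2 \<le> (\<Sum>i=1..n. (rn (n - i) (x, v) i 0)\<^sup>2)"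
        by (rule member_le_sum[OF that]) auto
      then show ?thesis unfolding s_def using S1(2) by (intro real_le_rsqrt) (simp add: S_def)
    qed
    have xi: "norm (x i 0, v i 0) \<le> s" if "i \<in> {n+1..n+p}" for i
    proof -
      have "(norm (x (n+(i-n)) 0, v (n+(i-n)) 0))\<^sup>2 \<le> (\<Sum>j=1..p. (norm (x (n+j) 0, v (n+j) 0))\<^sup>2)"
        by (rule member_le_sum[of "i - n" "{1..p}" "\<lambda>j. (norm (x (n+j) 0, v (n+j) 0))\<^sup>2"]) (use that in auto)
      then show ?thesis unfolding s_def using S1(1) that by (intro real_le_rsqrt) (simp add: S_def)
    qed
    have b1: "norm (R (x (n - 1) t)) \<le> K0 * s" if t: "t \<in> {0..T}" for t
    proof -
      have "norm (R (x (n - 1) t)) \<le> rn 1 (x, v) (Suc m) t"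
        using norm_fst_le_rn[of 1 "(x, v)" "Suc m" t] m by simp
      also have "\<dots> \<le> Ka * (\<Sum>i=1..Suc m. rn (n - i) (x, v) i 0)" by (rule Ka(2)[OF ca t])
      also have "\<dots> \<le> Ka * (\<Sum>i=1..Suc m. s)" by (intro mult_left_mono sum_mono ri Ka(1)) (use m in auto)
      also have "\<dots> = Ka * (real (Suc m) * s)" by simp
      also have "\<dots> \<le> (Ka + Kb) * (real n * s)" using Ka(1) Kb(1) s0 m by (intro mult_mono) auto
      finally show ?thesis by (simp add: K0_def)
    qed
    have b2: "norm (x n t, v n t) \<le> K0 * s" if t: "t \<in> {0..T}" for t
    proof -
      have "norm (x n t, v n t) = rn 0 (x, v) n t" by (simp add: rn_def)
      also have "\<dots> \<le> Kb * (\<Sum>i=1..n. rn (n - i) (x, v) i 0)" by (rule Kb(2)[OF ca t])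
      also have "\<dots> \<le> Kb * (\<Sum>i=1..n. s)" by (intro mult_left_mono sum_mono ri Kb(1)) auto
      also have "\<dots> = Kb * (real n * s)" by simp
      also have "\<dots> \<le> (Ka + Kb) * (real n * s)" using Ka(1) Kb(1) s0 by (intro mult_mono) auto
      finally show ?thesis by (simp add: K0_def)
    qed
    have b3: "norm (x i 0, v i 0) \<le> 1 * s + 1 * L'"
      if "i \<in> {n+1..n+p}" "\<forall>t\<in>{0..T}. norm (ext_src C n i x t) \<le> L'" for i L'
    proof -
      have "0 \<le> L'" using that(2) T norm_ge_zero order_trans by (metis atLeastAtMost_iff less_imp_le order_refl)
      then show ?thesis using xi[OF that(1)] by simp
    qed
    have pr: "\<forall>t\<in>{0..T}. (\<forall>i\<in>{n..n+p}. norm (x i t, v i t) \<le> K * s) \<and>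
       (\<forall>i\<in>{n+1..n+p}. norm (ext_src C n i x t) \<le> K * s)"
      using pg s0 ext b1 b2 b3 by blast
    have KL: "K * s \<le> L * s" "M * (K0 * s) \<le> L * s"
    proof -
      have "0 \<le> M * K0" using M0 K0 by simp
      then have "K \<le> L" "M * K0 \<le> L" unfolding L_def using K by simp_all
      then show "K * s \<le> L * s" "M * (K0 * s) \<le> L * s"
        using s0 mult_right_mono[of K L s] mult_right_mono[of "M * K0" L s] by (simp_all add: mult.assoc)
    qed
    have "q j T (x (n+j)) (v (n+j)) \<le> Q j * (K\<^sup>2 + L\<^sup>2) * S" if j: "j \<in> {0..p}" for j
    proof -
      have Xj: "norm (x (n+j) t, v (n+j) t) \<le> K * s" if "t \<in> {0..T}" for t using pr that j by simp
      have "\<exists>f. cw T f (x (n+j)) (v (n+j)) \<and> (\<forall>t\<in>{0..T}. norm (f t) \<le> L * s)"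
      proof (cases "j = 0")
        case True
        have "norm (- C n (Suc m) (R (x (Suc m) t))) \<le> L * s" if "t \<in> {0..T}" for t
        proof -
          have "norm (- C n (Suc m) (R (x (Suc m) t))) \<le> M * norm (R (x (Suc m) t))"
            using CB[of "Suc m" 0 "R (x (Suc m) t)"] m by simp
          also have "\<dots> \<le> M * (K0 * s)" using b1[OF that] m by (intro mult_left_mono M0) simp
          also have "\<dots> \<le> L * s" by (rule KL)
          finally show ?thesis .
        qed
        moreover have "cw T (\<lambda>t. - C n (Suc m) (R (x (Suc m) t))) (x n) (v n)"
          using cascD[OF ca, of "Suc m"] m by simp
        ultimately show ?thesis using True by auto
      next
        case False
        have i: "n + j \<in> {n+1..n+p}" using False j by simp
        have "norm (- (\<Sum>k=n-1..n+j-1. C (n+j) k (R (x k t)))) \<le> L * s" if "t \<in> {0..T}" for t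
          unfolding norm_minus_cancel using pr that i KL(1) order_trans by blast
        then show ?thesis using bspec[OF ext i] by blast
      qed
      then obtain f where f: "cw T f (x (n+j)) (v (n+j))" "\<And>t. t \<in> {0..T} \<Longrightarrow> norm (f t) \<le> L * s" by blast
      have "q j T (x (n+j)) (v (n+j)) \<le> Q j * ((K * s)\<^sup>2 + (L * s)\<^sup>2)"
        by (rule Q(2)[OF _ f(1) Xj f(2)]) (use j in simp)
      also have "\<dots> = Q j * (K\<^sup>2 + L\<^sup>2) * S" using S0 by (simp add: s_def power_mult_distrib algebra_simps)
      finally show ?thesis .
    qed
    then have "(\<Sum>j=0..p. q j T (x (n+j)) (v (n+j))) \<le> (\<Sum>j=0..p. Q j * (K\<^sup>2 + L\<^sup>2) * S)" by (rule sum_mono)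
    also have "\<dots> = Z * S" unfolding Z_def by (simp add: sum_distrib_right)
    also have "\<dots> \<le> (Z + 1) * S" using S0 by (intro mult_right_mono) auto
    finally show "(\<Sum>j=0..p. q j T (x (n+j)) (v (n+j)))
      \<le> (Z + 1) * ((\<Sum>i=1..n. (rn (n - i) (x, v) i 0)\<^sup>2) + (\<Sum>j=1..p. (norm (x (n+j) 0, v (n+j) 0))\<^sup>2))"
      unfolding S_def .
  qed
qed

text \<open>Here the scale is the square root of the total observation \<open>S\<close>.
  Observability perturbed by a source bounds each initial state by its own observation plus the size
  of its source, and \<open>propagate\<close> resolves the dependence of the sources on the lower
  components.\<close>

lemma extension_estimate:
  assumes n2: "n \<ge> 2" and T: "T > 0" and q: "\<And>j. j \<le> k \<Longrightarrow> obs_fun (q j)" and K0: "K0 \<ge> 0"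
    and base: "\<And>x v t. casc T (x, v) \<Longrightarrow> t \<in> {0..T} \<Longrightarrow>
      norm (R (x (n - 1) t)) \<le> K0 * sqrt (q 0 T (x n) (v n)) \<and>
      norm (x n t, v n t) \<le> K0 * sqrt (q 0 T (x n) (v n))"
    and fo: "\<And>j. 1 \<le> j \<Longrightarrow> j \<le> k \<Longrightarrow>
      \<exists>r>0. \<forall>x v. cw T (\<lambda>t. 0) x v \<longrightarrow> r * (norm (x 0, v 0))\<^sup>2 \<le> q j T x v"
  shows "\<exists>\<rho>>0. \<forall>x v. msol k T x v \<longrightarrow>
     (norm (x (n+k) 0, v (n+k) 0))\<^sup>2 \<le> \<rho> * (\<Sum>l=0..k. q l T (x (n+l)) (v (n+l)))"
proof -
  define bd where "bd j b \<longleftrightarrow> b \<ge> 0 \<and> (\<forall>f x v L. cw T f x v \<longrightarrow> (\<forall>t\<in>{0..T}. norm (f t) \<le> L) \<longrightarrow>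
      norm (x 0, v 0) \<le> b * sqrt (q j T x v) + b * L)" for j and b :: real
  have "\<exists>b. 1 \<le> j \<longrightarrow> j \<le> k \<longrightarrow> bd j b" for j
  proof (cases "1 \<le> j \<and> j \<le> k")
      case True
      then have j: "1 \<le> j" "j \<le> k" by auto
      obtain r where r: "r > 0" "\<And>x v. cw T (\<lambda>t. 0) x v \<Longrightarrow> r * (norm (x 0, v 0))\<^sup>2 \<le> q j T x v"
        using fo[OF j] by blast
      obtain K where K: "K \<ge> 0" "\<And>f x v L. cw T f x v \<Longrightarrow> (\<And>t. t \<in> {0..T} \<Longrightarrow> norm (f t) \<le> L) \<Longrightarrow>
        r * (norm (x 0, v 0))\<^sup>2 \<le> 2 * q j T x v + K * L\<^sup>2"
        by (rule perturbed_observability[OF q[OF j(2)] T less_imp_le[OF r(1)] r(2)]) blast+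
      \<comment> \<open>The perturbed inequality is divided by \<open>r\<close> and its square root
        taken; one constant majorizes both coefficients.\<close>
      define b where "b = sqrt (2 / r) + sqrt (K / r)"
      have bb: "sqrt (2 / r) \<le> b" "sqrt (K / r) \<le> b" "b \<ge> 0" unfolding b_def using r K by simp_all
      have "norm (x 0, v 0) \<le> b * sqrt (q j T x v) + b * L"
        if w: "cw T f x v" and L: "\<forall>t\<in>{0..T}. norm (f t) \<le> L" for f x v L
      proof -
        have L0: "0 \<le> L" using L T norm_ge_zero order_trans by (metis atLeastAtMost_iff less_imp_le order_refl)
        have q0: "0 \<le> q j T x v" by (rule obs_fun_nonneg[OF q[OF j(2)] w T])
        have "(norm (x 0, v 0))\<^sup>2 \<le> (2 * q j T x v + K * L\<^sup>2) / r"
          using K(2)[OF w, of L] L r(1) by (simp add: field_simps)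
        also have "\<dots> = 2 / r * q j T x v + K / r * L\<^sup>2" by (simp add: add_divide_distrib)
        finally have "norm (x 0, v 0) \<le> sqrt (2 / r * q j T x v + K / r * L\<^sup>2)" by (rule real_le_rsqrt)
        also have "\<dots> \<le> sqrt (2 / r * q j T x v) + sqrt (K / r * L\<^sup>2)"
          by (rule sqrt_add_le_add_sqrt) (use q0 r K in auto)
        also have "\<dots> = sqrt (2 / r) * sqrt (q j T x v) + sqrt (K / r) * L"
          by (simp only: real_sqrt_mult real_sqrt_abs abs_of_nonneg[OF L0])
        also have "\<dots> \<le> b * sqrt (q j T x v) + b * L"
          using bb q0 L0 by (intro add_mono mult_right_mono) auto
        finally show ?thesis .
      qed
      then show ?thesis unfolding bd_def using bb(3) by blast
  qed blast
  then obtain \<beta> where \<beta>0: "\<And>j. 1 \<le> j \<Longrightarrow> j \<le> k \<Longrightarrow> bd j (\<beta> j)" by metis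
  have \<beta>: "\<And>j. 1 \<le> j \<Longrightarrow> j \<le> k \<Longrightarrow> \<beta> j \<ge> 0"
    "\<And>j f x v L. 1 \<le> j \<Longrightarrow> j \<le> k \<Longrightarrow> cw T f x v \<Longrightarrow> \<forall>t\<in>{0..T}. norm (f t) \<le> L \<Longrightarrow>
      norm (x 0, v 0) \<le> \<beta> j * sqrt (q j T x v) + \<beta> j * L"
    using \<beta>0 unfolding bd_def by blast+
  define K1 where "K1 = (\<Sum>j=1..k. \<beta> j)"
  have K1: "K1 \<ge> 0" unfolding K1_def using \<beta>(1) by (intro sum_nonneg) auto
  have \<beta>K1: "\<beta> j \<le> K1" if "1 \<le> j" "j \<le> k" for j
    unfolding K1_def by (rule member_le_sum) (use that \<beta>(1) in auto)
  obtain K where K: "K \<ge> 0" and pg: "propagates C n k T K0 K1 K"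
    using propagate[OF less_imp_le[OF T] K0 K1, of n k C] n2 by auto
  show ?thesis
  proof (intro exI[of _ "K\<^sup>2 + 1"] conjI allI impI)
    show "0 < K\<^sup>2 + 1" by (simp add: add_nonneg_pos)
    fix x v assume sol: "msol k T x v"
    then have ca: "casc T (x, v)"
      and ext: "ext_sol C n k T x v"
      unfolding msol_def by auto
    define S where "S = (\<Sum>l=0..k. q l T (x (n+l)) (v (n+l)))"
    have q0: "0 \<le> q l T (x (n+l)) (v (n+l))" if l: "l \<in> {0..k}" for l
    proof (cases "l = 0")
      case True
      obtain m where m: "n = Suc m" using n2 by (cases n) auto
      have "cw T (\<lambda>t. - C n m (R (x m t))) (x n) (v n)" using cascD[OF ca, of m] m by simp
      then show ?thesis using obs_fun_nonneg[OF q _ T] True by simp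
    next
      case False
      then have "n + l \<in> {n+1..n+k}" using l by simp
      from obs_fun_nonneg[OF q bspec[OF ext this] T, of l] show ?thesis using l by simp
    qed
    have ql: "sqrt (q l T (x (n+l)) (v (n+l))) \<le> sqrt S" if "l \<in> {0..k}" for l
      unfolding S_def by (intro real_sqrt_le_mono member_le_sum[OF that] q0) auto
    have S0: "S \<ge> 0" unfolding S_def by (intro sum_nonneg q0)
    have "K0 * sqrt (q 0 T (x n) (v n)) \<le> K0 * sqrt S" using ql[of 0] by (intro mult_left_mono K0) simp
    then have b1: "\<forall>t\<in>{0..T}. norm (R (x (n - 1) t)) \<le> K0 * sqrt S"
      and b2: "\<forall>t\<in>{0..T}. norm (x n t, v n t) \<le> K0 * sqrt S"
      using base[OF ca] order_trans by blast+
    have b3: "norm (x i 0, v i 0) \<le> K1 * sqrt S + K1 * L"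
      if i: "i \<in> {n+1..n+k}" and L: "\<forall>t\<in>{0..T}. norm (ext_src C n i x t) \<le> L" for i L
    proof -
      define j where "j = i - n"
      have j: "1 \<le> j" "j \<le> k" "n + j = i" using i unfolding j_def by auto
      have L0: "0 \<le> L" using L T norm_ge_zero order_trans by (metis atLeastAtMost_iff less_imp_le order_refl)
      have "norm (x i 0, v i 0) \<le> \<beta> j * sqrt (q j T (x i) (v i)) + \<beta> j * L"
        by (rule \<beta>(2)[OF j(1,2) bspec[OF ext i]]) (use L in simp)
      also have "\<dots> \<le> K1 * sqrt S + K1 * L"
        using ql[of j] j \<beta>K1[OF j(1,2)] \<beta>(1)[OF j(1,2)] K1 L0 q0[of j]
        by (intro add_mono mult_mono) auto
      finally show ?thesis .
    qed
    have s0: "0 \<le> sqrt S" using S0 by simp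
    have "\<forall>t\<in>{0..T}. (\<forall>i\<in>{n..n+k}. norm (x i t, v i t) \<le> K * sqrt S) \<and>
       (\<forall>i\<in>{n+1..n+k}. norm (ext_src C n i x t) \<le> K * sqrt S)"
      using pg s0 ext b1 b2 b3 by blast
    then have "norm (x (n+k) 0, v (n+k) 0) \<le> K * sqrt S" using T by simp
    then have "(norm (x (n+k) 0, v (n+k) 0))\<^sup>2 \<le> (K * sqrt S)\<^sup>2" by (rule power_mono) simp
    also have "\<dots> = K\<^sup>2 * S" using S0 by (simp add: power_mult_distrib)
    also have "\<dots> \<le> (K\<^sup>2 + 1) * S" using S0 by (intro mult_right_mono) auto
    finally show "(norm (x (n+k) 0, v (n+k) 0))\<^sup>2 \<le> (K\<^sup>2 + 1) * (\<Sum>l=0..k. q l T (x (n+l)) (v (n+l)))"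
      unfolding S_def .
  qed
qed

end

theorem theorem3p2:
  fixes A :: "('h::{real_inner, complete_space} \<times> 'h) set"
    and \<omega> :: real
    and n p :: nat
    and C :: "nat \<Rightarrow> nat \<Rightarrow> 'h \<Rightarrow>\<^sub>L 'h"
    and P :: "nat \<Rightarrow> 'h \<Rightarrow>\<^sub>L 'h"
    and G :: "nat \<Rightarrow> 'g::{real_inner, complete_space} set"
    and B :: "nat \<Rightarrow> 'h \<times> 'h \<Rightarrow> 'g"
  assumes "self_adjoint A" and "positive_op A" and "compact_resolvent A"
    and "\<omega> > 0" and "\<forall>u\<in>Domain A. norm (op_app A u) \<ge> \<omega> * norm u"
    and "n \<ge> 2" and "p \<ge> 1"
    and "coupling_hyp A n C P"
    and "coupling_observable A n P"
    and "\<forall>i\<in>{n + 1..n + p}. \<forall>j\<in>{n - 1..i - 1}. \<forall>k\<in>{0, 1}.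
           bounded_on_Hsp A k (blinfun_apply (C i j)) \<and>
           bounded_on_Hsp A k (adjoint (blinfun_apply (C i j)))"
    and "\<forall>j\<in>{0..p}. admissible A (G (n + j)) (B (n + j)) \<and> observable A (B (n + j))"
  shows
    "(\<forall>T>0. \<exists>K>0. \<forall>u v. mixed_cascade_sol A n p C T u v \<longrightarrow>
        (\<Sum>j = 0..p. observed A (B (n + j)) T (cascade_source n C u (n + j)) (u (n + j)) (v (n + j)))
        \<le> K * ((\<Sum>i = 1..n. energy A (1 + int i - int n) (u i 0) (v i 0))
               + (\<Sum>j = 1..p. energy A 1 (u (n + j) 0) (v (n + j) 0)))) \<and>
     (\<exists>Tstar>0. \<exists>(d :: nat \<Rightarrow> real \<Rightarrow> real) (\<rho> :: nat \<Rightarrow> real \<Rightarrow> real) (K :: real).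
        \<forall>T>Tstar.
          (\<forall>i\<in>{1..n}. d i T > 0) \<and>
          (\<forall>i\<in>{1..n - 1}. d i T \<le> K / T ^ 3) \<and>
          d n T \<le> K / T \<and>
          (\<forall>k\<in>{1..p}. \<rho> k T > 0) \<and>
          (\<forall>u v. mixed_cascade_sol A n p C T u v \<longrightarrow>
             (\<forall>i\<in>{1..n}. energy A (1 + int i - int n) (u i 0) (v i 0)
                \<le> d i T * observed A (B n) T (cascade_source n C u n) (u n) (v n)) \<and>
             (\<forall>k\<in>{1..p}. energy A 1 (u (n + k) 0) (v (n + k) 0)
                \<le> \<rho> k T *
                   (\<Sum>l = 0..k. observed A (B (n + l)) T (cascade_source n C u (n + l))
                                  (u (n + l)) (v (n + l))))))"
proof -
  note H = assms
  obtain E a c D where "wave E a c A D" using wave_exists[OF H(1-5)] by blast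
  then interpret wave E a c A D .
  have n2: "n \<ge> 2" by (rule H(6))
  have coup: "\<forall>k\<in>{0..n - i + 1}. bounded_on_Hsp A k (adjoint (blinfun_apply (C i (i - 1))))"
    "\<exists>\<alpha>>0. \<forall>w. \<alpha> * (norm (P i w))\<^sup>2 \<le> C i (i - 1) w \<bullet> w" if "i \<in> {2..n}" for i
    using H(8) that unfolding coupling_hyp_def by blast+
  have "\<exists>b\<ge>0. \<forall>x. norm ((R ^^ k) (C (Suc j) j x)) \<le> b * norm ((R ^^ k) x)"
    if "1 \<le> j" "j < n" "k \<le> n - j" for j k
  proof (rule adjoint_bounded_imp_negative_order_bound)
    show "bounded_on_Hsp A k (adjoint (blinfun_apply (C (Suc j) j)))"
      using coup(1)[of "Suc j"] that by simp
  qed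
  then have "\<forall>j k. \<exists>b. 1 \<le> j \<longrightarrow> j < n \<longrightarrow> k \<le> n - j \<longrightarrow>
      b \<ge> 0 \<and> (\<forall>x. norm ((R ^^ k) (C (Suc j) j x)) \<le> b * norm ((R ^^ k) x))" by blast
  then obtain b where b: "\<And>j k. 1 \<le> j \<Longrightarrow> j < n \<Longrightarrow> k \<le> n - j \<Longrightarrow>
      b j k \<ge> 0 \<and> (\<forall>x. norm ((R ^^ k) (C (Suc j) j x)) \<le> b j k * norm ((R ^^ k) x))" by metis
  \<comment> \<open>Only finitely many pairs of coupling and order occur, so the sum is a common
    bound.\<close>
  define M where "M = (\<Sum>j\<le>n. \<Sum>k\<le>n. \<bar>b j k\<bar>)"
  interpret cascade E a c A D n C M
  proof
    show "M \<ge> 0" unfolding M_def by (intro sum_nonneg) simp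
    fix j k x assume j: "1 \<le> j" "j < n" "k \<le> n - j"
    have "\<bar>b j k\<bar> \<le> (\<Sum>k\<le>n. \<bar>b j k\<bar>)" by (rule member_le_sum) (use j in auto)
    also have "\<dots> \<le> M" unfolding M_def
      by (rule member_le_sum[of j _ "\<lambda>j. \<Sum>k\<le>n. \<bar>b j k\<bar>"]) (use j in \<open>auto intro: sum_nonneg\<close>)
    finally have "b j k * norm ((R ^^ k) x) \<le> M * norm ((R ^^ k) x)" by (intro mult_right_mono) auto
    then show "norm ((R ^^ k) (C (Suc j) j x)) \<le> M * norm ((R ^^ k) x)" using b[OF j] order_trans by blast
  qed
  have co: "\<exists>\<alpha>>0. \<forall>w. \<alpha> * (norm (P (Suc j) w))\<^sup>2 \<le> C (Suc j) j w \<bullet> w" if "1 \<le> j" "j < n" for j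
    using coup(2)[of "Suc j"] that by simp
  have foP: "free_observable (qP (P (Suc j)))" if "1 \<le> j" "j < n" for j
    by (rule free_observable_qP) (use H(9) that in \<open>unfold coupling_observable_def, auto\<close>)
  have adm: "admissible A (G (n + j)) (B (n + j))" and obs: "observable A (B (n + j))" if "j \<le> p" for j
    using H(11) that by auto
  define q where "q j = qB (B (n + j))" for j
  have qo: "obs_fun (q j)" and qf: "free_observable (q j)" if "j \<le> p" for j
    unfolding q_def using obs_fun_qB[OF adm[OF that]] free_observable_qB[OF adm[OF that] obs[OF that]] by auto
  define ob where "ob T u v j = observed A (B (n + j)) T (cascade_source n C u (n + j)) (u (n + j)) (v (n + j))" for T u v j
  \<comment> \<open>Dictionary between the quantities of the statement and the spectral variables;
    the factor \<open>1/2\<close> is that of the energies.\<close>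
  have sol: "\<exists>x. msol p T x v \<and> (\<forall>i\<in>{1..n}. energy A (1 + int i - int n) (u i 0) (v i 0) = 1/2 * (rn (n - i) (x, v) i 0)\<^sup>2) \<and>
      (\<forall>j\<in>{1..p}. energy A 1 (u (n + j) 0) (v (n + j) 0) = 1/2 * (norm (x (n + j) 0, v (n + j) 0))\<^sup>2) \<and>
      (\<forall>j\<in>{0..p}. ob T u v j = q j T (x (n + j)) (v (n + j)))"
    if T: "T > 0" and uv: "mixed_cascade_sol A n p C T u v" for T u v
  proof -
    obtain x where x: "x 0 = (\<lambda>t. 0)"
      "\<And>i t. i \<in> {1..n+p} \<Longrightarrow> t \<in> {0..T} \<Longrightarrow> u i t = R (x i t)"
      "\<And>i. i \<in> {1..n+p} \<Longrightarrow> cw T (cascade_source n C u i) (x i) (v i)"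
      "\<And>j. j < n \<Longrightarrow> cw T (\<lambda>t. - C (Suc j) j (R (x j t))) (x (Suc j)) (v (Suc j))"
      "\<And>i. i \<in> {n+1..n+p} \<Longrightarrow> cw T (\<lambda>t. - ext_src C n i x t) (x i) (v i)"
      by (rule mixed_cascade_sol_cw[OF n2 uv]) blast
    have "msol p T x v" unfolding msol_def casc_def using x(1,4,5) by simp
    moreover have "energy A (1 + int i - int n) (u i 0) (v i 0) = 1/2 * (rn (n - i) (x, v) i 0)\<^sup>2" if i: "i \<in> {1..n}" for i
    proof -
      have k: "1 + int i - int n = 1 - int (n - i)" using i by (simp add: of_nat_diff)
      have "u i 0 = R (x i 0)" by (rule x(2)) (use i T in auto)
      then show ?thesis unfolding k rn_def fst_conv snd_conv by (simp only: energy_eq)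
    qed
    moreover have "energy A 1 (u (n + j) 0) (v (n + j) 0) = 1/2 * (norm (x (n + j) 0, v (n + j) 0))\<^sup>2" if j: "j \<in> {1..p}" for j
    proof -
      have "u (n + j) 0 = R (x (n + j) 0)" by (rule x(2)) (use j T in auto)
      then show ?thesis using energy1 by simp
    qed
    moreover have "ob T u v j = q j T (x (n + j)) (v (n + j))" if j: "j \<in> {0..p}" for j
    proof -
      have i: "n + j \<in> {1..n+p}" and jp: "j \<le> p" using j n2 by auto
      have "ob T u v j = observed A (B (n + j)) T (cascade_source n C u (n + j)) (\<lambda>t. R (x (n + j) t)) (v (n + j))"
        unfolding ob_def by (rule observed_cong[OF less_imp_le[OF T] x(2)[OF i]])
      then show ?thesis unfolding q_def using qB_lim(2)[OF adm[OF jp] T x(3)[OF i]] by simp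
    qed
    ultimately show ?thesis by blast
  qed
  have direct: "\<exists>K>0. \<forall>u v. mixed_cascade_sol A n p C T u v \<longrightarrow>
        (\<Sum>j = 0..p. ob T u v j)
        \<le> K * ((\<Sum>i = 1..n. energy A (1 + int i - int n) (u i 0) (v i 0))
               + (\<Sum>j = 1..p. energy A 1 (u (n + j) 0) (v (n + j) 0)))" if T: "T > 0" for T
  proof -
    obtain K where K: "K > 0" "\<And>x v. msol p T x v \<Longrightarrow> (\<Sum>j=0..p. q j T (x (n+j)) (v (n+j)))
      \<le> K * ((\<Sum>i=1..n. (rn (n - i) (x, v) i 0)\<^sup>2) + (\<Sum>j=1..p. (norm (x (n+j) 0, v (n+j) 0))\<^sup>2))"
      using direct_estimate[OF n2 T, of p q] qo by blast
    \<comment> \<open>The factor 2 undoes the \<open>1/2\<close> in the energies.\<close>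
    show ?thesis
    proof (intro exI[of _ "2 * K"] conjI allI impI)
      fix u v assume "mixed_cascade_sol A n p C T u v"
      from sol[OF T this] obtain x where x: "msol p T x v"
        "\<forall>i\<in>{1..n}. energy A (1 + int i - int n) (u i 0) (v i 0) = 1/2 * (rn (n - i) (x, v) i 0)\<^sup>2"
        "\<forall>j\<in>{1..p}. energy A 1 (u (n + j) 0) (v (n + j) 0) = 1/2 * (norm (x (n + j) 0, v (n + j) 0))\<^sup>2"
        "\<forall>j\<in>{0..p}. ob T u v j = q j T (x (n + j)) (v (n + j))" by blast
      have e1: "(\<Sum>i=1..n. (rn (n - i) (x, v) i 0)\<^sup>2) = 2 * (\<Sum>i = 1..n. energy A (1 + int i - int n) (u i 0) (v i 0))"
        unfolding sum_distrib_left by (rule sum.cong[OF refl]) (drule bspec[OF x(2)], simp)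
      have e2: "(\<Sum>j=1..p. (norm (x (n+j) 0, v (n+j) 0))\<^sup>2) = 2 * (\<Sum>j = 1..p. energy A 1 (u (n + j) 0) (v (n + j) 0))"
        unfolding sum_distrib_left by (rule sum.cong[OF refl]) (drule bspec[OF x(3)], simp)
      have e3: "(\<Sum>j = 0..p. ob T u v j) = (\<Sum>j=0..p. q j T (x (n+j)) (v (n+j)))"
        by (rule sum.cong) (use x(4) in simp_all)
      show "(\<Sum>j = 0..p. ob T u v j)
        \<le> 2 * K * ((\<Sum>i = 1..n. energy A (1 + int i - int n) (u i 0) (v i 0))
               + (\<Sum>j = 1..p. energy A 1 (u (n + j) 0) (v (n + j) 0)))"
        using K(2)[OF x(1)] unfolding e1 e2 e3 by (simp add: algebra_simps)
    qed (use K(1) in simp)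
  qed
  obtain K T1 where K: "K > 0" "T1 \<ge> 1"
    "\<And>T p t. T \<ge> T1 \<Longrightarrow> casc T p \<Longrightarrow> t \<in> {0..T} \<Longrightarrow> (rn 0 p n t)\<^sup>2 \<le> K / T * q 0 T (fst p n) (snd p n)"
    "\<And>T p t i. T \<ge> T1 \<Longrightarrow> casc T p \<Longrightarrow> t \<in> {0..T} \<Longrightarrow> 1 \<le> i \<Longrightarrow> i < n \<Longrightarrow>
       (rn (n - i) p i t)\<^sup>2 \<le> K / T^3 * q 0 T (fst p n) (snd p n)"
    by (rule top_estimate[OF n2 co foP qo[of 0] qf[of 0]]) (assumption | simp)+
  define td where "td j t \<longleftrightarrow> t > 0 \<and> (\<forall>T>t. \<exists>r>0. \<forall>x v. cw T (\<lambda>t. 0) x v \<longrightarrow>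
     r * (norm (x 0, v 0))\<^sup>2 \<le> q j T x v)" for j and t :: real
  have "\<exists>t. td j t" if "j \<le> p" for j using qf[OF that] unfolding free_observable_def td_def .
  then obtain T0 where td: "\<And>j. j \<le> p \<Longrightarrow> td j (T0 j)" by metis
  have T0: "\<And>j. j \<le> p \<Longrightarrow> T0 j > 0" "\<And>j T. j \<le> p \<Longrightarrow> T > T0 j \<Longrightarrow>
     \<exists>r>0. \<forall>x v. cw T (\<lambda>t. 0) x v \<longrightarrow> r * (norm (x 0, v 0))\<^sup>2 \<le> q j T x v"
    using td unfolding td_def by blast+
  \<comment> \<open>Dominates \<open>T1\<close> and every threshold \<open>T0 j\<close> at once, all
    summands being positive.\<close>
  define Ts where "Ts = T1 + (\<Sum>j\<le>p. T0 j)"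
  have T0s: "0 \<le> (\<Sum>j\<le>p. T0 j)" using T0(1) by (intro sum_nonneg) (simp add: less_imp_le)
  have Ts: "Ts > 0" "T1 \<le> Ts" using K(2) T0s unfolding Ts_def by simp_all
  have TT0: "T > T0 j" if "T > Ts" "j \<le> p" for T j
  proof -
    have "T0 j \<le> (\<Sum>j\<le>p. T0 j)" by (rule member_le_sum) (use that T0(1) in \<open>auto simp: less_imp_le\<close>)
    then show ?thesis using that(1) K(2) unfolding Ts_def by linarith
  qed
  \<comment> \<open>\<open>K\<close> is the constant of \<open>top_estimate\<close>, obtained before
    any choice of \<open>T\<close>.\<close>
  define d where "d i T = (if i = n then K / T else K / T^3)" for i :: nat and T :: real
  have low: "energy A (1 + int i - int n) (u i 0) (v i 0) \<le> d i T * ob T u v 0"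
    if T: "T > Ts" and uv: "mixed_cascade_sol A n p C T u v" and i: "i \<in> {1..n}" for T u v i
  proof -
    have Tp: "T > 0" "T \<ge> T1" using T Ts by linarith+
    from sol[OF Tp(1) uv] obtain x where x: "msol p T x v"
        "\<forall>i\<in>{1..n}. energy A (1 + int i - int n) (u i 0) (v i 0) = 1/2 * (rn (n - i) (x, v) i 0)\<^sup>2"
        "\<forall>j\<in>{0..p}. ob T u v j = q j T (x (n + j)) (v (n + j))" by blast
    have ca: "casc T (x, v)" using x(1) unfolding msol_def by blast
    have q0: "ob T u v 0 = q 0 T (x n) (v n)" using x(3) by simp
    have t0: "0 \<in> {0..T}" using Tp by simp
    have "(rn (n - i) (x, v) i 0)\<^sup>2 \<le> d i T * ob T u v 0"
    proof (cases "i = n")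
      case True
      then show ?thesis using K(3)[OF Tp(2) ca t0] by (simp add: d_def q0)
    next
      case False
      then show ?thesis using K(4)[OF Tp(2) ca t0, of i] i by (simp add: d_def q0)
    qed
    moreover have "0 \<le> (rn (n - i) (x, v) i 0)\<^sup>2" by simp
    ultimately show ?thesis unfolding bspec[OF x(2) i] by linarith
  qed
  have "\<exists>r>0. \<forall>u v. mixed_cascade_sol A n p C T u v \<longrightarrow>
      energy A 1 (u (n + k) 0) (v (n + k) 0) \<le> r * (\<Sum>l=0..k. ob T u v l)"
    if T: "T > Ts" and k: "k \<in> {1..p}" for T k
  proof -
    have Tp: "T > 0" "T \<ge> T1" using T Ts by linarith+
    have kp: "k \<le> p" using k by simp
    \<comment> \<open>Roots of the two bounds of \<open>top_estimate\<close>: \<open>K / T^3\<close>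
      for the displacement of the component \<open>n - 1\<close>, \<open>K / T\<close> for the
      component \<open>n\<close>.\<close>
    define K0 where "K0 = sqrt (K / T) + sqrt (K / T^3)"
    have kk: "0 \<le> sqrt (K / T)" "0 \<le> sqrt (K / T^3)" using K(1) Tp by simp_all
    have "\<exists>\<rho>>0. \<forall>x v. msol k T x v \<longrightarrow>
      (norm (x (n+k) 0, v (n+k) 0))\<^sup>2 \<le> \<rho> * (\<Sum>l=0..k. q l T (x (n+l)) (v (n+l)))"
    proof (rule extension_estimate[OF n2 Tp(1)])
      show "obs_fun (q j)" if "j \<le> k" for j using qo that kp by simp
      show "K0 \<ge> 0" using kk by (simp add: K0_def)
      show "\<exists>r>0. \<forall>x v. cw T (\<lambda>t. 0) x v \<longrightarrow> r * (norm (x 0, v 0))\<^sup>2 \<le> q j T x v" if "1 \<le> j" "j \<le> k" for j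
        using T0(2)[of j T] TT0[OF T, of j] that kp by simp
      fix x v t assume ca: "casc T (x, v)" and t: "t \<in> {0..T}"
      let ?q = "q 0 T (x n) (v n)"
      obtain m where m: "n = Suc m" using n2 by (cases n) auto
      have "cw T (\<lambda>t. - C n m (R (x m t))) (x n) (v n)" using cascD[OF ca, of m] m by simp
      then have q0: "?q \<ge> 0" using obs_fun_nonneg[OF qo[of 0] _ Tp(1)] by simp
      have "rn 1 (x, v) (n - 1) t \<le> sqrt (K / T^3 * ?q)"
        using K(4)[OF Tp(2) ca t, of "n - 1"] n2 by (intro real_le_rsqrt) simp
      then have r1: "rn 1 (x, v) (n - 1) t \<le> sqrt (K / T^3) * sqrt ?q" by (simp only: real_sqrt_mult)
      have "rn 0 (x, v) n t \<le> sqrt (K / T * ?q)" using K(3)[OF Tp(2) ca t] by (intro real_le_rsqrt) simp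
      then have r2: "rn 0 (x, v) n t \<le> sqrt (K / T) * sqrt ?q" by (simp only: real_sqrt_mult)
      have s: "sqrt (K / T^3) * sqrt ?q \<le> K0 * sqrt ?q" "sqrt (K / T) * sqrt ?q \<le> K0 * sqrt ?q"
        using kk q0 unfolding K0_def by (intro mult_right_mono; simp)+
      have "norm (R (x (n - 1) t)) \<le> K0 * sqrt ?q"
        using norm_fst_le_rn[of 1 "(x, v)" "n - 1" t] r1 s(1) by simp
      moreover have "norm (x n t, v n t) \<le> K0 * sqrt ?q" using r2 s(2) by (simp add: rn_def)
      ultimately show "norm (R (x (n - 1) t)) \<le> K0 * sqrt ?q \<and> norm (x n t, v n t) \<le> K0 * sqrt ?q" ..
    qed
    then obtain r where r: "r > 0" "\<And>x v. msol k T x v \<Longrightarrow>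
      (norm (x (n+k) 0, v (n+k) 0))\<^sup>2 \<le> r * (\<Sum>l=0..k. q l T (x (n+l)) (v (n+l)))" by blast
    show ?thesis
    proof (intro exI[of _ r] conjI allI impI r(1))
      fix u v assume "mixed_cascade_sol A n p C T u v"
      from sol[OF Tp(1) this] obtain x where x: "msol p T x v"
        "\<forall>j\<in>{1..p}. energy A 1 (u (n + j) 0) (v (n + j) 0) = 1/2 * (norm (x (n + j) 0, v (n + j) 0))\<^sup>2"
        "\<forall>j\<in>{0..p}. ob T u v j = q j T (x (n + j)) (v (n + j))" by blast
      \<comment> \<open>Forgetting the components above \<open>n + k\<close> leaves only the
        observations up to index \<open>k\<close> on the right-hand side.\<close>
      have "msol k T x v" using x(1) kp unfolding msol_def by simp
      from r(2)[OF this] have "(norm (x (n+k) 0, v (n+k) 0))\<^sup>2 \<le> r * (\<Sum>l=0..k. q l T (x (n+l)) (v (n+l)))" .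
      also have "(\<Sum>l=0..k. q l T (x (n+l)) (v (n+l))) = (\<Sum>l=0..k. ob T u v l)"
        by (rule sum.cong) (use x(3) kp in simp_all)
      finally have "(norm (x (n+k) 0, v (n+k) 0))\<^sup>2 \<le> r * (\<Sum>l=0..k. ob T u v l)" .
      moreover have "0 \<le> (norm (x (n+k) 0, v (n+k) 0))\<^sup>2" by simp
      ultimately show "energy A 1 (u (n + k) 0) (v (n + k) 0) \<le> r * (\<Sum>l=0..k. ob T u v l)"
        unfolding bspec[OF x(2) k] by linarith
    qed
  qed
  then have "\<forall>k T. \<exists>r. T > Ts \<longrightarrow> k \<in> {1..p} \<longrightarrow> r > 0 \<and> (\<forall>u v. mixed_cascade_sol A n p C T u v \<longrightarrow>
      energy A 1 (u (n + k) 0) (v (n + k) 0) \<le> r * (\<Sum>l=0..k. ob T u v l))" by blast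
  then obtain \<rho> where \<rho>: "\<And>k T. T > Ts \<Longrightarrow> k \<in> {1..p} \<Longrightarrow> \<rho> k T > 0 \<and> (\<forall>u v. mixed_cascade_sol A n p C T u v \<longrightarrow>
      energy A 1 (u (n + k) 0) (v (n + k) 0) \<le> \<rho> k T * (\<Sum>l=0..k. ob T u v l))" by metis
  have ob0: "observed A (B n) T (cascade_source n C u n) (u n) (v n) = ob T u v 0" for T u v
    by (simp add: ob_def)
  show ?thesis
  proof (intro conjI)
    show "\<forall>T>0. \<exists>K>0. \<forall>u v. mixed_cascade_sol A n p C T u v \<longrightarrow>
        (\<Sum>j = 0..p. observed A (B (n + j)) T (cascade_source n C u (n + j)) (u (n + j)) (v (n + j)))
        \<le> K * ((\<Sum>i = 1..n. energy A (1 + int i - int n) (u i 0) (v i 0))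
               + (\<Sum>j = 1..p. energy A 1 (u (n + j) 0) (v (n + j) 0)))"
      unfolding ob_def[symmetric] using direct by blast
    show "\<exists>Tstar>0. \<exists>(d :: nat \<Rightarrow> real \<Rightarrow> real) (\<rho> :: nat \<Rightarrow> real \<Rightarrow> real) (K :: real).
        \<forall>T>Tstar.
          (\<forall>i\<in>{1..n}. d i T > 0) \<and>
          (\<forall>i\<in>{1..n - 1}. d i T \<le> K / T ^ 3) \<and>
          d n T \<le> K / T \<and>
          (\<forall>k\<in>{1..p}. \<rho> k T > 0) \<and>
          (\<forall>u v. mixed_cascade_sol A n p C T u v \<longrightarrow>
             (\<forall>i\<in>{1..n}. energy A (1 + int i - int n) (u i 0) (v i 0)
                \<le> d i T * observed A (B n) T (cascade_source n C u n) (u n) (v n)) \<and>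
             (\<forall>k\<in>{1..p}. energy A 1 (u (n + k) 0) (v (n + k) 0)
                \<le> \<rho> k T *
                   (\<Sum>l = 0..k. observed A (B (n + l)) T (cascade_source n C u (n + l))
                                  (u (n + l)) (v (n + l)))))"
      unfolding ob_def[symmetric] ob0
    proof (rule exI[of _ Ts], rule conjI[OF Ts(1)], rule exI[of _ d], rule exI[of _ \<rho>], rule exI[of _ K],
        intro allI impI conjI ballI)
      fix T assume T: "T > Ts"
      then have Tp: "T > 0" using Ts by linarith
      show "d i T > 0" for i using K(1) Tp by (simp add: d_def)
      show "d i T \<le> K / T^3" if "i \<in> {1..n - 1}" for i using that n2 by (auto simp: d_def)
      show "d n T \<le> K / T" by (simp add: d_def)
      show "\<rho> k T > 0" if "k \<in> {1..p}" for k using \<rho>[OF T that] by blast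
      fix u v assume uv: "mixed_cascade_sol A n p C T u v"
      show "energy A (1 + int i - int n) (u i 0) (v i 0) \<le> d i T * ob T u v 0" if "i \<in> {1..n}" for i
        by (rule low[OF T uv that])
      show "energy A 1 (u (n + k) 0) (v (n + k) 0) \<le> \<rho> k T * (\<Sum>l = 0..k. ob T u v l)" if "k \<in> {1..p}" for k
        using \<rho>[OF T that] uv by blast
    qed
  qed
qed

end
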